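(* Let $T>0$, $k\in\mathbb{N}^*$ and let $(\omega_j)_{j\in\mathbb{N}}$ be a strictly increasing sequence of $[0,+\infty)$ such that $\omega_0=0$ and such that there exist $\varepsilon>0$, $N_0\in\mathbb{N}$ and $c>0$ with $\omega_{j+1}-\omega_j\ge cj^{\varepsilon}$ for all $j\ge N_0$. There exist a constant $C>0$ and a continuous linear map $\mathcal{M}^T_k:h^{2k}_{\omega,r}(\mathbb{N},\mathbb{C})\to H^k_0((0,T),\mathbb{R})$ such that for every $d=(d_j)_{j\in\mathbb{N}}\in h^{2k}_{\omega,r}(\mathbb{N},\mathbb{C})$, the control $u:=\mathcal{M}^T_k(d)\in H^k_0((0,T),\mathbb{R})$ satisfies the moment problem $$\int_0^Tu(t)e^{i\omega_jt}dt=d_j,\qquad\forall j\in\mathbb{N},$$ with the boundary conditions $$u_2(T)=u_3(T)=\dots=u_{k+1}(T)=0,$$ and the size estimates $$\|u\|_{H^m_0(0,T)}\le C\|d\|_{h^{2m}_\omega(\mathbb{N},\mathbb{C})},\qquad\forall m=-(k+1),\dots,0,\dots,k.$$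
   Context: $\mathbb{N}=\{0,1,2,\dots\}$, $\mathbb{N}^*=\{1,2,\dots\}$. For $m\in\mathbb{N}$, $h^{2m}_{\omega,r}(\mathbb{N},\mathbb{C})$ is the real vector space of $(d_j)_{j\in\mathbb{N}}\in\ell^2(\mathbb{N},\mathbb{C})$ with $d_0\in\mathbb{R}$ and $\|d\|^2_{h^{2m}_\omega}:=\sum_{j=0}^{+\infty}|(\delta_{j,0}+\omega_j^m)d_j|^2<+\infty$, with this norm ($\delta$ is the Kronecker symbol, $0^0=1$). For a negative integer $m$, $\|d\|_{h^{2m}_\omega}$ is given by the same formula, the weight at $j=0$ being $1$: $\|d\|_{h^{2m}_\omega}^2=|d_0|^2+\sum_{j\ge1}|\omega_j^{m}d_j|^2$. For $u\in L^1(0,T)$, $u_0:=u$ and $u_{n+1}(t):=\int_0^tu_n(\tau)d\tau$. For $m\in\mathbb{N}$, $H^m_0(0,T)$ is the closure of $C_c^\infty(0,T)$ in $H^m(0,T)$ with norm $\|u\|_{H^m_0(0,T)}=\|u^{(m)}\|_{L^2(0,T)}$ (for $m=0$ it is $L^2(0,T)$). For a negative integer $m=-n$ and $u\in L^2(0,T)$, $\|u\|_{H^m_0(0,T)}$ means $\|u\|_{H^{-n}(0,T)}:=|u_1(T)|+\|u_n\|_{L^2(0,T)}$. Linear means $\mathbb{R}$-linear. *)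

theory Defs
  imports "HOL-Analysis.Analysis"
begin

subsection \<open>The weighted sequence spaces\<close>

text \<open>
  The weight \<open>\<delta>\<^bsub>j,0\<^esub> + \<omega>\<^sub>j\<^sup>m\<close> of the \<open>h\<^sup>2\<^sup>m\<close>-norm, for an integer \<open>m\<close>. As \<open>x powi 0 = 1\<close>, the
  convention \<open>0\<^sup>0 = 1\<close> is respected (so for \<open>m = 0\<close> the weight at \<open>j = 0\<close> is \<open>2\<close>).
  For negative \<open>m\<close> the weight at \<open>j = 0\<close> is \<open>1\<close> by convention.
\<close>
definition h_weight :: "(nat \<Rightarrow> real) \<Rightarrow> int \<Rightarrow> nat \<Rightarrow> real" where
  "h_weight \<omega> m j =
     (if m < 0 \<and> j = 0 then 1 else (if j = 0 then 1 else 0) + \<omega> j powi m)"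

definition h_norm :: "(nat \<Rightarrow> real) \<Rightarrow> int \<Rightarrow> (nat \<Rightarrow> complex) \<Rightarrow> real" where
  "h_norm \<omega> m d = sqrt (\<Sum>j. (cmod (of_real (h_weight \<omega> m j) * d j))\<^sup>2)"

definition h_space :: "(nat \<Rightarrow> real) \<Rightarrow> nat \<Rightarrow> (nat \<Rightarrow> complex) set" where
  "h_space \<omega> m =
     {d. summable (\<lambda>j. (cmod (d j))\<^sup>2) \<and> d 0 \<in> \<real> \<and>
         summable (\<lambda>j. (cmod (of_real (h_weight \<omega> (int m) j) * d j))\<^sup>2)}"


subsection \<open>Sobolev spaces of real functions on \<open>(0,T)\<close>\<close>

text \<open>
  Elements of function spaces on \<open>(0,T)\<close> are represented by functions \<open>real \<Rightarrow> real\<close>, of which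
  only the almost-everywhere class on \<open>(0,T)\<close> is relevant.
\<close>

abbreviation leb :: "real \<Rightarrow> real measure" where
  "leb T \<equiv> lebesgue_on {0<..<T}"

definition L2_space :: "real \<Rightarrow> (real \<Rightarrow> real) set" where
  "L2_space T = {u \<in> borel_measurable (leb T). integrable (leb T) (\<lambda>t. (u t)\<^sup>2)}"

definition L2_norm :: "real \<Rightarrow> (real \<Rightarrow> real) \<Rightarrow> real" where
  "L2_norm T u = sqrt (LINT t|leb T. (u t)\<^sup>2)"

text \<open>\<open>C\<^sub>c\<^sup>\<infinity>(0,T)\<close>, with its elements extended by zero to the whole line.\<close>
definition test_funs :: "real \<Rightarrow> (real \<Rightarrow> real) set" where
  "test_funs T =
     {\<phi>. (\<forall>n x. (deriv ^^ n) \<phi> field_differentiable (at x)) \<and>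
         (\<exists>K. compact K \<and> K \<subseteq> {0<..<T} \<and> (\<forall>x. x \<notin> K \<longrightarrow> \<phi> x = 0))}"

definition has_weak_deriv :: "real \<Rightarrow> nat \<Rightarrow> (real \<Rightarrow> real) \<Rightarrow> (real \<Rightarrow> real) \<Rightarrow> bool" where
  "has_weak_deriv T n u v \<longleftrightarrow> v \<in> L2_space T \<and>
     (\<forall>\<phi>\<in>test_funs T.
        (LINT t|leb T. u t * (deriv ^^ n) \<phi> t) = (-1) ^ n * (LINT t|leb T. v t * \<phi> t))"

text \<open>A representative of the weak derivative, which is unique up to null sets if it exists.\<close>
definition weak_deriv :: "real \<Rightarrow> nat \<Rightarrow> (real \<Rightarrow> real) \<Rightarrow> (real \<Rightarrow> real)" where
  "weak_deriv T n u = (SOME v. has_weak_deriv T n u v)"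

definition sobolev :: "real \<Rightarrow> nat \<Rightarrow> (real \<Rightarrow> real) set" where
  "sobolev T m = {u \<in> L2_space T. \<forall>n\<le>m. \<exists>v. has_weak_deriv T n u v}"

definition sobolev_norm :: "real \<Rightarrow> nat \<Rightarrow> (real \<Rightarrow> real) \<Rightarrow> real" where
  "sobolev_norm T m u = sqrt (\<Sum>n\<le>m. (L2_norm T (weak_deriv T n u))\<^sup>2)"

definition sobolev0 :: "real \<Rightarrow> nat \<Rightarrow> (real \<Rightarrow> real) set" where
  "sobolev0 T m =
     {u \<in> sobolev T m. \<exists>\<phi>. (\<forall>n::nat. \<phi> n \<in> test_funs T) \<and>
        (\<lambda>n. sobolev_norm T m (\<lambda>t. \<phi> n t - u t)) \<longlonglongrightarrow> 0}"

primrec iter_prim :: "(real \<Rightarrow> real) \<Rightarrow> nat \<Rightarrow> real \<Rightarrow> real" where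
  "iter_prim u 0 = u"
| "iter_prim u (Suc n) = (\<lambda>t. LINT \<tau>|lebesgue_on {0<..<t}. iter_prim u n \<tau>)"

text \<open>The norm \<open>\<parallel>\<cdot>\<parallel>\<close> of \<open>H\<^sup>m\<^sub>0(0,T)\<close> for \<open>m \<ge> 0\<close>, and of \<open>H\<^sup>m(0,T)\<close> for \<open>m < 0\<close>.\<close>
definition H0_norm :: "real \<Rightarrow> int \<Rightarrow> (real \<Rightarrow> real) \<Rightarrow> real" where
  "H0_norm T m u =
     (if 0 \<le> m then L2_norm T (weak_deriv T (nat m) u)
      else \<bar>iter_prim u 1 T\<bar> + L2_norm T (iter_prim u (nat (- m))))"


subsection \<open>Continuous \<open>\<real>\<close>-linear maps from \<open>h\<^sup>2\<^sup>k\<close> to \<open>H\<^sup>k\<^sub>0(0,T)\<close>\<close>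

definition linear_h_H0 ::
  "(nat \<Rightarrow> real) \<Rightarrow> real \<Rightarrow> nat \<Rightarrow> ((nat \<Rightarrow> complex) \<Rightarrow> (real \<Rightarrow> real)) \<Rightarrow> bool" where
  "linear_h_H0 \<omega> T k M \<longleftrightarrow>
     (\<forall>d\<in>h_space \<omega> k. M d \<in> sobolev0 T k) \<and>
     (\<forall>d\<in>h_space \<omega> k. \<forall>e\<in>h_space \<omega> k.
        AE t in leb T. M (\<lambda>j. d j + e j) t = M d t + M e t) \<and>
     (\<forall>a::real. \<forall>d\<in>h_space \<omega> k.
        AE t in leb T. M (\<lambda>j. of_real a * d j) t = a * M d t)"

definition continuous_h_H0 ::
  "(nat \<Rightarrow> real) \<Rightarrow> real \<Rightarrow> nat \<Rightarrow> ((nat \<Rightarrow> complex) \<Rightarrow> (real \<Rightarrow> real)) \<Rightarrow> bool" where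
  "continuous_h_H0 \<omega> T k M \<longleftrightarrow>
     (\<forall>d\<in>h_space \<omega> k. \<forall>\<epsilon>>0. \<exists>\<delta>>0. \<forall>e\<in>h_space \<omega> k.
        h_norm \<omega> (int k) (\<lambda>j. e j - d j) < \<delta> \<longrightarrow>
        H0_norm T (int k) (\<lambda>t. M e t - M d t) < \<epsilon>)"

end

theory Submission
  imports Defs
begin

text \<open>
  The moment problem is solved by an explicit biorthogonal family whose members have controlled
  derivatives and primitives. Put \<open>\<lambda>\<^sub>j = sgn(j) \<omega>\<^bsub>|j|\<^esub>\<close> for every integer \<open>j\<close>. The gap assumption gives
  \<open>|\<lambda>\<^sub>a - \<lambda>\<^sub>b| \<ge> \<gamma> |a - b|\<^sup>s\<close> with \<open>s > 1\<close> (\<open>signed_freq_gap\<close>), so the sums of \<open>1/|\<lambda>\<^sub>a - \<lambda>\<^sub>l|\<close> over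
  \<open>a \<noteq> l\<close> converge uniformly in \<open>l\<close>.

  A frequency \<open>\<mu>\<close> is removed from a compactly supported function \<open>f\<close> at little cost by the average
  \<open>(f(t) + f(t - \<pi>/|\<mu>|))/2\<close>: the Fourier transform is multiplied by a factor that vanishes at \<open>\<mu>\<close>
  and equals \<open>1\<close> at \<open>0\<close>, the support grows by \<open>\<pi>/|\<mu>|\<close>, and no supremum norm of a derivative
  increases. Infinitely many averages with summable shifts converge to a smooth function; the
  finitely many frequencies whose shifts would be too long for \<open>(0,T)\<close> are removed by
  \<open>f + f'/(i\<mu>)\<close> instead. This yields smooth \<open>\<Phi>\<^sub>l\<close> supported in \<open>[T/4, 3T/4]\<close> whose transform is \<open>1\<close> at
  \<open>0\<close> and \<open>0\<close> at all \<open>\<lambda>\<^sub>a - \<lambda>\<^sub>l\<close>, \<open>a \<noteq> l\<close>, with derivative bounds independent of \<open>l\<close>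
  (\<open>kernel_with_prescribed_zeros\<close>).

  For \<open>l \<ge> 1\<close> let \<open>\<Psi>\<^sub>l\<close> be the \<open>(k+1)\<close>-st derivative of \<open>e\<^bsup>-i\<omega>\<^sub>l t\<^esup> \<Phi>\<^sub>l(t)\<close>, divided by
  \<open>(-i\<omega>\<^sub>l)\<^bsup>k+1\<^esup>\<close>. Its transform is \<open>1\<close> at \<open>\<omega>\<^sub>l\<close> and \<open>0\<close> at every other \<open>\<plusminus>\<omega>\<^sub>j\<close>, its first \<open>k+1\<close>
  primitives are compactly supported, and its derivative of order \<open>m\<close> (a primitive if \<open>m < 0\<close>) is
  \<open>e\<^bsup>-i\<omega>\<^sub>l t\<^esup> \<omega>\<^sub>l\<^sup>m\<close> times a function bounded together with its derivative, uniformly in \<open>l\<close>. For \<open>l = 0\<close>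
  the integral of \<open>\<Psi>\<^sub>0\<close> is \<open>1\<close>, so its primitives cannot be compactly supported; subtracting
  derivatives from \<open>\<Phi>\<^sub>0\<close> makes those of orders \<open>2, \<dots>, k+1\<close> vanish at \<open>T\<close>
  (\<open>kill_primitives_at_endpoint\<close>, \<open>biorthogonal_family\<close>).

  The control is \<open>u = Re (d\<^sub>0 \<Psi>\<^sub>0 + 2 \<Sum>\<^bsub>l\<ge>1\<^esub> d\<^sub>l \<Psi>\<^sub>l)\<close>. All size estimates are the same Bessel inequality,
  applied at the different orders \<open>m\<close>: one integration by parts shows that the Gram matrix of the
  \<open>m\<close>-th derivatives, rescaled by \<open>\<omega>\<^sub>l\<^sup>m\<close>, has entries \<open>O(|l-j|\<^sup>-\<^sup>s)\<close>, and Schur's test applies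
  (\<open>bessel_biorthogonal_family\<close>). For \<open>m \<ge> 0\<close> the partial sums are test functions that are Cauchy in
  \<open>H\<^sup>k\<close>; completeness of \<open>L\<^sup>2\<close> and uniqueness of weak derivatives then place \<open>u\<close> in \<open>H\<^sup>k\<^sub>0\<close>
  (\<open>sobolev0_limit\<close>). Moments and primitives pass to the limit by dominated convergence, since
  \<open>k \<ge> 1\<close> makes the coefficients \<open>d\<^sub>l\<close> absolutely summable (\<open>coef_summable\<close>).
\<close>

section \<open>Jets of smooth functions\<close>

text \<open>
  A smooth function is carried together with all its derivatives: \<open>F p\<close> is the \<open>p\<close>-th derivative of
  \<open>F 0\<close>. Linear operations, translations, limits and shifts of the index then act on the whole
  sequence at once, and an index shift downwards describes primitives.
\<close>
definition jet :: "(nat \<Rightarrow> real \<Rightarrow> 'a::real_normed_vector) \<Rightarrow> bool" where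
  "jet F \<longleftrightarrow> (\<forall>p t. (F p has_vector_derivative F (Suc p) t) (at t))"

lemma jetD: "jet F \<Longrightarrow> (F p has_vector_derivative F (Suc p) t) (at t)"
  by (simp add: jet_def)

lemma jet_continuous_on: "jet F \<Longrightarrow> continuous_on S (F p)"
  by (meson has_vector_derivative_continuous jet_def continuous_at_imp_continuous_on)

lemma jet_shift_order: "jet F \<Longrightarrow> jet (\<lambda>p. F (p + n))"
  by (simp add: jet_def)

lemma jet_linear_comb:
  fixes F G :: "nat \<Rightarrow> real \<Rightarrow> complex"
  assumes "jet F" "jet G"
  shows "jet (\<lambda>p t. F p t + c * G p t)"
  unfolding jet_def
proof (intro allI)
  fix p t
  show "((\<lambda>t. F p t + c * G p t) has_vector_derivative F (Suc p) t + c * G (Suc p) t) (at t)"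
    by (intro has_vector_derivative_add has_vector_derivative_mult_right jetD assms)
qed

text \<open>
  If the increments are summable uniformly at each order of derivation, then the limits of the
  derivatives are the derivatives of the limit.
\<close>
lemma uniform_limit_jet:
  fixes F :: "nat \<Rightarrow> nat \<Rightarrow> real \<Rightarrow> complex"
  assumes jet: "\<And>n. jet (F n)"
    and step: "\<And>n p t. norm (F (Suc n) p t - F n p t) \<le> h n * B p"
    and h: "summable h"
  obtains G where "jet G" "\<And>p. uniform_limit UNIV (\<lambda>n. F n p) (G p) sequentially"
proof -
  define G where "G p t = F 0 p t + (\<Sum>i. F (Suc i) p t - F i p t)" for p t
  have lim: "uniform_limit UNIV (\<lambda>n. F n p) (G p) sequentially" for p
  proof -
    have "summable (\<lambda>n. h n * B p)"
      by (intro summable_mult2 h)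
    then have "uniform_limit UNIV (\<lambda>n t. \<Sum>i<n. F (Suc i) p t - F i p t)
                 (\<lambda>t. \<Sum>i. F (Suc i) p t - F i p t) sequentially"
      using step by (intro Weierstrass_m_test) auto
    then have "uniform_limit UNIV (\<lambda>n t. F 0 p t + (\<Sum>i<n. F (Suc i) p t - F i p t)) (G p) sequentially"
      unfolding G_def by (intro uniform_limit_intros)
    moreover have "F 0 p t + (\<Sum>i<n. F (Suc i) p t - F i p t) = F n p t" for n t
      by (induction n) (simp_all add: add_diff_eq)
    ultimately show ?thesis by simp
  qed
  have "jet G"
    unfolding jet_def
  proof (intro allI)
    fix p t
    have "\<exists>g. \<forall>x\<in>UNIV. (\<lambda>n. F n p x) \<longlonglongrightarrow> g x \<and> (g has_derivative (\<lambda>y. y *\<^sub>R G (Suc p) x)) (at x within UNIV)"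
    proof (rule has_derivative_sequence[where f' = "\<lambda>n x y. y *\<^sub>R F n (Suc p) x" and ?x0.0 = 0 and l = "G p 0"])
      show "(F n p has_derivative (\<lambda>y. y *\<^sub>R F n (Suc p) x)) (at x within UNIV)" for n x
        using jetD[OF jet[of n], of p x] by (simp add: has_vector_derivative_def)
      show "\<forall>\<^sub>F n in sequentially. \<forall>x\<in>UNIV. \<forall>y. norm (y *\<^sub>R F n (Suc p) x - y *\<^sub>R G (Suc p) x) \<le> e * norm y"
        if "e > 0" for e
      proof -
        have "\<forall>\<^sub>F n in sequentially. \<forall>x\<in>UNIV. dist (F n (Suc p) x) (G (Suc p) x) < e"
          using lim[of "Suc p"] that by (rule uniform_limitD)
        then show ?thesis
        proof eventually_elim
          case (elim n)
          have "norm (y *\<^sub>R F n (Suc p) x - y *\<^sub>R G (Suc p) x) \<le> e * norm y" for x y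
          proof -
            have "norm (y *\<^sub>R F n (Suc p) x - y *\<^sub>R G (Suc p) x) = norm y * norm (F n (Suc p) x - G (Suc p) x)"
              by (metis norm_scaleR real_norm_def scaleR_diff_right)
            also have "\<dots> \<le> norm y * e"
              using elim by (intro mult_left_mono) (auto simp: dist_norm less_imp_le)
            finally show ?thesis by (simp add: mult.commute)
          qed
          then show ?case by blast
        qed
      qed
      show "(\<lambda>n. F n p 0) \<longlonglongrightarrow> G p 0"
        using tendsto_uniform_limitI[OF lim] by simp
    qed auto
    then obtain g where g: "\<And>x. (\<lambda>n. F n p x) \<longlonglongrightarrow> g x"
      and gd: "\<And>x. (g has_derivative (\<lambda>y. y *\<^sub>R G (Suc p) x)) (at x)"
      by auto
    have "g = G p"
      by (intro ext LIMSEQ_unique[OF g tendsto_uniform_limitI[OF lim]]) simp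
    then show "(G p has_vector_derivative G (Suc p) t) (at t)"
      using gd by (simp add: has_vector_derivative_def)
  qed
  then show ?thesis using that lim by blast
qed

section \<open>Fourier integrals over a bounded interval\<close>

definition fourier :: "real \<Rightarrow> (real \<Rightarrow> complex) \<Rightarrow> real \<Rightarrow> complex" where
  "fourier T f \<xi> = integral {0..T} (\<lambda>t. f t * cis (\<xi> * t))"

definition supported :: "real \<Rightarrow> real \<Rightarrow> (nat \<Rightarrow> real \<Rightarrow> 'a::zero) \<Rightarrow> bool" where
  "supported a b F \<longleftrightarrow> (\<forall>p t. t \<notin> {a..b} \<longrightarrow> F p t = 0)"

lemma fourier_integrable:
  assumes "continuous_on {0..T} f"
  shows "(\<lambda>t. f t * cis (\<xi> * t)) integrable_on {0..T}"
  by (intro integrable_continuous_real continuous_intros assms)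

lemma fourier_linear_comb:
  assumes "continuous_on {0..T} f" "continuous_on {0..T} g"
  shows "fourier T (\<lambda>t. f t + c * g t) \<xi> = fourier T f \<xi> + c * fourier T g \<xi>"
proof -
  have "fourier T (\<lambda>t. f t + c * g t) \<xi> =
     integral {0..T} (\<lambda>t. f t * cis (\<xi> * t) + c * (g t * cis (\<xi> * t)))"
    unfolding fourier_def by (simp add: algebra_simps)
  also have "\<dots> = fourier T f \<xi> + c * fourier T g \<xi>"
    unfolding fourier_def
    by (subst integral_add) (auto intro!: fourier_integrable assms integrable_on_mult_right)
  finally show ?thesis .
qed

lemma fourier_shift:
  assumes F: "jet F" "supported a b F" and ab: "0 \<le> a" "b + h \<le> T" "0 \<le> h"
  shows "fourier T (\<lambda>t. F p (t - h)) \<xi> = cis (\<xi> * h) * fourier T (F p) \<xi>"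
proof -
  define g where "g t = F p t * cis (\<xi> * t)" for t
  have "continuous_on {a..b} g"
    unfolding g_def by (intro continuous_intros jet_continuous_on F)
  then obtain I where I: "(g has_integral I) {a..b}"
    using integrable_continuous_real integrable_on_def by blast
  have g0: "g t = 0" if "t \<notin> {a..b}" for t
    using F that by (auto simp: supported_def g_def)
  have 1: "(g has_integral I) {0..T}"
    using I g0 ab by (rule_tac has_integral_on_superset) auto
  have "(g has_integral I) {0 + (-h)..T + (-h)}"
    using I g0 ab by (rule_tac has_integral_on_superset[of _ _ "{a..b}"]) auto
  then have "((g \<circ> ((+) (-h))) has_integral I) {0..T}"
    by (subst has_integral_shift_Icc_real)
  then have "((\<lambda>t. cis (\<xi> * h) * (g \<circ> ((+) (-h))) t) has_integral cis (\<xi> * h) * I) {0..T}"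
    by (rule has_integral_mult_right)
  moreover have "cis (\<xi> * h) * (g \<circ> ((+) (-h))) t = F p (t - h) * cis (\<xi> * t)" for t
  proof -
    have "cis (\<xi> * h) * cis (\<xi> * (t - h)) = cis (\<xi> * t)"
      by (simp add: cis_mult algebra_simps)
    then show ?thesis
      by (simp add: g_def mult.left_commute)
  qed
  ultimately have "((\<lambda>t. F p (t - h) * cis (\<xi> * t)) has_integral cis (\<xi> * h) * I) {0..T}"
    by simp
  then show ?thesis
    using integral_unique[OF 1] unfolding fourier_def g_def by (simp add: integral_unique)
qed

text \<open>
  The boundary terms of the integration by parts vanish because the support is inside \<open>(0,T)\<close>.
\<close>
lemma fourier_deriv:
  assumes F: "jet F" "supported a b F" and ab: "0 < a" "b < T" "0 \<le> T"
  shows "fourier T (F (Suc p)) \<xi> = - \<i> * of_real \<xi> * fourier T (F p) \<xi>"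
proof -
  have "((\<lambda>t. F (Suc p) t * cis (\<xi> * t) + \<i> * of_real \<xi> * (F p t * cis (\<xi> * t)))
         has_integral (F p T * cis (\<xi> * T) - F p 0 * cis (\<xi> * 0))) {0..T}"
  proof (rule fundamental_theorem_of_calculus)
    fix t
    have "((\<lambda>x. cis (\<xi> * x)) has_vector_derivative \<i> * of_real \<xi> * cis (\<xi> * t)) (at t within {0..T})"
    proof -
      have "((\<lambda>x. exp (\<i> * of_real \<xi> * x)) has_field_derivative \<i> * of_real \<xi> * exp (\<i> * of_real \<xi> * of_real t)) (at (of_real t))"
        by (auto intro!: derivative_eq_intros)
      from has_vector_derivative_real_field[OF this] show ?thesis
        by (simp add: cis_conv_exp mult.assoc)
    qed
    from has_vector_derivative_mult[OF has_vector_derivative_at_within[OF jetD[OF F(1)]] this]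
    show "((\<lambda>t. F p t * cis (\<xi> * t)) has_vector_derivative
       F (Suc p) t * cis (\<xi> * t) + \<i> * of_real \<xi> * (F p t * cis (\<xi> * t))) (at t within {0..T})"
      by (simp add: algebra_simps)
  qed (use ab in auto)
  moreover have "F p T = 0" "F p 0 = 0"
    using F(2) ab by (auto simp: supported_def)
  ultimately have "integral {0..T} (\<lambda>t. F (Suc p) t * cis (\<xi> * t) + \<i> * of_real \<xi> * (F p t * cis (\<xi> * t))) = 0"
    by (simp add: integral_unique)
  then have "fourier T (F (Suc p)) \<xi> + \<i> * of_real \<xi> * fourier T (F p) \<xi> = 0"
    unfolding fourier_def
    by (subst (asm) integral_add)
       (auto intro!: fourier_integrable integrable_on_mult_right jet_continuous_on F)
  then show ?thesis
    by (simp add: eq_neg_iff_add_eq_0)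
qed

lemma fourier_deriv_iterated:
  assumes "jet F" "supported a b F" "0 < a" "b < T" "0 \<le> T"
  shows "fourier T (F p) \<xi> = (- \<i> * of_real \<xi>) ^ p * fourier T (F 0) \<xi>"
  by (induction p) (simp_all add: fourier_deriv[OF assms] mult_ac)

lemma fourier_modulate:
  "fourier T (\<lambda>t. cis (- (w * t)) * f t) \<xi> = fourier T f (\<xi> - w)"
proof -
  have "cis (- (w * t)) * f t * cis (\<xi> * t) = f t * cis ((\<xi> - w) * t)" for t
  proof -
    have "cis (- (w * t)) * f t * cis (\<xi> * t) = f t * (cis (- (w * t)) * cis (\<xi> * t))"
      by (simp only: mult_ac)
    also have "cis (- (w * t)) * cis (\<xi> * t) = cis ((\<xi> - w) * t)"
      by (simp only: cis_mult) (simp add: algebra_simps)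
    finally show ?thesis .
  qed
  then show ?thesis unfolding fourier_def by (simp only:)
qed

lemma fourier_uniform_limit:
  assumes "uniform_limit UNIV F f sequentially" "\<And>n. continuous_on UNIV (F n)"
  shows "(\<lambda>n. fourier T (F n) \<xi>) \<longlonglongrightarrow> fourier T f \<xi>"
proof -
  let ?e = "\<lambda>t::real. cis (\<xi> * t)"
  have "uniform_limit {0..T} (\<lambda>n t. F n t * ?e t) (\<lambda>t. f t * ?e t) sequentially"
  proof (rule uniform_limitI)
    fix e :: real assume "e > 0"
    have "\<forall>\<^sub>F n in sequentially. \<forall>x\<in>UNIV. dist (F n x) (f x) < e"
      by (rule uniform_limitD[OF assms(1) \<open>e > 0\<close>])
    then show "\<forall>\<^sub>F n in sequentially. \<forall>x\<in>{0..T}. dist (F n x * ?e x) (f x * ?e x) < e"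
      by eventually_elim (simp add: dist_norm norm_mult left_diff_distrib[symmetric] )
  qed
  moreover have "continuous_on {0..T} (\<lambda>t. F n t * ?e t)" for n
    by (intro continuous_intros continuous_on_subset[OF assms(2)]) auto
  ultimately obtain I J where "\<And>n. ((\<lambda>t. F n t * ?e t) has_integral I n) {0..T}"
    "((\<lambda>t. f t * ?e t) has_integral J) {0..T}" "I \<longlonglongrightarrow> J"
    by (rule uniform_limit_integral) auto
  moreover have "integral {0..T} (\<lambda>t. F n t * ?e t) = I n" for n
    using calculation(1) by (rule integral_unique)
  moreover have "integral {0..T} (\<lambda>t. f t * ?e t) = J"
    using calculation(2) by (rule integral_unique)
  ultimately show ?thesis
    unfolding fourier_def by simp
qed

section \<open>Removing frequencies\<close>

text \<open>
  The average of a function with its translate by \<open>h\<close> multiplies the transform at \<open>\<xi>\<close> by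
  \<open>(1 + e\<^bsup>i\<xi>h\<^esup>)/2\<close>. This is \<open>0\<close> at \<open>\<xi> = \<plusminus>\<pi>/h\<close> and \<open>1\<close> at \<open>\<xi> = 0\<close>.
\<close>
definition avg :: "real \<Rightarrow> (nat \<Rightarrow> real \<Rightarrow> complex) \<Rightarrow> nat \<Rightarrow> real \<Rightarrow> complex" where
  "avg h F p t = (F p t + F p (t - h)) / 2"

lemma jet_avg: "jet F \<Longrightarrow> jet (avg h F)"
  unfolding jet_def avg_def
proof (intro allI)
  fix p t assume F: "\<forall>p t. (F p has_vector_derivative F (Suc p) t) (at t)"
  have "((F p \<circ> (\<lambda>t. t - h)) has_vector_derivative 1 *\<^sub>R F (Suc p) (t - h)) (at t)"
    by (rule vector_diff_chain_at) (use F in \<open>auto intro!: derivative_eq_intros\<close>)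
  then have "((\<lambda>t. F p (t - h)) has_vector_derivative F (Suc p) (t - h)) (at t)"
    by (simp add: o_def)
  then show "((\<lambda>t. (F p t + F p (t - h)) / 2) has_vector_derivative (F (Suc p) t + F (Suc p) (t - h)) / 2) (at t)"
    using F by (auto intro!: derivative_eq_intros)
qed

lemma avg_bound:
  assumes "\<And>p t. norm (F p t) \<le> B p"
  shows "norm (avg h F p t) \<le> B p"
proof -
  have "norm (F p t + F p (t - h)) \<le> B p + B p"
    by (meson assms add_mono norm_triangle_le)
  then show ?thesis by (simp add: avg_def norm_divide)
qed

lemma avg_increment:
  assumes F: "jet F" and B: "\<And>p t. norm (F p t) \<le> B p" and "h \<ge> 0"
  shows "norm (avg h F p t - F p t) \<le> h * B (Suc p)"
proof -
  have "norm (avg h F p t - F p t) = norm (F p (t - h) - F p t) / 2"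
  proof -
    have "avg h F p t - F p t = (F p (t - h) - F p t) / 2"
      by (simp add: avg_def field_simps)
    then show ?thesis by (simp only: norm_divide) simp
  qed
  moreover have "norm (F p (t - h) - F p t) \<le> B (Suc p) * norm ((t - h) - t)"
  proof (rule differentiable_bound[where S = UNIV and f' = "\<lambda>x y. y *\<^sub>R F (Suc p) x"])
    show "(F p has_derivative (\<lambda>y. y *\<^sub>R F (Suc p) x)) (at x within UNIV)" for x
      using jetD[OF F, of p x] by (simp add: has_vector_derivative_def)
    show "onorm (\<lambda>y. y *\<^sub>R F (Suc p) x) \<le> B (Suc p)" for x
      using B[of "Suc p" x] by (intro onorm_le) (simp add: mult.commute mult_left_mono)
  qed auto
  moreover have "B (Suc p) * h \<ge> 0"
    using B norm_ge_zero order_trans assms(3) by (metis mult_nonneg_nonneg)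
  ultimately show ?thesis
    using \<open>h \<ge> 0\<close> by (simp add: mult.commute)
qed


lemma fourier_avg:
  assumes F: "jet F" "supported a b F" and ab: "0 \<le> a" "b + h \<le> T" "0 \<le> h"
  shows "fourier T (avg h F p) \<xi> = (1 + cis (\<xi> * h)) / 2 * fourier T (F p) \<xi>"
proof -
  have c: "continuous_on {0..T} (\<lambda>t. F p (t - h))"
    by (rule continuous_on_compose2[OF jet_continuous_on[OF F(1), of UNIV]]) (auto intro!: continuous_intros)
  have "fourier T (avg h F p) \<xi> = (1 / 2) * fourier T (\<lambda>t. F p t + 1 * F p (t - h)) \<xi>"
    unfolding fourier_def avg_def integral_mult_right[symmetric]
    by (rule arg_cong[where f = "integral {0..T}"]) (simp add: fun_eq_iff field_simps)
  also have "\<dots> = (1 / 2) * (fourier T (F p) \<xi> + 1 * fourier T (\<lambda>t. F p (t - h)) \<xi>)"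
    by (subst fourier_linear_comb) (auto intro!: jet_continuous_on F c)
  finally show ?thesis
    using fourier_shift[OF F ab, of p \<xi>] by (simp add: algebra_simps)
qed

lemma supported_avg:
  assumes "supported a b F" "h \<ge> 0"
  shows "supported a (b + h) (avg h F)"
  using assms by (auto simp: supported_def avg_def)

primrec avg_seq :: "(nat \<Rightarrow> real) \<Rightarrow> (nat \<Rightarrow> real \<Rightarrow> complex) \<Rightarrow> nat \<Rightarrow> nat \<Rightarrow> real \<Rightarrow> complex" where
  "avg_seq h F 0 = F"
| "avg_seq h F (Suc n) = avg (h n) (avg_seq h F n)"

lemma supported_mono: "supported a b F \<Longrightarrow> b \<le> b' \<Longrightarrow> supported a b' F"
  by (force simp: supported_def)

text \<open>
  By \<open>avg_increment\<close> the \<open>n\<close>-th average changes each derivative by at most \<open>h n\<close> times a bound on the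
  next one, and averaging preserves all bounds; summable shifts therefore give convergence at every
  order. A zero of the transform, once created, survives all later averages.
\<close>
lemma infinite_averaging:
  assumes F: "jet F" "supported a b F" and B: "\<And>p t. norm (F p t) \<le> B p"
    and h: "\<And>n. h n \<ge> 0" "summable h" and ab: "0 \<le> a" "b + suminf h \<le> b'" "b' \<le> T"
  obtains G where "jet G" "supported a b' G" "\<And>p t. norm (G p t) \<le> B p"
    "fourier T (G 0) 0 = fourier T (F 0) 0"
    "\<And>\<xi>. fourier T (F 0) \<xi> = 0 \<Longrightarrow> fourier T (G 0) \<xi> = 0"
    "\<And>\<xi> n. cis (\<xi> * h n) = -1 \<Longrightarrow> fourier T (G 0) \<xi> = 0"
proof -
  let ?S = "avg_seq h F"
  have le: "b + sum h {..<n} \<le> b'" for n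
    using sum_le_suminf[OF h(2), of "{..<n}"] h(1) ab(2) by auto
  have jet: "jet (?S n)" for n
    by (induction n) (auto intro: F jet_avg)
  have bnd: "norm (?S n p t) \<le> B p" for n p t
    by (induction n arbitrary: p t) (auto intro: B avg_bound)
  have supp': "supported a (b + sum h {..<n}) (?S n)" for n
  proof (induction n)
    case (Suc n)
    then show ?case using supported_avg[OF Suc h(1)[of n]] by (simp add: add.assoc)
  qed (use F in simp)
  have supp: "supported a b' (?S n)" for n
    using supp' le by (rule supported_mono)
  have fou: "fourier T (?S (Suc n) 0) \<xi> = (1 + cis (\<xi> * h n)) / 2 * fourier T (?S n 0) \<xi>" for n \<xi>
    using fourier_avg[OF jet supp' ab(1) _ h(1), of n n T 0 \<xi>] le[of "Suc n"] ab(3)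
    by (simp add: add.assoc)
  have "norm (?S (Suc n) p t - ?S n p t) \<le> h n * B (Suc p)" for n p t
    using avg_increment[OF jet bnd h(1)] by simp
  then obtain G where G: "jet G" "\<And>p. uniform_limit UNIV (\<lambda>n. ?S n p) (G p) sequentially"
    using uniform_limit_jet[of ?S h "\<lambda>p. B (Suc p)"] jet h(2) by blast
  have lim: "(\<lambda>n. ?S n p t) \<longlonglongrightarrow> G p t" for p t
    using tendsto_uniform_limitI[OF G(2)] by simp
  have flim: "(\<lambda>n. fourier T (?S n 0) \<xi>) \<longlonglongrightarrow> fourier T (G 0) \<xi>" for \<xi>
    by (rule fourier_uniform_limit[OF G(2)]) (intro jet_continuous_on jet)
  have stay: "fourier T (?S (m + n) 0) \<xi> = 0" if "fourier T (?S m 0) \<xi> = 0" for m n \<xi>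
    by (induction n) (simp_all add: that fou del: avg_seq.simps(2))
  have zero: "fourier T (G 0) \<xi> = 0" if "fourier T (?S m 0) \<xi> = 0" for m \<xi>
  proof -
    have "(\<lambda>n. fourier T (?S (n + m) 0) \<xi>) \<longlonglongrightarrow> fourier T (G 0) \<xi>"
      using flim by (rule LIMSEQ_ignore_initial_segment)
    moreover have "(\<lambda>n. fourier T (?S (n + m) 0) \<xi>) = (\<lambda>n. 0)"
      using stay[OF that] by (simp add: add.commute)
    ultimately show ?thesis by (simp add: LIMSEQ_const_iff)
  qed
  show ?thesis
  proof (rule that[OF G(1)])
    show "supported a b' G"
      unfolding supported_def
    proof (intro allI impI)
      fix p t assume "t \<notin> {a..b'}"
      then have "(\<lambda>n. ?S n p t) = (\<lambda>n. 0)"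
        using supp unfolding supported_def by blast
      then show "G p t = 0" using lim[of p t] by (simp add: LIMSEQ_const_iff)
    qed
    show "norm (G p t) \<le> B p" for p t
      by (rule Lim_norm_ubound[OF _ lim]) (auto simp: bnd)
    have "fourier T (?S n 0) 0 = fourier T (F 0) 0" for n
      by (induction n) (simp_all add: fou del: avg_seq.simps(2))
    then show "fourier T (G 0) 0 = fourier T (F 0) 0"
      using flim[of 0] by (simp add: LIMSEQ_const_iff)
    show "fourier T (G 0) \<xi> = 0" if "fourier T (F 0) \<xi> = 0" for \<xi>
      using zero[of 0] that by simp
    show "fourier T (G 0) \<xi> = 0" if "cis (\<xi> * h n) = -1" for \<xi> n
      using zero[of "Suc n"] fou[of n \<xi>] that by simp
  qed
qed

text \<open>
  The operator \<open>f + f'/(i\<mu>)\<close> multiplies the transform at \<open>\<xi>\<close> by \<open>1 - \<xi>/\<mu>\<close> and leaves the support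
  unchanged, but it costs one derivative and a factor \<open>1/|\<mu>|\<close>. Hence only finitely many frequencies
  can be removed in this way, with bounds that depend on their number and on a lower bound \<open>\<gamma>\<close> of
  their moduli but not on the frequencies themselves.
\<close>
lemma annihilate_finitely_many:
  assumes F: "jet F" "supported a b F" and B: "\<And>p t. norm (F p t) \<le> B p"
    and ab: "0 < a" "b < T" "0 \<le> T" and g: "\<gamma> > 0"
  shows "\<exists>B'. \<forall>\<mu>. (\<forall>n<R. \<bar>\<mu> n\<bar> \<ge> \<gamma>) \<longrightarrow> (\<exists>G. jet G \<and> supported a b G \<and>
     (\<forall>p t. norm (G p t) \<le> B' p) \<and> fourier T (G 0) 0 = fourier T (F 0) 0 \<and>
     (\<forall>n<R::nat. fourier T (G 0) (\<mu> n) = 0))"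
proof (induction R)
  case 0
  show ?case using F B by auto
next
  case (Suc R)
  then obtain B' where B': "\<And>\<mu>. (\<forall>n<R. \<bar>\<mu> n\<bar> \<ge> \<gamma>) \<Longrightarrow> (\<exists>G. jet G \<and> supported a b G \<and>
     (\<forall>p t. norm (G p t) \<le> B' p) \<and> fourier T (G 0) 0 = fourier T (F 0) 0 \<and>
     (\<forall>n<R. fourier T (G 0) (\<mu> n) = 0))" by blast
  show ?case
  proof (intro exI[of _ "\<lambda>p. B' p + B' (Suc p) / \<gamma>"] allI impI)
    fix \<mu> :: "nat \<Rightarrow> real" assume \<mu>: "\<forall>n<Suc R. \<bar>\<mu> n\<bar> \<ge> \<gamma>"
    obtain G where G: "jet G" "supported a b G" "\<And>p t. norm (G p t) \<le> B' p"
      "fourier T (G 0) 0 = fourier T (F 0) 0" "\<And>n. n < R \<Longrightarrow> fourier T (G 0) (\<mu> n) = 0"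
      using B'[of \<mu>] \<mu> by auto
    define c where "c = - \<i> / of_real (\<mu> R)"
    define H where "H p t = G p t + c * G (Suc p) t" for p t
    have R: "\<bar>\<mu> R\<bar> \<ge> \<gamma>" "\<mu> R \<noteq> 0" using \<mu> g by force+
    have cn: "norm c \<le> 1 / \<gamma>"
      using R g by (simp add: c_def norm_divide frac_le)
    have fou: "fourier T (H 0) \<xi> = (1 - of_real (\<xi> / \<mu> R)) * fourier T (G 0) \<xi>" for \<xi>
    proof -
      have "fourier T (H 0) \<xi> = fourier T (G 0) \<xi> + c * fourier T (G (Suc 0)) \<xi>"
        unfolding H_def by (rule fourier_linear_comb) (auto intro: jet_continuous_on G)
      also have "fourier T (G (Suc 0)) \<xi> = - \<i> * of_real \<xi> * fourier T (G 0) \<xi>"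
        by (rule fourier_deriv) (use G ab in auto)
      finally show ?thesis using R by (simp add: c_def field_simps)
    qed
    show "\<exists>G. jet G \<and> supported a b G \<and>
     (\<forall>p t. norm (G p t) \<le> B' p + B' (Suc p) / \<gamma>) \<and> fourier T (G 0) 0 = fourier T (F 0) 0 \<and>
     (\<forall>n<Suc R. fourier T (G 0) (\<mu> n) = 0)"
    proof (intro exI[of _ H] conjI allI impI)
      show "jet H" unfolding H_def
        using jet_linear_comb[OF G(1) jet_shift_order[OF G(1), of 1]] by simp
      show "supported a b H" using G(2) by (auto simp: supported_def H_def)
      show "norm (H p t) \<le> B' p + B' (Suc p) / \<gamma>" for p t
      proof -
        have "norm (c * G (Suc p) t) \<le> 1 / \<gamma> * B' (Suc p)"
          unfolding norm_mult by (intro mult_mono cn G) (use g in auto)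
        then show ?thesis
          unfolding H_def by (intro norm_triangle_le add_mono G(3)) auto
      qed
      show "fourier T (H 0) 0 = fourier T (F 0) 0" by (simp add: fou G)
      show "fourier T (H 0) (\<mu> n) = 0" if "n < Suc R" for n
        using that G(5)[of n] R by (cases "n = R") (auto simp: fou)
    qed
  qed
qed

section \<open>Bump functions\<close>

text \<open>
  Leibniz' rule for all orders at once; the step is Pascal's identity for the binomial coefficients.
\<close>
lemma jet_mult:
  fixes F G :: "nat \<Rightarrow> real \<Rightarrow> real"
  assumes "jet F" "jet G"
  shows "jet (\<lambda>p t. \<Sum>q\<le>p. real (p choose q) * (F q t * G (p - q) t))"
  unfolding jet_def
proof (intro allI)
  fix p t
  have d: "((\<lambda>t. F q t * G r t) has_real_derivative F q t * G (Suc r) t + F (Suc q) t * G r t) (at t)" for q r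
    using jetD[OF assms(1), of q t] jetD[OF assms(2), of r t]
    unfolding has_real_derivative_iff_has_vector_derivative[symmetric]
    by (auto intro!: derivative_eq_intros)
  have "((\<lambda>t. \<Sum>q\<le>p. real (p choose q) * (F q t * G (p - q) t)) has_real_derivative
     (\<Sum>q\<le>p. real (p choose q) * (F q t * G (Suc (p - q)) t + F (Suc q) t * G (p - q) t))) (at t)"
    by (intro DERIV_sum DERIV_cmult d)
  moreover have "(\<Sum>q\<le>p. real (p choose q) * (F q t * G (Suc (p - q)) t + F (Suc q) t * G (p - q) t))
     = (\<Sum>q\<le>Suc p. real (Suc p choose q) * (F q t * G (Suc p - q) t))"
  proof -
    have "(\<Sum>q\<le>p. real (p choose q) * (F q t * G (Suc (p - q)) t))
        = (\<Sum>q\<le>Suc p. real (p choose q) * (F q t * G (Suc p - q) t))"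
      by (simp add: Suc_diff_le)
    also have "\<dots> = F 0 t * G (Suc p) t + (\<Sum>q\<le>p. real (p choose Suc q) * (F (Suc q) t * G (p - q) t))"
      by (subst sum.atMost_Suc_shift) simp
    finally have 1: "(\<Sum>q\<le>p. real (p choose q) * (F q t * G (Suc (p - q)) t)) = \<dots>" .
    have "(\<Sum>q\<le>Suc p. real (Suc p choose q) * (F q t * G (Suc p - q) t))
        = F 0 t * G (Suc p) t + (\<Sum>q\<le>p. real (Suc p choose Suc q) * (F (Suc q) t * G (p - q) t))"
      by (subst sum.atMost_Suc_shift) simp
    also have "(\<Sum>q\<le>p. real (Suc p choose Suc q) * (F (Suc q) t * G (p - q) t))
       = (\<Sum>q\<le>p. real (p choose q) * (F (Suc q) t * G (p - q) t)) + (\<Sum>q\<le>p. real (p choose Suc q) * (F (Suc q) t * G (p - q) t))"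
      by (simp add: sum.distrib[symmetric] algebra_simps)
    finally show ?thesis
      using 1 by (simp add: distrib_left sum.distrib)
  qed
  ultimately show "((\<lambda>t. \<Sum>q\<le>p. real (p choose q) * (F q t * G (p - q) t)) has_vector_derivative
     (\<Sum>q\<le>Suc p. real (Suc p choose q) * (F q t * G (Suc p - q) t))) (at t)"
    by (simp add: has_real_derivative_iff_has_vector_derivative)
qed

lemma jet_affine:
  fixes F :: "nat \<Rightarrow> real \<Rightarrow> real"
  assumes "jet F"
  shows "jet (\<lambda>p t. m ^ p * F p (m * t + c))"
  unfolding jet_def has_real_derivative_iff_has_vector_derivative[symmetric]
proof (intro allI)
  fix p t
  have "(F p has_real_derivative F (Suc p) (m * t + c)) (at (m * t + c))"
    using jetD[OF assms] by (simp add: has_real_derivative_iff_has_vector_derivative)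
  moreover have "((\<lambda>t. m * t + c) has_real_derivative m) (at t)"
    by (auto intro!: derivative_eq_intros)
  ultimately have "((\<lambda>t. F p (m * t + c)) has_real_derivative F (Suc p) (m * t + c) * m) (at t)"
    by (rule DERIV_chain2)
  from DERIV_cmult[OF this, of "m ^ p"]
  show "((\<lambda>t. m ^ p * F p (m * t + c)) has_real_derivative m ^ Suc p * F (Suc p) (m * t + c)) (at t)"
    by (simp add: mult_ac)
qed

text \<open>
  The \<open>p\<close>-th derivative of \<open>exp (-1/x)\<close> is a polynomial in \<open>1/x\<close> times \<open>exp (-1/x)\<close>; the recursion
  is the chain rule in the variable \<open>1/x\<close>.
\<close>
primrec flat_poly :: "nat \<Rightarrow> real poly" where
  "flat_poly 0 = 1"
| "flat_poly (Suc p) = [:0, 0, 1:] * (flat_poly p - pderiv (flat_poly p))"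

text \<open>
  The jet of the function that is \<open>exp (-1/x)\<close> for \<open>x > 0\<close> and \<open>0\<close> otherwise.
\<close>
definition flat :: "nat \<Rightarrow> real \<Rightarrow> real" where
  "flat p x = (if x > 0 then poly (flat_poly p) (1 / x) * exp (- (1 / x)) else 0)"

lemma poly_times_exp_neg_tendsto_0:
  fixes P :: "real poly"
  shows "((\<lambda>z. poly P z * exp (- z)) \<longlongrightarrow> 0) at_top"
proof -
  have "((\<lambda>z. \<Sum>i\<le>degree P. coeff P i * (z ^ i / exp z)) \<longlongrightarrow> (\<Sum>i\<le>degree P. coeff P i * 0)) at_top"
    by (intro tendsto_sum tendsto_mult tendsto_const tendsto_power_div_exp_0)
  then show ?thesis
    by (simp add: poly_altdef sum_distrib_right exp_minus divide_inverse mult.assoc)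
qed

lemma jet_flat: "jet flat"
  unfolding jet_def has_real_derivative_iff_has_vector_derivative[symmetric]
proof (intro allI)
  fix p and x :: real
  let ?P = "flat_poly p"
  consider "x > 0" | "x < 0" | "x = 0" by linarith
  then show "(flat p has_real_derivative flat (Suc p) x) (at x)"
  proof cases
    case 1
    have "((\<lambda>x. poly ?P (1 / x) * exp (- (1 / x))) has_real_derivative flat (Suc p) x) (at x)"
      using 1 by (auto intro!: derivative_eq_intros DERIV_chain2[OF poly_DERIV] simp: flat_def field_simps power2_eq_square)
    then show ?thesis
      by (rule DERIV_cong_ev[THEN iffD1, rotated -1])
         (use 1 eventually_nhds_in_open[of "{0<..}" x] in \<open>auto simp: flat_def elim!: eventually_mono\<close>)
  next
    case 2
    have "((\<lambda>x. 0) has_real_derivative flat (Suc p) x) (at x)"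
      using 2 by (auto simp: flat_def)
    then show ?thesis
      by (rule DERIV_cong_ev[THEN iffD1, rotated -1])
         (use 2 eventually_nhds_in_open[of "{..<0}" x] in \<open>auto simp: flat_def elim!: eventually_mono\<close>)
  next
    case 3
    have "((\<lambda>z. poly ([:0, 1:] * ?P) z * exp (- z)) \<longlongrightarrow> 0) at_top"
      by (rule poly_times_exp_neg_tendsto_0)
    then have "((\<lambda>y. poly ([:0, 1:] * ?P) (inverse y) * exp (- inverse y)) \<longlongrightarrow> 0) (at_right 0)"
      by (rule filterlim_compose) (rule filterlim_inverse_at_top_right)
    then have r: "((\<lambda>y. flat p y / y) \<longlongrightarrow> 0) (at_right 0)"
      by (rule Lim_transform_eventually)
         (auto simp: flat_def field_simps eventually_at_right_field intro!: exI[of _ 1])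
    have l: "((\<lambda>y. flat p y / y) \<longlongrightarrow> 0) (at_left 0)"
      by (rule tendsto_eventually) (auto simp: flat_def eventually_at_left_field intro!: exI[of _ "-1"])
    have "((\<lambda>y. flat p y / y) \<longlongrightarrow> 0) (at 0)"
      using l r by (simp add: filterlim_at_split)
    then show ?thesis
      using 3 by (simp add: has_field_derivative_iff flat_def)
  qed
qed

text \<open>
  The jet of the product of \<open>flat 0 (m (t - x))\<close> and \<open>flat 0 (m (y - t))\<close>, given by Leibniz' rule.
  The function is positive exactly on \<open>(x,y)\<close>; for large \<open>m\<close> it approaches the indicator function.
\<close>
definition bump :: "real \<Rightarrow> real \<Rightarrow> real \<Rightarrow> nat \<Rightarrow> real \<Rightarrow> real" where
  "bump m x y p t = (\<Sum>q\<le>p. real (p choose q) *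
      ((m ^ q * flat q (m * t + (- m * x))) * ((- m) ^ (p - q) * flat (p - q) ((- m) * t + m * y))))"

lemma jet_bump: "jet (bump m x y)"
  unfolding bump_def[abs_def] by (intro jet_mult jet_affine jet_flat)

lemma bump_0:
  "bump m x y 0 t = flat 0 (m * (t - x)) * flat 0 (m * (y - t))"
  by (simp add: bump_def algebra_simps)

lemma bump_outside: 
  assumes "m > 0" "t \<notin> {x<..<y}" shows "bump m x y p t = 0"
proof -
  have "m * t + (- m * x) \<le> 0 \<or> (- m) * t + m * y \<le> 0"
    using assms by auto
  then have "flat q (m * t + (- m * x)) * flat r ((- m) * t + m * y) = 0" for q r
    by (auto simp: flat_def)
  then have "(m ^ q * flat q (m * t + (- m * x))) * ((- m) ^ r * flat r ((- m) * t + m * y)) = 0" for q r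
    using mult_eq_0_iff by (metis (no_types))
  then show ?thesis unfolding bump_def by (simp only: mult_zero_right sum.neutral_const)
qed

lemma unit_mass_bump:
  assumes "0 < x" "x < y" "y < T"
  obtains F :: "nat \<Rightarrow> real \<Rightarrow> complex" and B where
    "jet F" "supported x y F" "\<And>p t. norm (F p t) \<le> B p" "fourier T (F 0) 0 = 1"
proof -
  let ?b = "bump 1 x y"
  have cont: "continuous_on S (?b p)" for S p
    by (rule jet_continuous_on[OF jet_bump])
  have out: "?b p t = 0" if "t \<notin> {x..y}" for p t
    using that by (intro bump_outside) auto
  define I where "I = integral {0..T} (?b 0)"
  have "I \<noteq> 0"
  proof
    assume "I = 0"
    moreover have "?b 0 t \<ge> 0" for t
      by (simp add: bump_0 flat_def)
    ultimately have "\<forall>t\<in>{0..T}. ?b 0 t = 0"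
      using integral_eq_0_iff[of 0 T "?b 0"] cont assms unfolding I_def by auto
    moreover have "(x + y) / 2 \<in> {0..T}" "?b 0 ((x + y) / 2) \<noteq> 0"
      using assms by (auto simp: bump_0 flat_def field_simps)
    ultimately show False by blast
  qed
  define F where "F p t = complex_of_real (?b p t / I)" for p t
  have "jet F"
    unfolding jet_def F_def
    using jetD[OF jet_bump[of 1 x y]]
    by (auto intro!: derivative_eq_intros simp: has_real_derivative_iff_has_vector_derivative)
  have bnd: "\<exists>B. \<forall>t. norm (F p t) \<le> B" for p
  proof -
    have "compact (?b p ` {x..y})"
      by (intro compact_continuous_image cont) auto
    then obtain B where B: "\<forall>t\<in>{x..y}. norm (?b p t) \<le> B"
      using compact_imp_bounded bounded_iff by (metis imageI)
    have "norm (F p t) \<le> \<bar>B / I\<bar>" for t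
    proof (cases "t \<in> {x..y}")
      case True
      then have "\<bar>?b p t\<bar> \<le> \<bar>B\<bar>" using B by (metis abs_ge_self order_trans real_norm_def)
      then show ?thesis by (simp add: F_def norm_divide divide_right_mono)
    qed (simp add: F_def out)
    then show ?thesis by blast
  qed
  then obtain B where "\<And>p t. norm (F p t) \<le> B p" by metis
  moreover have "supported x y F" by (simp add: supported_def F_def out)
  moreover have "fourier T (F 0) 0 = 1"
  proof -
    have "((\<lambda>t. ?b 0 t / I) has_integral I / I) {0..T}"
      unfolding I_def by (intro has_integral_divide integrable_integral integrable_continuous_real cont)
    then have "((\<lambda>t. of_real (?b 0 t / I)) has_integral complex_of_real (I / I)) {0..T}"
      by (rule has_integral_of_real)
    from integral_unique[OF this] show ?thesis
      using \<open>I \<noteq> 0\<close> unfolding fourier_def F_def by simp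
  qed
  ultimately show ?thesis using that \<open>jet F\<close> by blast
qed

lemma summable_shift_powr:
  assumes "s > 1"
  shows "summable (\<lambda>n. real (Suc n) powr - s)"
  using assms summable_real_powr_iff[of "- s"] summable_Suc_iff[of "\<lambda>n. real n powr - s"] by simp

section \<open>Kernels with prescribed zeros\<close>

text \<open>
  The essential point is that the bounds \<open>B\<close> serve all sequences \<open>\<mu>\<close> simultaneously. The number \<open>R\<close>
  is chosen such that the averages for the frequencies from the \<open>R\<close>-th on enlarge the support by less
  than \<open>T/4\<close>; the first \<open>R\<close> frequencies are removed by differential operators.
\<close>
theorem kernel_with_prescribed_zeros:
  fixes T \<gamma> s :: real
  assumes T: "T > 0" and g: "\<gamma> > 0" and s: "s > 1"
  shows "\<exists>B. \<forall>\<mu>. (\<forall>n. \<bar>\<mu> n\<bar> \<ge> \<gamma> * real (Suc n) powr s) \<longrightarrow>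
     (\<exists>\<Phi>. jet \<Phi> \<and> supported (T/4) (3*T/4) \<Phi> \<and> (\<forall>p t. norm (\<Phi> p t) \<le> B p) \<and>
          fourier T (\<Phi> 0) 0 = 1 \<and> (\<forall>n. fourier T (\<Phi> 0) (\<mu> n) = 0))"
proof -
  obtain F B where F: "jet F" "supported (T/4) (T/2) F" "\<And>p t. norm (F p t) \<le> B p" "fourier T (F 0) 0 = 1"
    using unit_mass_bump[of "T/4" "T/2" T] T by auto
  \<comment> \<open>an upper bound for the shift \<open>\<pi>/|\<mu> n|\<close> that does not depend on \<open>\<mu>\<close>\<close>
  let ?r = "\<lambda>n. pi / \<gamma> * real (Suc n) powr - s"
  have sr: "summable ?r"
    using summable_shift_powr[OF s] by (rule summable_mult)
  then obtain R where R: "(\<Sum>n. ?r (n + R)) < T / 4"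
  proof -
    obtain N where "\<forall>n\<ge>N. norm (\<Sum>i. ?r (i + n)) < T / 4"
      using suminf_exist_split[of "T / 4" ?r] sr T by auto
    then have "norm (\<Sum>i. ?r (i + N)) < T / 4" by blast
    then have "(\<Sum>i. ?r (i + N)) < T / 4" by (metis abs_ge_self le_less_trans real_norm_def)
    then show ?thesis by (rule that)
  qed
  obtain B' where B': "\<And>\<mu>. (\<forall>n<R. \<bar>\<mu> n\<bar> \<ge> \<gamma>) \<Longrightarrow> (\<exists>G. jet G \<and> supported (T/4) (T/2) G \<and>
     (\<forall>p t. norm (G p t) \<le> B' p) \<and> fourier T (G 0) 0 = fourier T (F 0) 0 \<and>
     (\<forall>n<R. fourier T (G 0) (\<mu> n) = 0))"
    using annihilate_finitely_many[OF F(1-3), of T \<gamma> R] T g by auto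
  show ?thesis
  proof (intro exI[of _ B'] allI impI)
    fix \<mu> :: "nat \<Rightarrow> real" assume \<mu>: "\<forall>n. \<bar>\<mu> n\<bar> \<ge> \<gamma> * real (Suc n) powr s"
    have pos: "\<bar>\<mu> n\<bar> \<ge> \<gamma>" for n
    proof -
      have "1 \<le> real (Suc n) powr s" using s by (intro ge_one_powr_ge_zero) auto
      then have "\<gamma> * 1 \<le> \<gamma> * real (Suc n) powr s" using g by (intro mult_left_mono) auto
      then show ?thesis using \<mu>[rule_format, of n] by linarith
    qed
    obtain G where G: "jet G" "supported (T/4) (T/2) G" "\<And>p t. norm (G p t) \<le> B' p"
      "fourier T (G 0) 0 = 1" "\<And>n. n < R \<Longrightarrow> fourier T (G 0) (\<mu> n) = 0"
      using B'[of \<mu>] pos F(4) by auto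
    define h where "h n = pi / \<bar>\<mu> (n + R)\<bar>" for n
    have h0: "h n \<ge> 0" for n by (simp add: h_def)
    have hr: "h n \<le> ?r (n + R)" for n
    proof -
      have "h n \<le> pi / (\<gamma> * real (Suc (n + R)) powr s)"
        unfolding h_def
      proof (rule divide_left_mono[OF \<mu>[rule_format, of "n + R"]])
        have "\<gamma> * real (Suc (n + R)) powr s > 0" using g by simp
        moreover have "\<bar>\<mu> (n + R)\<bar> > 0" using pos[of "n + R"] g by linarith
        ultimately show "0 < \<bar>\<mu> (n + R)\<bar> * (\<gamma> * real (Suc (n + R)) powr s)"
          by (rule mult_pos_pos[rotated])
      qed simp
      then show ?thesis by (simp add: powr_minus field_simps)
    qed
    have srR: "summable (\<lambda>n. ?r (n + R))"
      using sr by (rule summable_ignore_initial_segment)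
    have sh: "summable h"
      by (rule summable_comparison_test'[OF srR]) (use h0 hr in auto)
    have "suminf h \<le> (\<Sum>n. ?r (n + R))"
      by (rule suminf_le[OF hr sh srR])
    then have le: "T/2 + suminf h \<le> 3*T/4" using R by simp
    obtain \<Phi> where \<Phi>: "jet \<Phi>" "supported (T/4) (3*T/4) \<Phi>" "\<And>p t. norm (\<Phi> p t) \<le> B' p"
      "fourier T (\<Phi> 0) 0 = fourier T (G 0) 0"
      "\<And>\<xi>. fourier T (G 0) \<xi> = 0 \<Longrightarrow> fourier T (\<Phi> 0) \<xi> = 0"
      "\<And>\<xi> n. cis (\<xi> * h n) = -1 \<Longrightarrow> fourier T (\<Phi> 0) \<xi> = 0"
      by (rule infinite_averaging[OF G(1-3) h0 sh _ le, where T = T]) (use T in auto)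
    have "fourier T (\<Phi> 0) (\<mu> n) = 0" for n
    proof (cases "n < R")
      case False
      have "\<mu> n * h (n - R) = pi \<or> \<mu> n * h (n - R) = - pi"
        using False pos[of n] g by (auto simp: h_def abs_if)
      then have "cis (\<mu> n * h (n - R)) = -1"
        by (auto simp: complex_eq_iff)
      then show ?thesis by (rule \<Phi>(6))
    qed (use \<Phi>(5) G(5) in auto)
    then show "\<exists>\<Phi>. jet \<Phi> \<and> supported (T/4) (3*T/4) \<Phi> \<and> (\<forall>p t. norm (\<Phi> p t) \<le> B' p) \<and>
          fourier T (\<Phi> 0) 0 = 1 \<and> (\<forall>n. fourier T (\<Phi> 0) (\<mu> n) = 0)"
      using \<Phi> G(4) by auto
  qed
qed

section \<open>Separation of the frequencies\<close>

text \<open>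
  In each pair of terms with indices \<open>i\<close> and \<open>n - 1 - i\<close> the larger one is at least \<open>(n/2)\<^sup>\<epsilon>\<close>.
\<close>
lemma sum_powr_lower_bound:
  assumes "\<epsilon> > 0"
  shows "(\<Sum>i<n. real (Suc i) powr \<epsilon>) \<ge> real n powr (1 + \<epsilon>) / 2 powr (1 + \<epsilon>)"
proof (cases "n = 0")
  case False
  let ?f = "\<lambda>i. real (Suc i) powr \<epsilon>"
  have "real n * (real n / 2) powr \<epsilon> = (\<Sum>i<n. (real n / 2) powr \<epsilon>)"
    by simp
  also have "\<dots> \<le> (\<Sum>i<n. ?f i + ?f (n - Suc i))"
  proof (rule sum_mono)
    fix i assume "i \<in> {..<n}"
    then have "real n / 2 \<le> real (Suc i) \<or> real n / 2 \<le> real (Suc (n - Suc i))"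
      by (auto simp: of_nat_diff)
    then have "(real n / 2) powr \<epsilon> \<le> ?f i \<or> (real n / 2) powr \<epsilon> \<le> ?f (n - Suc i)"
      using assms by (meson powr_mono2 less_imp_le of_nat_0_le_iff divide_nonneg_nonneg zero_le_numeral)
    then show "(real n / 2) powr \<epsilon> \<le> ?f i + ?f (n - Suc i)"
      using powr_ge_zero[of "real (Suc i)" \<epsilon>] powr_ge_zero[of "real (Suc (n - Suc i))" \<epsilon>] by linarith
  qed
  also have "\<dots> = 2 * (\<Sum>i<n. ?f i)"
    using sum.nat_diff_reindex[of ?f n] by (simp add: sum.distrib)
  finally show ?thesis
    using False by (simp add: powr_add powr_divide field_simps)
qed simp

definition signed_freq :: "(nat \<Rightarrow> real) \<Rightarrow> int \<Rightarrow> real" where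
  "signed_freq \<omega> a = (if a \<ge> 0 then \<omega> (nat a) else - \<omega> (nat (- a)))"

text \<open>
  The gaps at all indices dominate a multiple of \<open>(j+1)\<^sup>\<epsilon>\<close>: the finitely many gaps before \<open>N0\<close> are
  positive. Summing \<open>n\<close> consecutive gaps gives a multiple of \<open>n\<^bsup>1+\<epsilon>\<^esup>\<close>, which settles frequencies of
  the same sign. For opposite signs \<open>\<omega> j + \<omega> l\<close> is at least the larger of the two, and
  \<open>max j l \<ge> (j + l)/2\<close>.
\<close>
lemma signed_freq_gap:
  assumes mono: "strict_mono \<omega>" and w0: "\<omega> 0 = 0"
    and gap: "\<exists>\<epsilon>>0. \<exists>N0::nat. \<exists>c>0. \<forall>j\<ge>N0. \<omega> (Suc j) - \<omega> j \<ge> c * real j powr \<epsilon>"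
  obtains \<gamma> s where "\<gamma> > 0" "s > 1"
    "\<And>a b. \<bar>signed_freq \<omega> a - signed_freq \<omega> b\<bar> \<ge> \<gamma> * real_of_int \<bar>a - b\<bar> powr s"
proof -
  obtain \<epsilon> N c where e: "\<epsilon> > 0" and c: "c > 0"
    and N: "\<And>j. j \<ge> N \<Longrightarrow> \<omega> (Suc j) - \<omega> j \<ge> c * real j powr \<epsilon>"
    using gap by blast
  let ?q = "\<lambda>j. (\<omega> (Suc j) - \<omega> j) / real (Suc j) powr \<epsilon>"
  define c' where "c' = min (c / 2 powr \<epsilon>) (Min (?q ` {..N}))"
  have gpos: "\<omega> (Suc j) - \<omega> j > 0" for j
    using strict_monoD[OF mono, of j "Suc j"] by simp
  have "Min (?q ` {..N}) > 0"
    by (subst Min_gr_iff) (use gpos in \<open>auto intro!: divide_pos_pos\<close>)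
  then have c': "c' > 0" using c by (simp add: c'_def)
  have g1: "\<omega> (Suc j) - \<omega> j \<ge> c' * real (Suc j) powr \<epsilon>" for j
  proof (cases "j \<le> N")
    case True
    then have "Min (?q ` {..N}) \<le> ?q j" by (intro Min_le) auto
    then have "c' \<le> ?q j" unfolding c'_def by linarith
    then show ?thesis by (simp add: field_simps)
  next
    case False
    have "(real (Suc j) / 2) powr \<epsilon> \<le> real j powr \<epsilon>"
      using False e by (intro powr_mono2) auto
    then have "c * (real (Suc j) / 2) powr \<epsilon> \<le> \<omega> (Suc j) - \<omega> j"
      using N[of j] False c by (smt (verit) mult_left_mono nle_le)
    moreover have "c' * real (Suc j) powr \<epsilon> \<le> c / 2 powr \<epsilon> * real (Suc j) powr \<epsilon>"
      unfolding c'_def by (intro mult_right_mono) auto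
    ultimately show ?thesis by (simp add: powr_divide)
  qed
  have g2: "\<omega> (l + n) - \<omega> l \<ge> c' * (\<Sum>i<n. real (Suc i) powr \<epsilon>)" for l n
  proof (induction n)
    case (Suc n)
    have "real (Suc n) powr \<epsilon> \<le> real (Suc (l + n)) powr \<epsilon>"
      using e by (intro powr_mono2) auto
    then have "c' * real (Suc n) powr \<epsilon> \<le> c' * real (Suc (l + n)) powr \<epsilon>"
      using c' by (intro mult_left_mono) auto
    also have "\<dots> \<le> \<omega> (Suc (l + n)) - \<omega> (l + n)"
      by (rule g1)
    finally show ?case using Suc by (simp add: distrib_left)
  qed simp
  define s where "s = 1 + \<epsilon>"
  define \<gamma>' where "\<gamma>' = c' / 2 powr s"
  have g3: "\<omega> (l + n) - \<omega> l \<ge> \<gamma>' * real n powr s" for l n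
  proof -
    have "c' * (real n powr s / 2 powr s) \<le> c' * (\<Sum>i<n. real (Suc i) powr \<epsilon>)"
      using sum_powr_lower_bound[OF e, of n] c' unfolding s_def by (intro mult_left_mono) auto
    then show ?thesis using g2[of n l] by (simp add: \<gamma>'_def)
  qed
  define \<gamma> where "\<gamma> = \<gamma>' / 2 powr s"
  have s: "s > 1" using e by (simp add: s_def)
  have \<gamma>': "\<gamma>' > 0" using c' by (simp add: \<gamma>'_def)
  have \<gamma>: "\<gamma> > 0" "\<gamma> \<le> \<gamma>'"
  proof -
    show "\<gamma> > 0" using \<gamma>' by (simp add: \<gamma>_def)
    have "1 \<le> 2 powr s" using s by (intro ge_one_powr_ge_zero) auto
    then show "\<gamma> \<le> \<gamma>'" using \<gamma>' by (simp add: \<gamma>_def field_simps)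
  qed
  have same: "\<omega> j - \<omega> l \<ge> \<gamma> * real (j - l) powr s" if "l \<le> j" for j l
  proof -
    have "\<gamma> * real (j - l) powr s \<le> \<gamma>' * real (j - l) powr s"
      using \<gamma> by (intro mult_right_mono) auto
    then show ?thesis using g3[of "j - l" l] that by simp
  qed
  have opp: "\<omega> j + \<omega> l \<ge> \<gamma> * real (j + l) powr s" for j l
  proof -
    have "\<gamma> * real (j + l) powr s = \<gamma>' * (real (j + l) / 2) powr s"
      by (simp add: \<gamma>_def powr_divide)
    also have "\<dots> \<le> \<gamma>' * real (max j l) powr s"
      using \<gamma>' s by (intro mult_left_mono powr_mono2) auto
    also have "\<dots> \<le> \<omega> (max j l)"
      using g3[of "max j l" 0] w0 by simp
    also have "\<dots> \<le> \<omega> j + \<omega> l"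
      using strict_mono_less_eq[OF mono, of 0 j] strict_mono_less_eq[OF mono, of 0 l] w0 by (auto simp: max_def)
    finally show ?thesis .
  qed
  have main: "signed_freq \<omega> a - signed_freq \<omega> b \<ge> \<gamma> * real_of_int (a - b) powr s" if "b \<le> a" for a b
  proof -
    consider "b \<ge> 0" | "a < 0" | "a \<ge> 0" "b < 0" by linarith
    then show ?thesis
    proof cases
      case 1
      then show ?thesis using that same[of "nat b" "nat a"] by (simp add: signed_freq_def of_nat_diff)
    next
      case 2
      then show ?thesis using that same[of "nat (- a)" "nat (- b)"] by (simp add: signed_freq_def of_nat_diff)
    next
      case 3
      then show ?thesis using that opp[of "nat a" "nat (- b)"] by (simp add: signed_freq_def)
    qed
  qed
  show ?thesis
  proof (rule that[OF \<gamma>(1) s])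
    fix a b
    show "\<bar>signed_freq \<omega> a - signed_freq \<omega> b\<bar> \<ge> \<gamma> * real_of_int \<bar>a - b\<bar> powr s"
      using main[of a b] main[of b a] by (cases "b \<le> a") (auto simp: abs_if)
  qed
qed

section \<open>Primitives and endpoint conditions\<close>

text \<open>
  The index shift that turns a jet into the jet of its primitive vanishing at \<open>0\<close>. The integral over
  \<open>{0..t}\<close> is \<open>0\<close> for negative \<open>t\<close>, which is the correct value for functions vanishing to the left of
  some \<open>a > 0\<close>.
\<close>
definition prim :: "(nat \<Rightarrow> real \<Rightarrow> complex) \<Rightarrow> nat \<Rightarrow> real \<Rightarrow> complex" where
  "prim F p t = (case p of 0 \<Rightarrow> integral {0..t} (F 0) | Suc q \<Rightarrow> F q t)"

lemma prim_simps [simp]: "prim F 0 t = integral {0..t} (F 0)" "prim F (Suc q) = F q"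
  by (simp_all add: prim_def fun_eq_iff)

definition left_zero :: "real \<Rightarrow> (nat \<Rightarrow> real \<Rightarrow> complex) \<Rightarrow> bool" where
  "left_zero a F \<longleftrightarrow> (\<forall>p t. t < a \<longrightarrow> F p t = 0)"

lemma left_zero_prim: 
  assumes "left_zero a F" shows "left_zero a (prim F)"
  unfolding left_zero_def
proof (intro allI impI)
  fix p t assume "t < a"
  then have "integral {0..t} (F 0) = integral {0..t} (\<lambda>_. 0)"
    using assms by (intro integral_cong) (auto simp: left_zero_def)
  then show "prim F p t = 0"
    using assms \<open>t < a\<close> by (cases p) (auto simp: left_zero_def)
qed

lemma jet_prim:
  assumes F: "jet F" "left_zero a F" "0 < a"
  shows "jet (prim F)"
  unfolding jet_def
proof (intro allI)
  fix p t
  show "(prim F p has_vector_derivative prim F (Suc p) t) (at t)"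
  proof (cases p)
    case 0
    show ?thesis
    proof (cases "t < a")
      case True
      have "((\<lambda>_. 0) has_vector_derivative F 0 t) (at t)"
        using True F by (auto simp: left_zero_def)
      then show ?thesis unfolding 0 prim_simps(2)
        by (rule has_vector_derivative_transform_within_open[of _ _ _ "{..<a}"])
           (use True left_zero_prim[OF F(2)] in \<open>auto simp: left_zero_def simp del: prim_simps(1)\<close>)
    next
      case False
      have "((\<lambda>u. integral {0..u} (F 0)) has_vector_derivative F 0 t) (at t within {0..t + 1})"
        by (rule integral_has_vector_derivative) (use False F in \<open>auto intro: jet_continuous_on\<close>)
      moreover have "at t within {0..t + 1} = at t"
        using False F by (intro at_within_interior) auto
      moreover have "prim F 0 = (\<lambda>u. integral {0..u} (F 0))" by (simp add: fun_eq_iff)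
      ultimately show ?thesis unfolding 0 by simp
    qed
  qed (simp add: jetD[OF F(1)])
qed

lemma prim_iter:
  assumes "jet F" "left_zero a F" "0 < a"
  shows "jet ((prim ^^ n) F)" "left_zero a ((prim ^^ n) F)"
proof -
  have "jet ((prim ^^ n) F) \<and> left_zero a ((prim ^^ n) F)"
    by (induction n) (use assms in \<open>auto intro: jet_prim left_zero_prim\<close>)
  then show "jet ((prim ^^ n) F)" "left_zero a ((prim ^^ n) F)" by auto
qed

lemma prim_iter_ge: "(prim ^^ n) F (p + n) = F p"
  by (induction n) simp_all

lemma prim_iter_le: "(prim ^^ (m + j)) F j = (prim ^^ m) F 0"
  by (induction j) simp_all

lemma prim_of_shift:
  assumes F: "jet F" "left_zero a F" "0 < a"
  shows "prim (\<lambda>p. F (Suc p)) = F"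
proof (intro ext)
  fix p t
  show "prim (\<lambda>p. F (Suc p)) p t = F p t"
  proof (cases p)
    case 0
    show ?thesis
    proof (cases "t < 0")
      case True
      then show ?thesis using 0 F by (auto simp: left_zero_def)
    next
      case False
      have "(F (Suc 0) has_integral F 0 t - F 0 0) {0..t}"
        using False by (intro fundamental_theorem_of_calculus) (auto intro: has_vector_derivative_at_within jetD[OF F(1)])
      then show ?thesis using 0 F by (simp add: integral_unique left_zero_def)
    qed
  qed simp
qed

lemma prim_iter_of_shift:
  assumes F: "jet F" "left_zero a F" "0 < a"
  shows "(prim ^^ n) (\<lambda>p. F (p + n)) = F"
  using F
proof (induction n arbitrary: F)
  case (Suc n)
  have "jet (\<lambda>p. F (p + n))" "left_zero a (\<lambda>p. F (p + n))"
    using Suc.prems by (auto simp: left_zero_def intro: jet_shift_order)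
  from prim_of_shift[OF this Suc.prems(3)] have "prim (\<lambda>p. F (p + Suc n)) = (\<lambda>p. F (p + n))"
    by simp
  then show ?case
    using Suc.IH[OF Suc.prems] by (simp add: funpow_swap1)
qed simp

lemma prim_linear_comb:
  assumes "jet F" "jet G"
  shows "prim (\<lambda>p t. F p t + c * G p t) = (\<lambda>p t. prim F p t + c * prim G p t)"
proof (intro ext)
  fix p t
  show "prim (\<lambda>p t. F p t + c * G p t) p t = prim F p t + c * prim G p t"
  proof (cases p)
    case 0
    have "(\<lambda>t. c * G 0 t) integrable_on {0..t}"
      by (intro integrable_on_mult_right integrable_continuous_real jet_continuous_on assms)
    moreover have "F 0 integrable_on {0..t}"
      by (intro integrable_continuous_real jet_continuous_on assms)
    ultimately show ?thesis using 0 by (simp add: integral_add)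
  qed simp
qed

lemma prim_iter_linear_comb:
  assumes "jet F" "jet G" "left_zero a F" "left_zero a G" "0 < a"
  shows "(prim ^^ n) (\<lambda>p t. F p t + c * G p t) = (\<lambda>p t. (prim ^^ n) F p t + c * (prim ^^ n) G p t)"
  by (induction n) (auto simp: prim_linear_comb prim_iter(1)[OF assms(1,3,5)] prim_iter(1)[OF assms(2,4,5)])

lemma supported_left_zero: "supported a b F \<Longrightarrow> left_zero a F"
  by (auto simp: supported_def left_zero_def)

text \<open>
  Adding a multiple of the \<open>(n+1)\<close>-st derivative of \<open>G\<close> corrects the primitive of order \<open>n+2\<close> at \<open>T\<close>:
  the derivative's own primitives of order at most \<open>n+1\<close> are derivatives of \<open>G\<close> and vanish at \<open>T\<close>,
  while that of order \<open>n+2\<close> is the integral of \<open>G\<close>, which is \<open>1\<close>. The transform is multiplied by a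
  polynomial that is \<open>1\<close> at \<open>0\<close>, so its zeros are kept.
\<close>
lemma kill_primitives_at_endpoint:
  assumes F: "jet F" "supported a b F" "fourier T (F 0) 0 = 1" and ab: "0 < a" "b < T" "0 \<le> T"
  shows "\<exists>G. jet G \<and> supported a b G \<and> fourier T (G 0) 0 = 1 \<and>
     (\<forall>\<xi>. fourier T (F 0) \<xi> = 0 \<longrightarrow> fourier T (G 0) \<xi> = 0) \<and> (\<forall>j\<in>{2..Suc n}. (prim ^^ j) G 0 T = 0)"
proof (induction n)
  case 0
  show ?case by (intro exI[of _ F]) (use F in auto)
next
  case (Suc n)
  then obtain G where G: "jet G" "supported a b G" "fourier T (G 0) 0 = 1"
     "\<And>\<xi>. fourier T (F 0) \<xi> = 0 \<Longrightarrow> fourier T (G 0) \<xi> = 0"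
     and z: "\<And>j. j \<in> {2..Suc n} \<Longrightarrow> (prim ^^ j) G 0 T = 0" by blast
  define c where "c = - (prim ^^ Suc (Suc n)) G 0 T"
  \<comment> \<open>the jet of the derivative of \<open>G\<close> of order \<open>n+1\<close>\<close>
  define D where "D = (\<lambda>p. G (p + Suc n))"
  define H where "H = (\<lambda>p t. G p t + c * D p t)"
  have D: "jet D" "supported a b D"
    using G unfolding D_def supported_def by (auto intro: jet_shift_order simp del: add_Suc_right)
  note lz = supported_left_zero[OF G(2)] supported_left_zero[OF D(2)]
  have fou: "fourier T (H 0) \<xi> = fourier T (G 0) \<xi> + c * ((- \<i> * of_real \<xi>) ^ Suc n * fourier T (G 0) \<xi>)" for \<xi>
    unfolding H_def using fourier_deriv_iterated[OF G(1,2) ab, of "Suc n" \<xi>]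
    by (subst fourier_linear_comb) (auto intro!: jet_continuous_on G D simp: D_def)
  have iter: "(prim ^^ j) H 0 T = (prim ^^ j) G 0 T + c * (prim ^^ j) D 0 T" for j
    unfolding H_def using prim_iter_linear_comb[OF G(1) D(1) lz ab(1)] by simp
  have low: "(prim ^^ j) D 0 T = 0" if "j \<le> Suc n" for j
  proof -
    let ?E = "\<lambda>p. G (p + (Suc n - j))"
    have "jet ?E" "left_zero a ?E"
      using G lz by (auto simp: left_zero_def intro: jet_shift_order)
    from prim_iter_of_shift[OF this ab(1), of j]
    have "(prim ^^ j) D = ?E"
      unfolding D_def using that by (simp add: add.assoc)
    then show ?thesis using G(2) ab by (auto simp: supported_def)
  qed
  have "(prim ^^ Suc n) D = G"
    unfolding D_def by (rule prim_iter_of_shift[OF G(1) lz(1) ab(1)])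
  then have "(prim ^^ Suc (Suc n)) D 0 T = integral {0..T} (G 0)"
    by simp
  then have top: "(prim ^^ Suc (Suc n)) D 0 T = 1"
    using G(3) by (simp add: fourier_def)
  show ?case
  proof (intro exI[of _ H] conjI allI impI ballI)
    show "jet H" unfolding H_def by (rule jet_linear_comb[OF G(1) D(1)])
    show "supported a b H" using G(2) D(2) by (auto simp: supported_def H_def)
    show "fourier T (H 0) 0 = 1" by (simp add: fou G(3))
    show "fourier T (H 0) \<xi> = 0" if "fourier T (F 0) \<xi> = 0" for \<xi>
      using G(4)[OF that] by (simp add: fou)
    show "(prim ^^ j) H 0 T = 0" if "j \<in> {2..Suc (Suc n)}" for j
    proof (cases "j = Suc (Suc n)")
      case True
      then show ?thesis unfolding iter True top c_def by simp
    next
      case False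
      then show ?thesis using that z[of j] low[of j] by (simp add: iter)
    qed
  qed
qed

section \<open>The biorthogonal family\<close>

text \<open>
  The \<open>p\<close>-th derivative of \<open>e\<^bsup>-iwt\<^esup> \<Phi>(t)\<close> is \<open>e\<^bsup>-iwt\<^esup> w\<^sup>p\<close> times \<open>mod_jet w \<Phi> p 0\<close>; the remaining index
  of \<open>mod_jet\<close> counts the derivatives of this amplitude. Dividing by the powers of \<open>w\<close> makes the
  amplitudes bounded uniformly for \<open>w\<close> away from \<open>0\<close>.
\<close>
primrec mod_jet :: "real \<Rightarrow> (nat \<Rightarrow> real \<Rightarrow> complex) \<Rightarrow> nat \<Rightarrow> nat \<Rightarrow> real \<Rightarrow> complex" where
  "mod_jet w \<Phi> 0 = \<Phi>"
| "mod_jet w \<Phi> (Suc p) = (\<lambda>q t. - \<i> * mod_jet w \<Phi> p q t + mod_jet w \<Phi> p (Suc q) t / of_real w)"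

lemma jet_cmult:
  fixes F :: "nat \<Rightarrow> real \<Rightarrow> complex"
  shows "jet F \<Longrightarrow> jet (\<lambda>p t. c * F p t)"
  unfolding jet_def by (intro allI has_vector_derivative_mult_right) blast

lemma jet_mod_jet: "jet \<Phi> \<Longrightarrow> jet (mod_jet w \<Phi> p)"
proof (induction p)
  case (Suc p)
  then have "jet (mod_jet w \<Phi> p)" by simp
  then have "jet (\<lambda>q t. (\<lambda>q t. - \<i> * mod_jet w \<Phi> p q t) q t + (1 / of_real w) * (mod_jet w \<Phi> p (q + 1) t))"
    by (intro jet_linear_comb jet_shift_order jet_cmult)
  then show ?case by simp
qed simp

lemma supported_mod_jet: "supported a b \<Phi> \<Longrightarrow> supported a b (mod_jet w \<Phi> p)"
  by (induction p) (auto simp: supported_def)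

primrec mod_bound :: "real \<Rightarrow> (nat \<Rightarrow> real) \<Rightarrow> nat \<Rightarrow> nat \<Rightarrow> real" where
  "mod_bound w B 0 q = B q"
| "mod_bound w B (Suc p) q = mod_bound w B p q + mod_bound w B p (Suc q) / w"

lemma mod_jet_bound:
  assumes "\<And>q t. norm (\<Phi> q t) \<le> B q" "0 < w1" "w1 \<le> w"
  shows "norm (mod_jet w \<Phi> p q t) \<le> mod_bound w1 B p q"
proof (induction p arbitrary: q)
  case (Suc p)
  have "norm (mod_jet w \<Phi> p (Suc q) t / of_real w) \<le> mod_bound w1 B p (Suc q) / w1"
    using Suc[of "Suc q"] assms by (auto simp: norm_divide intro!: frac_le order_trans[OF norm_ge_zero Suc])
  moreover have "norm (- \<i> * mod_jet w \<Phi> p q t) \<le> mod_bound w1 B p q"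
    using Suc[of q] by (simp add: norm_mult)
  ultimately show ?case
    unfolding mod_jet.simps mod_bound.simps by (intro norm_triangle_le add_mono)
qed (use assms in simp)

lemma cis_has_vector_derivative:
  "((\<lambda>t. cis (- (w * t))) has_vector_derivative - \<i> * of_real w * cis (- (w * t))) (at t within S)"
proof -
  have "((\<lambda>x. exp (- (\<i> * of_real w * x))) has_field_derivative - \<i> * of_real w * exp (- (\<i> * of_real w * of_real t))) (at (of_real t))"
    by (auto intro!: derivative_eq_intros)
  from has_vector_derivative_real_field[OF this, of S] show ?thesis
    by (simp add: cis_conv_exp mult.assoc)
qed

lemma jet_modulated:
  assumes "jet \<Phi>" "w \<noteq> 0"
  shows "jet (\<lambda>p t. cis (- (w * t)) * (of_real w ^ p * mod_jet w \<Phi> p 0 t))"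
  unfolding jet_def
proof (intro allI)
  fix p t
  have "((\<lambda>t. of_real w ^ p * mod_jet w \<Phi> p 0 t) has_vector_derivative of_real w ^ p * mod_jet w \<Phi> p (Suc 0) t) (at t)"
    by (intro has_vector_derivative_mult_right jetD jet_mod_jet assms)
  note has_vector_derivative_mult[OF cis_has_vector_derivative this, of w]
  moreover have "cis (- (w * t)) * (of_real w ^ p * mod_jet w \<Phi> p (Suc 0) t) +
      - \<i> * of_real w * cis (- (w * t)) * (of_real w ^ p * mod_jet w \<Phi> p 0 t)
    = cis (- (w * t)) * (of_real w ^ Suc p * mod_jet w \<Phi> (Suc p) 0 t)"
    using assms(2) by (simp add: field_simps)
  ultimately show "((\<lambda>t. cis (- (w * t)) * (of_real w ^ p * mod_jet w \<Phi> p 0 t)) has_vector_derivative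
       cis (- (w * t)) * (of_real w ^ Suc p * mod_jet w \<Phi> (Suc p) 0 t)) (at t)"
    by (simp only:)
qed

text \<open>
  The frequency by which amplitudes are measured; the value \<open>1\<close> at \<open>l = 0\<close> makes its powers
  comparable with the weights of the sequence spaces.
\<close>
definition base_freq :: "(nat \<Rightarrow> real) \<Rightarrow> nat \<Rightarrow> real" where
  "base_freq \<omega> l = (if l = 0 then 1 else \<omega> l)"

text \<open>
  \<open>W l (Suc k)\<close> is the \<open>l\<close>-th member of the family, and \<open>W l p\<close> its derivative of order \<open>p - (k+1)\<close>, a
  primitive if \<open>p \<le> k\<close>. The kernel for index \<open>l\<close> is applied to the frequencies \<open>\<lambda>\<^sub>a - \<lambda>\<^sub>l\<close>, \<open>a \<noteq> l\<close>,
  listed alternately to the right and to the left of \<open>l\<close>. Orders up to \<open>2k+1\<close> are those of the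
  derivatives up to order \<open>k\<close>; the bound on \<open>Z l p 1\<close> is what one integration by parts consumes.
\<close>
theorem biorthogonal_family:
  fixes T \<gamma> s :: real and k :: nat and \<omega> :: "nat \<Rightarrow> real"
  assumes T: "T > 0" and mono: "strict_mono \<omega>" and w0: "\<omega> 0 = 0" and g: "\<gamma> > 0" and s: "s > 1"
    and gap: "\<And>a b. \<bar>signed_freq \<omega> a - signed_freq \<omega> b\<bar> \<ge> \<gamma> * real_of_int \<bar>a - b\<bar> powr s"
  obtains W Z :: "nat \<Rightarrow> nat \<Rightarrow> _" and C where
    "\<And>l. jet (W l)"
    "\<And>l p t. t < T/4 \<Longrightarrow> W l p t = 0"
    "\<And>l p t. p \<ge> Suc k \<or> l \<ge> 1 \<Longrightarrow> t > 3*T/4 \<Longrightarrow> W l p t = 0"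
    "\<And>l p. p < k \<Longrightarrow> W l p T = 0"
    "\<And>l j. fourier T (W l (Suc k)) (\<omega> j) = (if j = l then 1 else 0)"
    "\<And>l j. (j, l) \<noteq> (0, 0) \<Longrightarrow> fourier T (W l (Suc k)) (- \<omega> j) = 0"
    "\<And>l p t. W l p t = cis (- (\<omega> l * t)) * (of_real (base_freq \<omega> l powi (int p - int (Suc k))) * Z l p 0 t)"
    "\<And>l p. jet (Z l p)"
    "\<And>l p q t. p \<le> 2*k+1 \<Longrightarrow> q \<le> 1 \<Longrightarrow> t \<in> {0..T} \<Longrightarrow> norm (Z l p q t) \<le> C"
proof -
  obtain B where B: "\<And>\<mu>. (\<forall>n. \<bar>\<mu> n\<bar> \<ge> (\<gamma> / 2 powr s) * real (Suc n) powr s) \<Longrightarrow>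
     (\<exists>\<Phi>. jet \<Phi> \<and> supported (T/4) (3*T/4) \<Phi> \<and> (\<forall>p t. norm (\<Phi> p t) \<le> B p) \<and>
          fourier T (\<Phi> 0) 0 = 1 \<and> (\<forall>n. fourier T (\<Phi> 0) (\<mu> n) = 0))"
    using kernel_with_prescribed_zeros[OF T _ s, of "\<gamma> / 2 powr s"] g by auto
  let ?sf = "signed_freq \<omega>"
  have ex: "\<exists>\<Phi>. jet \<Phi> \<and> supported (T/4) (3*T/4) \<Phi> \<and> (\<forall>p t. norm (\<Phi> p t) \<le> B p) \<and>
          fourier T (\<Phi> 0) 0 = 1 \<and> (\<forall>a. a \<noteq> int l \<longrightarrow> fourier T (\<Phi> 0) (?sf a - ?sf (int l)) = 0)" for l
  proof -
    \<comment> \<open>offsets \<open>1, -1, 2, -2, \<dots>\<close>; the \<open>n\<close>-th one has modulus at least \<open>(n+1)/2\<close>\<close>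
    define off where "off n = (if even n then int (n div 2) + 1 else - int (n div 2) - 1)" for n
    define \<mu> where "\<mu> n = ?sf (int l + off n) - ?sf (int l)" for n
    have "\<bar>\<mu> n\<bar> \<ge> (\<gamma> / 2 powr s) * real (Suc n) powr s" for n
    proof -
      have "real (Suc n) / 2 \<le> real_of_int \<bar>off n\<bar>"
        unfolding off_def by (auto elim!: evenE oddE)
      then have "\<gamma> * (real (Suc n) / 2) powr s \<le> \<gamma> * real_of_int \<bar>off n\<bar> powr s"
        using g s by (intro mult_left_mono powr_mono2) auto
      also have "\<dots> \<le> \<bar>\<mu> n\<bar>"
        using gap[of "int l" "int l + off n"] by (simp add: \<mu>_def abs_minus_commute)
      finally show ?thesis by (simp add: powr_divide)
    qed
    then obtain \<Phi> where \<Phi>: "jet \<Phi>" "supported (T/4) (3*T/4) \<Phi>" "\<forall>p t. norm (\<Phi> p t) \<le> B p"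
          "fourier T (\<Phi> 0) 0 = 1" "\<And>n. fourier T (\<Phi> 0) (\<mu> n) = 0"
      using B[of \<mu>] by blast
    have "fourier T (\<Phi> 0) (?sf a - ?sf (int l)) = 0" if "a \<noteq> int l" for a
    proof -
      define n where "n = (if a > int l then 2 * nat (a - int l - 1) else 2 * nat (int l - a - 1) + 1)"
      have "int l + off n = a" using that by (auto simp: n_def off_def)
      then show ?thesis using \<Phi>(5)[of n] by (simp add: \<mu>_def)
    qed
    then show ?thesis using \<Phi> by blast
  qed
  then obtain \<Phi> where \<Phi>: "\<And>l. jet (\<Phi> l)" "\<And>l. supported (T/4) (3*T/4) (\<Phi> l)" "\<And>l p t. norm (\<Phi> l p t) \<le> B p"
    "\<And>l. fourier T (\<Phi> l 0) 0 = 1" "\<And>l a. a \<noteq> int l \<Longrightarrow> fourier T (\<Phi> l 0) (?sf a - ?sf (int l)) = 0"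
    by metis
  have z1: "fourier T (\<Phi> l 0) (\<omega> j - \<omega> l) = (if j = l then 1 else 0)" for l j
    using \<Phi>(4)[of l] \<Phi>(5)[of "int j" l] by (auto simp: signed_freq_def)
  have z2: "fourier T (\<Phi> l 0) (- \<omega> j - \<omega> l) = 0" if "(j, l) \<noteq> (0, 0)" for l j
    using \<Phi>(5)[of "- int j" l] that w0 by (cases "j = 0") (auto simp: signed_freq_def)
  have ab: "0 < T/4" "3*T/4 < T" "0 \<le> T" using T by auto
  obtain \<Psi> where \<Psi>: "jet \<Psi>" "supported (T/4) (3*T/4) \<Psi>" "fourier T (\<Psi> 0) 0 = 1"
     "\<And>\<xi>. fourier T (\<Phi> 0 0) \<xi> = 0 \<Longrightarrow> fourier T (\<Psi> 0) \<xi> = 0" "\<And>j. j \<in> {2..Suc k} \<Longrightarrow> (prim ^^ j) \<Psi> 0 T = 0"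
    using kill_primitives_at_endpoint[OF \<Phi>(1)[of 0] \<Phi>(2)[of 0] \<Phi>(4)[of 0] ab, of k] by blast
  define W0 where "W0 = (prim ^^ Suc k) \<Psi>"
  define W where "W l p t = (if l = 0 then W0 p t else
     (1 / (- \<i> * of_real (\<omega> l)) ^ Suc k) * (cis (- (\<omega> l * t)) * (of_real (\<omega> l) ^ p * mod_jet (\<omega> l) (\<Phi> l) p 0 t)))" for l p t
  define Z where "Z l p q t = (if l = 0 then W0 (p + q) t else (1 / (- \<i>) ^ Suc k) * mod_jet (\<omega> l) (\<Phi> l) p q t)" for l p q t
  have W0: "jet W0" "left_zero (T/4) W0"
    unfolding W0_def using prim_iter[OF \<Psi>(1) supported_left_zero[OF \<Psi>(2)] ab(1)] by blast+
  have wpos: "\<omega> l > 0" "\<omega> l \<ge> \<omega> 1" if "l \<noteq> 0" for l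
    using strict_mono_less[OF mono, of 0 l] strict_mono_less_eq[OF mono, of 1 l] w0 that by auto
  have jW: "jet (W l)" for l
  proof (cases "l = 0")
    case False
    then have "\<omega> l \<noteq> 0" using wpos[of l] by simp
    have "W l = (\<lambda>p t. (1 / (- \<i> * of_real (\<omega> l)) ^ Suc k) *
        (cis (- (\<omega> l * t)) * (of_real (\<omega> l) ^ p * mod_jet (\<omega> l) (\<Phi> l) p 0 t)))"
      using False by (intro ext) (simp only: W_def if_False)
    then show ?thesis
      by (simp only:) (intro jet_cmult jet_modulated \<Phi>(1) \<open>\<omega> l \<noteq> 0\<close>)
  qed (use W0 in \<open>simp add: W_def[abs_def]\<close>)
  have jZ: "jet (Z l p)" for l p
  proof (cases "l = 0")
    case True
    then show ?thesis using W0(1) by (simp add: Z_def[abs_def] jet_def)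
  next
    case False
    then have "Z l p = (\<lambda>q t. (1 / (- \<i>) ^ Suc k) * mod_jet (\<omega> l) (\<Phi> l) p q t)"
      by (intro ext) (simp only: Z_def if_False)
    then show ?thesis
      by (simp only:) (intro jet_cmult jet_mod_jet \<Phi>(1))
  qed
  have left: "W l p t = 0" if "t < T/4" for l p t
    using that W0(2) supported_mod_jet[OF \<Phi>(2)[of l], of "\<omega> l" p]
    by (auto simp: W_def left_zero_def supported_def)
  have right: "W l p t = 0" if "p \<ge> Suc k \<or> l \<ge> 1" "t > 3*T/4" for l p t
  proof (cases "l = 0")
    case True
    have "W0 p t = \<Psi> (p - Suc k) t"
      unfolding W0_def using prim_iter_ge[of "Suc k" \<Psi> "p - Suc k"] that True by (simp del: funpow.simps)
    then show ?thesis using True that \<Psi>(2) by (simp add: W_def supported_def)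
  next
    case False
    then show ?thesis using that supported_mod_jet[OF \<Phi>(2)[of l], of "\<omega> l" p]
      by (simp add: W_def supported_def)
  qed
  have endp: "W l p T = 0" if "p < k" for l p
  proof (cases "l = 0")
    case True
    have "(prim ^^ Suc k) \<Psi> p = (prim ^^ (Suc k - p)) \<Psi> 0"
      using prim_iter_le[of "Suc k - p" p \<Psi>] that by simp
    then show ?thesis using True \<Psi>(5)[of "Suc k - p"] that by (simp add: W_def W0_def del: funpow.simps)
  next
    case False
    then show ?thesis using right[of p l T] T by simp
  qed
  have fou: "fourier T (W l (Suc k)) \<xi> = of_real ((\<xi> / \<omega> l) ^ Suc k) * fourier T (\<Phi> l 0) (\<xi> - \<omega> l)" if "l \<noteq> 0" for l \<xi>
  proof -
    have "fourier T (W l (Suc k)) \<xi> = (- \<i> * of_real \<xi>) ^ Suc k * fourier T (W l 0) \<xi>"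
      by (rule fourier_deriv_iterated[OF jW _ ab]) (use left right that in \<open>force simp: supported_def\<close>)
    also have "fourier T (W l 0) \<xi> = (1 / (- \<i> * of_real (\<omega> l)) ^ Suc k) * fourier T (\<lambda>t. cis (- (\<omega> l * t)) * \<Phi> l 0 t) \<xi>"
      using that by (simp add: fourier_def W_def integral_mult_right[symmetric] mult.assoc del: power_Suc)
    also have "fourier T (\<lambda>t. cis (- (\<omega> l * t)) * \<Phi> l 0 t) \<xi> = fourier T (\<Phi> l 0) (\<xi> - \<omega> l)"
      by (rule fourier_modulate)
    finally have "fourier T (W l (Suc k)) \<xi> =
        ((- \<i> * of_real \<xi>) / (- \<i> * of_real (\<omega> l))) ^ Suc k * fourier T (\<Phi> l 0) (\<xi> - \<omega> l)"
      by (simp only: power_divide) (simp only: mult.assoc times_divide_eq_left times_divide_eq_right mult_1_left)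
    moreover have "(- \<i> * of_real \<xi>) / (- \<i> * of_real (\<omega> l)) = complex_of_real (\<xi> / \<omega> l)"
      using wpos[OF that] by simp
    ultimately show ?thesis by (simp only: of_real_power)
  qed
  have W00: "W 0 (Suc k) = \<Psi> 0"
    using prim_iter_ge[of "Suc k" \<Psi> 0] by (simp add: W_def[abs_def] W0_def fun_eq_iff)
  have f1: "fourier T (W l (Suc k)) (\<omega> j) = (if j = l then 1 else 0)" for l j
  proof (cases "l = 0")
    case True
    then show ?thesis using \<Psi>(3) \<Psi>(4)[of "\<omega> j"] z1[of 0 j] w0 by (auto simp: W00)
  next
    case False
    then show ?thesis using fou[of l] z1[of l j] wpos[of l] by auto
  qed
  have f2: "fourier T (W l (Suc k)) (- \<omega> j) = 0" if "(j, l) \<noteq> (0, 0)" for l j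
  proof (cases "l = 0")
    case True
    then show ?thesis using \<Psi>(4)[of "- \<omega> j"] z2[of j 0] w0 that by (auto simp: W00)
  next
    case False
    then show ?thesis using fou[of l] z2[OF that] by simp
  qed
  have WZ: "W l p t = cis (- (\<omega> l * t)) * (of_real (base_freq \<omega> l powi (int p - int (Suc k))) * Z l p 0 t)" for l p t
  proof (cases "l = 0")
    case True
    then show ?thesis by (simp add: W_def Z_def base_freq_def w0)
  next
    case False
    have "base_freq \<omega> l powi (int p - int (Suc k)) = \<omega> l ^ p / \<omega> l ^ Suc k"
      using False wpos[of l] by (simp add: base_freq_def power_int_diff del: of_nat_Suc power_Suc)
    moreover have "(- \<i> * complex_of_real (\<omega> l)) ^ Suc k = (- \<i>) ^ Suc k * of_real (\<omega> l) ^ Suc k"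
      by (rule power_mult_distrib)
    ultimately show ?thesis
      using False unfolding W_def Z_def by (simp add: field_simps del: power_Suc of_nat_Suc)
  qed
  obtain C0 where C0: "\<And>p t. t \<in> {0..T} \<Longrightarrow> norm (W0 p t) \<le> C0 p"
  proof -
    have "\<exists>C. \<forall>t\<in>{0..T}. norm (W0 p t) \<le> C" for p
    proof -
      have "compact (W0 p ` {0..T})"
        by (intro compact_continuous_image jet_continuous_on W0) auto
      then show ?thesis using compact_imp_bounded bounded_iff by (metis imageI)
    qed
    then show ?thesis using that by metis
  qed
  define m where "m = (\<lambda>(p, q). max (C0 (p + q)) (mod_bound (\<omega> 1) B p q))"
  define C where "C = Max (m ` ({..2*k+1} \<times> {..1}))"
  have "norm (Z l p q t) \<le> C" if "p \<le> 2*k+1" "q \<le> 1" "t \<in> {0..T}" for l p q t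
  proof -
    have "norm (Z l p q t) \<le> m (p, q)"
    proof (cases "l = 0")
      case True
      then show ?thesis using C0[OF that(3), of "p + q"] by (simp add: Z_def m_def)
    next
      case False
      have "norm (mod_jet (\<omega> l) (\<Phi> l) p q t) \<le> mod_bound (\<omega> 1) B p q"
        by (rule mod_jet_bound) (use \<Phi>(3) wpos[of l] wpos[of 1] False in auto)
      then show ?thesis using False by (simp add: Z_def m_def norm_mult norm_divide norm_power del: power_Suc)
    qed
    also have "\<dots> \<le> C"
      unfolding C_def using that by (intro Max_ge) auto
    finally show ?thesis .
  qed
  note Zb = this
  show thesis
    by (rule that; (rule jW left right endp f1 f2 WZ jZ Zb; assumption))
qed

section \<open>Almost orthogonality\<close>

lemma oscillatory_integral_bound:
  fixes f f' :: "real \<Rightarrow> complex"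
  assumes d: "\<And>t. (f has_vector_derivative f' t) (at t)" and c: "continuous_on {0..T} f'"
    and z: "f 0 = 0" "f T = 0" and K: "\<And>t. t \<in> {0..T} \<Longrightarrow> norm (f' t) \<le> K"
    and T: "T \<ge> 0" and mu: "w \<noteq> 0"
  shows "norm (integral {0..T} (\<lambda>t. cis (- (w * t)) * f t)) \<le> T * K / \<bar>w\<bar>"
proof -
  have cf: "continuous_on {0..T} f"
    using d by (meson continuous_at_imp_continuous_on has_vector_derivative_continuous)
  have i1: "(\<lambda>t. cis (- (w * t)) * f t) integrable_on {0..T}"
    and i2: "(\<lambda>t. cis (- (w * t)) * f' t) integrable_on {0..T}"
    by (intro integrable_continuous_real continuous_intros cf c)+
  have "((\<lambda>t. cis (- (w * t)) * f' t + (- \<i> * of_real w) * (cis (- (w * t)) * f t))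
      has_integral (cis (- (w * T)) * f T - cis (- (w * 0)) * f 0)) {0..T}"
  proof (rule fundamental_theorem_of_calculus[OF T])
    fix t
    from has_vector_derivative_mult[OF cis_has_vector_derivative has_vector_derivative_at_within[OF d]]
    show "((\<lambda>t. cis (- (w * t)) * f t) has_vector_derivative
      cis (- (w * t)) * f' t + (- \<i> * of_real w) * (cis (- (w * t)) * f t)) (at t within {0..T})"
      by (simp add: mult.assoc)
  qed
  then have "integral {0..T} (\<lambda>t. cis (- (w * t)) * f' t + (- \<i> * of_real w) * (cis (- (w * t)) * f t)) = 0"
    using z by (simp add: integral_unique)
  then have "integral {0..T} (\<lambda>t. cis (- (w * t)) * f' t) + (- \<i> * of_real w) * integral {0..T} (\<lambda>t. cis (- (w * t)) * f t) = 0"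
    by (simp only: integral_add[OF i2 integrable_on_mult_right[OF i1]] integral_mult_right)
  then have "integral {0..T} (\<lambda>t. cis (- (w * t)) * f' t) = \<i> * of_real w * integral {0..T} (\<lambda>t. cis (- (w * t)) * f t)"
    by (simp add: algebra_simps add_eq_0_iff)
  then have "\<bar>w\<bar> * norm (integral {0..T} (\<lambda>t. cis (- (w * t)) * f t)) = norm (integral {0..T} (\<lambda>t. cis (- (w * t)) * f' t))"
    by (simp add: norm_mult)
  also have "\<dots> \<le> integral {0..T} (\<lambda>t. K)"
    using K by (intro integral_norm_bound_integral i2) (auto simp: norm_mult)
  also have "\<dots> = T * K" using T by simp
  finally show ?thesis using mu by (simp add: field_simps)
qed

lemma schur_row_sum:
  fixes s :: real
  assumes "s > 1" "finite A"
  shows "(\<Sum>m\<in>A. (1 + \<bar>real l - real m\<bar>) powr - s) \<le> 2 * (\<Sum>n. real (Suc n) powr - s)"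
proof -
  let ?f = "\<lambda>n. real (Suc n) powr - s"
  have sm: "summable ?f" by (rule summable_shift_powr[OF assms(1)])
  have 1: "(\<Sum>m\<in>A \<inter> {..l}. (1 + \<bar>real l - real m\<bar>) powr - s) \<le> suminf ?f"
  proof -
    have "(\<Sum>m\<in>A \<inter> {..l}. (1 + \<bar>real l - real m\<bar>) powr - s) = sum ?f ((\<lambda>m. l - m) ` (A \<inter> {..l}))"
      by (subst sum.reindex) (auto simp: inj_on_def of_nat_diff intro!: sum.cong)
    also have "\<dots> \<le> suminf ?f"
      using assms by (intro sum_le_suminf sm) auto
    finally show ?thesis .
  qed
  have 2: "(\<Sum>m\<in>A - {..l}. (1 + \<bar>real l - real m\<bar>) powr - s) \<le> suminf ?f"
  proof -
    have "(\<Sum>m\<in>A - {..l}. (1 + \<bar>real l - real m\<bar>) powr - s) = sum ?f ((\<lambda>m. m - l) ` (A - {..l}))"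
      by (subst sum.reindex) (auto simp: inj_on_def of_nat_diff intro!: sum.cong)
    also have "\<dots> \<le> suminf ?f"
      using assms by (intro sum_le_suminf sm) auto
    finally show ?thesis .
  qed
  have "A = (A \<inter> {..l}) \<union> (A - {..l})" by auto
  then have "(\<Sum>m\<in>A. (1 + \<bar>real l - real m\<bar>) powr - s) =
     (\<Sum>m\<in>A \<inter> {..l}. (1 + \<bar>real l - real m\<bar>) powr - s) + (\<Sum>m\<in>A - {..l}. (1 + \<bar>real l - real m\<bar>) powr - s)"
    using assms(2) by (metis sum.Int_Diff)
  then show ?thesis using 1 2 by simp
qed

text \<open>
  Schur's test: \<open>|c\<^sub>l||c\<^sub>m|\<close> is at most the mean of the squares, and by symmetry of the bound on the Gram
  matrix both halves give the same row sums, which converge because \<open>s > 1\<close>.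
\<close>
lemma bessel_almost_orthogonal:
  fixes E :: "nat \<Rightarrow> real \<Rightarrow> complex"
  assumes c: "\<And>l. continuous_on {0..T} (E l)" and s: "s > 1" and K: "K \<ge> 0"
    and gram: "\<And>l m. norm (integral {0..T} (\<lambda>t. E l t * cnj (E m t))) \<le> K * (1 + \<bar>real l - real m\<bar>) powr - s"
    and A: "finite A"
  shows "integral {0..T} (\<lambda>t. (norm (\<Sum>l\<in>A. c l * E l t))\<^sup>2)
      \<le> K * (2 * (\<Sum>n. real (Suc n) powr - s)) * (\<Sum>l\<in>A. (norm (c l))\<^sup>2)"
proof -
  let ?S = "2 * (\<Sum>n. real (Suc n) powr - s)"
  let ?k = "\<lambda>l m. (1 + \<bar>real l - real m\<bar>) powr - s"
  have cE: "continuous_on {0..T} (\<lambda>t. \<Sum>l\<in>A. c l * E l t)"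
    by (intro continuous_intros c)
  have "complex_of_real (integral {0..T} (\<lambda>t. (norm (\<Sum>l\<in>A. c l * E l t))\<^sup>2))
      = integral {0..T} (\<lambda>t. complex_of_real ((norm (\<Sum>l\<in>A. c l * E l t))\<^sup>2))"
    by (rule integral_unique[symmetric], rule has_integral_of_real)
       (intro integrable_integral integrable_continuous_real continuous_intros cE)
  also have "\<dots> = integral {0..T} (\<lambda>t. \<Sum>l\<in>A. \<Sum>m\<in>A. (c l * cnj (c m)) * (E l t * cnj (E m t)))"
    by (simp only: complex_norm_square cnj_sum sum_product complex_cnj_mult mult_ac)
  also have "\<dots> = (\<Sum>l\<in>A. \<Sum>m\<in>A. (c l * cnj (c m)) * integral {0..T} (\<lambda>t. E l t * cnj (E m t)))"
  proof -
    have i: "(\<lambda>t. (c l * cnj (c m)) * (E l t * cnj (E m t))) integrable_on {0..T}" for l m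
      by (intro integrable_continuous_real continuous_intros c)
    have "integral {0..T} (\<lambda>t. \<Sum>l\<in>A. \<Sum>m\<in>A. (c l * cnj (c m)) * (E l t * cnj (E m t)))
        = (\<Sum>l\<in>A. integral {0..T} (\<lambda>t. \<Sum>m\<in>A. (c l * cnj (c m)) * (E l t * cnj (E m t))))"
      by (rule integral_sum[OF A]) (intro integrable_sum A i)
    also have "\<dots> = (\<Sum>l\<in>A. \<Sum>m\<in>A. integral {0..T} (\<lambda>t. (c l * cnj (c m)) * (E l t * cnj (E m t))))"
      by (rule sum.cong[OF refl], rule integral_sum[OF A], rule i)
    finally show ?thesis by (simp only: integral_mult_right)
  qed
  finally have eq: "complex_of_real (integral {0..T} (\<lambda>t. (norm (\<Sum>l\<in>A. c l * E l t))\<^sup>2))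
    = (\<Sum>l\<in>A. \<Sum>m\<in>A. (c l * cnj (c m)) * integral {0..T} (\<lambda>t. E l t * cnj (E m t)))" .
  have "integral {0..T} (\<lambda>t. (norm (\<Sum>l\<in>A. c l * E l t))\<^sup>2)
     \<le> norm (\<Sum>l\<in>A. \<Sum>m\<in>A. (c l * cnj (c m)) * integral {0..T} (\<lambda>t. E l t * cnj (E m t)))"
    unfolding eq[symmetric] norm_of_real by (rule abs_ge_self)
  also have "\<dots> \<le> (\<Sum>l\<in>A. \<Sum>m\<in>A. ((norm (c l))\<^sup>2 / 2 + (norm (c m))\<^sup>2 / 2) * (K * ?k l m))"
  proof (intro order_trans[OF norm_sum] sum_mono)
    fix l m
    have "norm ((c l * cnj (c m)) * integral {0..T} (\<lambda>t. E l t * cnj (E m t))) \<le> (norm (c l) * norm (c m)) * (K * ?k l m)"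
      unfolding norm_mult complex_mod_cnj by (intro mult_left_mono gram) auto
    also have "\<dots> \<le> ((norm (c l))\<^sup>2 / 2 + (norm (c m))\<^sup>2 / 2) * (K * ?k l m)"
      using K sum_squares_bound[of "norm (c l)" "norm (c m)"] by (intro mult_right_mono) auto
    finally show "norm ((c l * cnj (c m)) * integral {0..T} (\<lambda>t. E l t * cnj (E m t)))
       \<le> ((norm (c l))\<^sup>2 / 2 + (norm (c m))\<^sup>2 / 2) * (K * ?k l m)" .
  qed
  also have "\<dots> = (\<Sum>l\<in>A. \<Sum>m\<in>A. (norm (c l))\<^sup>2 / 2 * (K * ?k l m)) + (\<Sum>l\<in>A. \<Sum>m\<in>A. (norm (c m))\<^sup>2 / 2 * (K * ?k l m))"
    by (simp only: distrib_right sum.distrib)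
  also have "(\<Sum>l\<in>A. \<Sum>m\<in>A. (norm (c m))\<^sup>2 / 2 * (K * ?k l m)) = (\<Sum>l\<in>A. \<Sum>m\<in>A. (norm (c l))\<^sup>2 / 2 * (K * ?k l m))"
    by (subst sum.swap) (simp add: abs_minus_commute)
  also have "(\<Sum>l\<in>A. \<Sum>m\<in>A. (norm (c l))\<^sup>2 / 2 * (K * ?k l m)) \<le> (\<Sum>l\<in>A. (norm (c l))\<^sup>2 / 2 * (K * ?S))"
  proof (rule sum_mono)
    fix l
    have "(\<Sum>m\<in>A. (norm (c l))\<^sup>2 / 2 * (K * ?k l m)) = (norm (c l))\<^sup>2 / 2 * (K * (\<Sum>m\<in>A. ?k l m))"
      by (simp add: sum_distrib_left)
    also have "\<dots> \<le> (norm (c l))\<^sup>2 / 2 * (K * ?S)"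
      using K schur_row_sum[OF s A, of l] by (intro mult_left_mono) auto
    finally show "(\<Sum>m\<in>A. (norm (c l))\<^sup>2 / 2 * (K * ?k l m)) \<le> (norm (c l))\<^sup>2 / 2 * (K * ?S)" .
  qed
  finally show ?thesis
    by (simp add: sum_distrib_left[symmetric] sum_distrib_right[symmetric] sum_divide_distrib[symmetric] algebra_simps)
qed

text \<open>
  For \<open>l \<noteq> m\<close> the product of the two amplitudes vanishes at both ends of \<open>[0,T]\<close>: at most one of the
  indices is \<open>0\<close>, and the other factor is compactly supported at every order. One integration by
  parts against \<open>e\<^bsup>-i(\<omega>\<^sub>l-\<omega>\<^sub>m)t\<^esup>\<close> gains \<open>1/|\<omega>\<^sub>l - \<omega>\<^sub>m|\<close>, hence the off-diagonal decay \<open>|l-m|\<^sup>-\<^sup>s\<close>.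
\<close>
theorem bessel_biorthogonal_family:
  fixes T \<gamma> s :: real and k :: nat and \<omega> :: "nat \<Rightarrow> real"
  assumes T: "T > 0" and mono: "strict_mono \<omega>" and w0: "\<omega> 0 = 0" and g: "\<gamma> > 0" and s: "s > 1"
    and gap: "\<And>a b. \<bar>signed_freq \<omega> a - signed_freq \<omega> b\<bar> \<ge> \<gamma> * real_of_int \<bar>a - b\<bar> powr s"
  obtains W :: "nat \<Rightarrow> nat \<Rightarrow> real \<Rightarrow> complex" and C where
    "C \<ge> 0" "\<And>l. jet (W l)"
    "\<And>l p t. t < T/4 \<Longrightarrow> W l p t = 0"
    "\<And>l p t. p \<ge> Suc k \<Longrightarrow> t > 3*T/4 \<Longrightarrow> W l p t = 0"
    "\<And>l p. p < k \<Longrightarrow> W l p T = 0"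
    "\<And>l j. fourier T (W l (Suc k)) (\<omega> j) = (if j = l then 1 else 0)"
    "\<And>l j. (j, l) \<noteq> (0, 0) \<Longrightarrow> fourier T (W l (Suc k)) (- \<omega> j) = 0"
    "\<And>l p t. p \<le> 2*k+1 \<Longrightarrow> t \<in> {0..T} \<Longrightarrow> norm (W l p t) \<le> C * base_freq \<omega> l powi (int p - int (Suc k))"
    "\<And>A c p. p \<le> 2*k+1 \<Longrightarrow> finite A \<Longrightarrow> integral {0..T} (\<lambda>t. (norm (\<Sum>l\<in>A. c l * W l p t))\<^sup>2)
       \<le> C * (\<Sum>l\<in>A. (norm (c l) * base_freq \<omega> l powi (int p - int (Suc k)))\<^sup>2)"
proof -
  obtain W Z C0 where jW: "\<And>l. jet (W l)"
    and left: "\<And>l p t. t < T/4 \<Longrightarrow> W l p t = 0"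
    and right: "\<And>l p t. p \<ge> Suc k \<or> l \<ge> 1 \<Longrightarrow> t > 3*T/4 \<Longrightarrow> W l p t = 0"
    and endp: "\<And>l p. p < k \<Longrightarrow> W l p T = 0"
    and f1: "\<And>l j. fourier T (W l (Suc k)) (\<omega> j) = (if j = l then 1 else 0)"
    and f2: "\<And>l j. (j, l) \<noteq> (0, 0) \<Longrightarrow> fourier T (W l (Suc k)) (- \<omega> j) = 0"
    and WZ: "\<And>l p t. W l p t = cis (- (\<omega> l * t)) * (of_real (base_freq \<omega> l powi (int p - int (Suc k))) * Z l p 0 t)"
    and jZ: "\<And>l p. jet (Z l p)"
    and Zb: "\<And>l p q t. p \<le> 2*k+1 \<Longrightarrow> q \<le> 1 \<Longrightarrow> t \<in> {0..T} \<Longrightarrow> norm (Z l p q t :: complex) \<le> C0"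
    by (rule biorthogonal_family[OF T mono w0 g s gap, of k]) (rule that; assumption)
  have bpos: "base_freq \<omega> l > 0" for l
    using strict_mono_less[OF mono, of 0 l] w0 by (simp add: base_freq_def)
  have C0: "C0 \<ge> 0" using Zb[of 0 0 0] T by (meson atLeastAtMost_iff le0 less_imp_le norm_ge_zero order_refl order_trans)
  have Z0: "Z l p 0 t = 0" if "W l p t = 0" for l p t
    using that bpos[of l] unfolding WZ by auto
  define K where "K = max (T * C0\<^sup>2) (T * (2 * C0\<^sup>2) / \<gamma> * 2 powr s)"
  have K: "K \<ge> 0" using T by (simp add: K_def le_max_iff_disj)
  define E where "E p l t = cis (- (\<omega> l * t)) * Z l p 0 t" for p l t
  have cE: "continuous_on {0..T} (E p l)" for p l
    unfolding E_def by (intro continuous_intros jet_continuous_on jZ)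
  have gram: "norm (integral {0..T} (\<lambda>t. E p l t * cnj (E p m t))) \<le> K * (1 + \<bar>real l - real m\<bar>) powr - s"
    if p: "p \<le> 2*k+1" for p l m
  proof (cases "l = m")
    case True
    have "norm (integral {0..T} (\<lambda>t. E p l t * cnj (E p m t))) \<le> integral {0..T} (\<lambda>t. C0\<^sup>2)"
    proof (rule integral_norm_bound_integral)
      show "(\<lambda>t. E p l t * cnj (E p m t)) integrable_on {0..T}"
        by (intro integrable_continuous_real continuous_intros cE)
      show "norm (E p l t * cnj (E p m t)) \<le> C0\<^sup>2" if "t \<in> {0..T}" for t
        unfolding E_def norm_mult power2_eq_square complex_mod_cnj norm_cis mult_1_left
        using C0 by (intro mult_mono Zb p that) auto
    qed auto
    also have "\<dots> \<le> K" using T by (simp add: K_def)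
    finally show ?thesis using True by simp
  next
    case False
    define f where "f t = Z l p 0 t * cnj (Z m p 0 t)" for t
    define f' where "f' t = Z l p 0 t * cnj (Z m p 1 t) + Z l p 1 t * cnj (Z m p 0 t)" for t
    have "norm (integral {0..T} (\<lambda>t. cis (- ((\<omega> l - \<omega> m) * t)) * f t)) \<le> T * (2 * C0\<^sup>2) / \<bar>\<omega> l - \<omega> m\<bar>"
    proof (rule oscillatory_integral_bound)
      show "(f has_vector_derivative f' t) (at t)" for t
        unfolding f_def[abs_def] f'_def One_nat_def
        by (intro has_vector_derivative_mult has_vector_derivative_cnj jetD jZ)
      show "continuous_on {0..T} f'"
        unfolding f'_def by (intro continuous_intros jet_continuous_on jZ)
      show "f 0 = 0" using Z0[OF left] T by (simp add: f_def)
      show "f T = 0"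
      proof -
        from False have "l \<ge> 1 \<or> m \<ge> 1" by linarith
        then have "W l p T = 0 \<or> W m p T = 0" using right[of p _ T] T by force
        then show ?thesis using Z0 by (auto simp: f_def)
      qed
      show "norm (f' t) \<le> 2 * C0\<^sup>2" if "t \<in> {0..T}" for t
      proof -
        have "norm (f' t) \<le> C0 * C0 + C0 * C0"
          unfolding f'_def using C0 that p
          by (intro norm_triangle_le add_mono; simp only: norm_mult complex_mod_cnj)
             (intro mult_mono Zb; simp)+
        then show ?thesis by (simp add: power2_eq_square)
      qed
      show "\<omega> l - \<omega> m \<noteq> 0" using False strict_mono_eq[OF mono, of l m] by simp
    qed (use T in simp)
    also have "(\<lambda>t. cis (- ((\<omega> l - \<omega> m) * t)) * f t) = (\<lambda>t. E p l t * cnj (E p m t))"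
    proof
      fix t
      have "cis (- ((\<omega> l - \<omega> m) * t)) = cis (- (\<omega> l * t)) * cnj (cis (- (\<omega> m * t)))"
        by (simp only: cis_cnj cis_mult) (simp add: algebra_simps)
      then show "cis (- ((\<omega> l - \<omega> m) * t)) * f t = E p l t * cnj (E p m t)"
        by (simp add: E_def f_def)
    qed
    also have "T * (2 * C0\<^sup>2) / \<bar>\<omega> l - \<omega> m\<bar> \<le> T * (2 * C0\<^sup>2) / (\<gamma> * ((1 + \<bar>real l - real m\<bar>) / 2) powr s)"
    proof (rule divide_left_mono)
      have d1: "1 \<le> \<bar>real l - real m\<bar>" using False by linarith
      then have "((1 + \<bar>real l - real m\<bar>) / 2) powr s \<le> \<bar>real l - real m\<bar> powr s"
        using s by (intro powr_mono2) auto
      then have "\<gamma> * ((1 + \<bar>real l - real m\<bar>) / 2) powr s \<le> \<gamma> * \<bar>real l - real m\<bar> powr s"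
        using g by (intro mult_left_mono) auto
      also have "\<dots> \<le> \<bar>\<omega> l - \<omega> m\<bar>"
        using gap[of "int l" "int m"] by (simp add: signed_freq_def)
      finally show *: "\<gamma> * ((1 + \<bar>real l - real m\<bar>) / 2) powr s \<le> \<bar>\<omega> l - \<omega> m\<bar>" .
      have pos: "0 < \<gamma> * ((1 + \<bar>real l - real m\<bar>) / 2) powr s"
        using g by (intro mult_pos_pos) auto
      show "0 < \<bar>\<omega> l - \<omega> m\<bar> * (\<gamma> * ((1 + \<bar>real l - real m\<bar>) / 2) powr s)"
        by (rule mult_pos_pos[OF less_le_trans[OF pos *] pos])
    qed (use T in auto)
    also have "\<dots> = T * (2 * C0\<^sup>2) / \<gamma> * 2 powr s * (1 + \<bar>real l - real m\<bar>) powr - s"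
      by (simp add: powr_divide powr_minus field_simps)
    also have "\<dots> \<le> K * (1 + \<bar>real l - real m\<bar>) powr - s"
      unfolding K_def by (intro mult_right_mono) auto
    finally show ?thesis .
  qed
  define C1 where "C1 = K * (2 * (\<Sum>n. real (Suc n) powr - s))"
  define C where "C = max C0 C1"
  have C: "C \<ge> 0" using C0 by (simp add: C_def)
  have "norm (W l p t) \<le> C * base_freq \<omega> l powi (int p - int (Suc k))" if "p \<le> 2*k+1" "t \<in> {0..T}" for l p t
  proof -
    have pw: "base_freq \<omega> l powi (int p - int (Suc k)) > 0"
      using bpos by (rule zero_less_power_int)
    have "norm (W l p t) = base_freq \<omega> l powi (int p - int (Suc k)) * norm (Z l p 0 t)"
      unfolding WZ norm_mult norm_cis norm_of_real using pw by simp
    also have "\<dots> \<le> base_freq \<omega> l powi (int p - int (Suc k)) * C"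
      using Zb[of p 0 t l] that pw by (intro mult_left_mono) (auto simp: C_def)
    finally show ?thesis by (simp add: mult.commute)
  qed
  note Wb = this
  have "integral {0..T} (\<lambda>t. (norm (\<Sum>l\<in>A. c l * W l p t))\<^sup>2)
       \<le> C * (\<Sum>l\<in>A. (norm (c l) * base_freq \<omega> l powi (int p - int (Suc k)))\<^sup>2)"
    if p: "p \<le> 2*k+1" and A: "finite A" for p A c
  proof -
    let ?b = "\<lambda>l. base_freq \<omega> l powi (int p - int (Suc k))"
    have pw: "?b l > 0" for l using bpos by (rule zero_less_power_int)
    have "integral {0..T} (\<lambda>t. (norm (\<Sum>l\<in>A. c l * W l p t))\<^sup>2)
       = integral {0..T} (\<lambda>t. (norm (\<Sum>l\<in>A. (c l * of_real (?b l)) * E p l t))\<^sup>2)"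
      by (simp only: WZ E_def mult_ac)
    also have "\<dots> \<le> C1 * (\<Sum>l\<in>A. (norm (c l * of_real (?b l)))\<^sup>2)"
      unfolding C1_def by (rule bessel_almost_orthogonal[OF cE s K gram[OF p] A])
    also have "\<dots> = C1 * (\<Sum>l\<in>A. (norm (c l) * ?b l)\<^sup>2)"
      using pw by (simp only: norm_mult norm_of_real abs_of_pos)
    also have "\<dots> \<le> C * (\<Sum>l\<in>A. (norm (c l) * ?b l)\<^sup>2)"
      by (intro mult_right_mono sum_nonneg) (auto simp: C_def)
    finally show ?thesis .
  qed
  note bessel = this
  have right': "W l p t = 0" if "p \<ge> Suc k" "t > 3*T/4" for l p t
    using right[of p l t] that by blast
  show thesis
    by (rule that; (rule C jW left right' endp f1 f2 Wb bessel; assumption))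
qed

section \<open>Square-integrable functions\<close>

lemma finite_measure_leb: "finite_measure (leb T)"
  by (intro finite_measure_lebesgue_on) auto

lemma continuous_leb:
  fixes f :: "real \<Rightarrow> 'a::euclidean_space"
  assumes "continuous_on {0..T} f"
  shows "f \<in> borel_measurable (leb T)" "integrable (leb T) f" "(LINT t|leb T. f t) = integral {0..T} f"
proof -
  show m: "f \<in> borel_measurable (leb T)"
    by (rule continuous_imp_measurable_on_sets_lebesgue[OF continuous_on_subset[OF assms]]) auto
  have "compact (f ` {0..T})" by (intro compact_continuous_image assms) auto
  then obtain B where B: "\<And>t. t \<in> {0..T} \<Longrightarrow> norm (f t) \<le> B"
    using compact_imp_bounded bounded_iff by (metis imageI)
  show i: "integrable (leb T) f"
    by (rule finite_measure.integrable_const_bound[OF finite_measure_leb _ m, of B]) (auto intro!: AE_I2 B)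
  have "(LINT t|leb T. f t) = integral {0<..<T} f"
    using i by (intro lebesgue_integral_eq_integral) auto
  also have "\<dots> = integral {0..T} f"
    using integral_open_interval[of 0 T f] by (simp add: box_real)
  finally show "(LINT t|leb T. f t) = integral {0..T} f" .
qed

lemma L2_continuous:
  assumes "continuous_on {0..T} f"
  shows "f \<in> L2_space T"
  unfolding L2_space_def using assms by (auto intro!: continuous_leb continuous_intros)

lemma L2_times_integrable:
  assumes "f \<in> L2_space T" "g \<in> L2_space T"
  shows "integrable (leb T) (\<lambda>t. f t * g t)"
proof (rule Bochner_Integration.integrable_bound)
  show "integrable (leb T) (\<lambda>t. (f t)\<^sup>2 + (g t)\<^sup>2)"
    using assms by (auto simp: L2_space_def)
  show "(\<lambda>t. f t * g t) \<in> borel_measurable (leb T)"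
    using assms by (auto simp: L2_space_def)
  have "\<bar>f t * g t\<bar> \<le> (f t)\<^sup>2 + (g t)\<^sup>2" for t
    using sum_squares_bound[of "\<bar>f t\<bar>" "\<bar>g t\<bar>"] abs_ge_zero[of "f t * g t"]
    unfolding abs_mult power2_abs by linarith
  then show "AE t in leb T. norm (f t * g t) \<le> norm ((f t)\<^sup>2 + (g t)\<^sup>2)"
    by (intro AE_I2) (metis abs_ge_self order_trans real_norm_def)
qed

lemma L2_linear_comb:
  assumes "f \<in> L2_space T" "g \<in> L2_space T"
  shows "(\<lambda>t. f t + c * g t) \<in> L2_space T"
proof -
  have "integrable (leb T) (\<lambda>t. (f t)\<^sup>2 + 2 * c * (f t * g t) + c\<^sup>2 * (g t)\<^sup>2)"
    using assms L2_times_integrable[OF assms] by (auto simp: L2_space_def)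
  then show ?thesis
    using assms by (auto simp: L2_space_def power2_eq_square algebra_simps)
qed

lemma L2_diff:
  assumes "f \<in> L2_space T" "g \<in> L2_space T"
  shows "(\<lambda>t. f t - g t) \<in> L2_space T"
  using L2_linear_comb[OF assms, of "-1"] by simp

lemma L2_integrable: "f \<in> L2_space T \<Longrightarrow> integrable (leb T) f"
  using L2_times_integrable[of f T "\<lambda>_. 1"] L2_continuous[of T "\<lambda>_. 1"] by simp

lemma L2_Cauchy_Schwarz:
  assumes f: "f \<in> L2_space T" and g: "g \<in> L2_space T"
  shows "\<bar>LINT t|leb T. f t * g t\<bar> \<le> sqrt (LINT t|leb T. (f t)\<^sup>2) * sqrt (LINT t|leb T. (g t)\<^sup>2)"
proof -
  define A where "A = (LINT t|leb T. (f t)\<^sup>2)"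
  define B where "B = (LINT t|leb T. (g t)\<^sup>2)"
  define C where "C = (LINT t|leb T. f t * g t)"
  have q: "0 \<le> A + 2 * c * C + c\<^sup>2 * B" for c
  proof -
    have "0 \<le> (LINT t|leb T. (f t + c * g t)\<^sup>2)" by simp
    also have "\<dots> = (LINT t|leb T. ((f t)\<^sup>2 + (2 * c) * (f t * g t)) + c\<^sup>2 * (g t)\<^sup>2)"
      by (simp add: power2_eq_square algebra_simps)
    also have "\<dots> = A + 2 * c * C + c\<^sup>2 * B"
      using f g L2_times_integrable[OF f g] by (simp add: L2_space_def A_def B_def C_def)
    finally show ?thesis .
  qed
  have B0: "B \<ge> 0" "A \<ge> 0" by (simp_all add: B_def A_def)
  have "C\<^sup>2 \<le> A * B"
  proof (cases "B = 0")
    case True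
    have "C = 0"
    proof (rule ccontr)
      assume "C \<noteq> 0"
      \<comment> \<open>for \<open>B = 0\<close> the form is affine in \<open>c\<close> and takes the value \<open>-1\<close> at this \<open>c\<close>\<close>
      then have "2 * (- (A + 1) / (2 * C)) * C = - (A + 1)"
        by (simp only: times_divide_eq_right times_divide_eq_left) simp
      then show False using q[of "- (A + 1) / (2 * C)"] unfolding True by linarith
    qed
    then show ?thesis using B0 by simp
  next
    case False
    have "0 \<le> B * (A + 2 * (- C / B) * C + (- C / B)\<^sup>2 * B)"
      using q[of "- C / B"] B0 by (intro mult_nonneg_nonneg) auto
    also have "\<dots> = A * B - C\<^sup>2"
      using False by (simp add: power2_eq_square field_simps)
    finally show ?thesis by simp
  qed
  then have "\<bar>C\<bar> \<le> sqrt (A * B)"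
    by (metis real_le_rsqrt power2_abs)
  then show ?thesis by (simp add: A_def B_def C_def real_sqrt_mult)
qed

text \<open>
  Fatou's lemma, in the form in which bounds on the partial sums pass to their limits.
\<close>
lemma L2_Fatou:
  assumes h: "\<And>i. h i \<in> L2_space T" and v: "v \<in> borel_measurable (leb T)"
    and lim: "AE t in leb T. (\<lambda>i. h i t) \<longlonglongrightarrow> v t"
    and K: "\<And>i. i \<ge> N \<Longrightarrow> (LINT t|leb T. (h i t)\<^sup>2) \<le> K"
  shows "v \<in> L2_space T" "(LINT t|leb T. (v t)\<^sup>2) \<le> K"
proof -
  have K0: "K \<ge> 0"
    using K[of N] order_trans[of 0 "LINT t|leb T. (h N t)\<^sup>2" K] by simp
  have hm: "h i \<in> borel_measurable (leb T)" for i using h by (simp add: L2_space_def)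
  have "(\<integral>\<^sup>+ t. ennreal ((v t)\<^sup>2) \<partial>leb T) = (\<integral>\<^sup>+ t. liminf (\<lambda>i. ennreal ((h i t)\<^sup>2)) \<partial>leb T)"
  proof (rule nn_integral_cong_AE)
    show "AE t in leb T. ennreal ((v t)\<^sup>2) = liminf (\<lambda>i. ennreal ((h i t)\<^sup>2))"
      using lim
    proof eventually_elim
      case (elim t)
      have "(\<lambda>i. ennreal ((h i t)\<^sup>2)) \<longlonglongrightarrow> ennreal ((v t)\<^sup>2)"
        by (intro tendsto_ennrealI tendsto_power elim)
      from lim_imp_Liminf[OF sequentially_bot this] show ?case by simp
    qed
  qed
  also have "\<dots> \<le> liminf (\<lambda>i. \<integral>\<^sup>+ t. ennreal ((h i t)\<^sup>2) \<partial>leb T)"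
    using hm by (intro nn_integral_liminf) measurable
  also have "\<dots> \<le> ennreal K"
  proof (rule Liminf_le)
    show "\<forall>\<^sub>F i in sequentially. (\<integral>\<^sup>+ t. ennreal ((h i t)\<^sup>2) \<partial>leb T) \<le> ennreal K"
      unfolding eventually_sequentially
    proof (intro exI allI impI)
      fix i assume "N \<le> i"
      have "(\<integral>\<^sup>+ t. ennreal ((h i t)\<^sup>2) \<partial>leb T) = ennreal (LINT t|leb T. (h i t)\<^sup>2)"
        using h[of i] by (intro nn_integral_eq_integral) (auto simp: L2_space_def)
      then show "(\<integral>\<^sup>+ t. ennreal ((h i t)\<^sup>2) \<partial>leb T) \<le> ennreal K"
        using K[OF \<open>N \<le> i\<close>] by (simp add: ennreal_leI)
    qed
  qed simp
  finally have le: "(\<integral>\<^sup>+ t. ennreal ((v t)\<^sup>2) \<partial>leb T) \<le> ennreal K" .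
  then have int: "integrable (leb T) (\<lambda>t. (v t)\<^sup>2)"
    using v by (intro integrableI_bounded) (auto intro: le_less_trans)
  then show "v \<in> L2_space T" using v by (simp add: L2_space_def)
  have "ennreal (LINT t|leb T. (v t)\<^sup>2) \<le> ennreal K"
    using nn_integral_eq_integral[OF int] le by simp
  then show "(LINT t|leb T. (v t)\<^sup>2) \<le> K"
    using K0 by (simp add: ennreal_le_iff)
qed

text \<open>
  Riesz and Fischer: along a subsequence with increments of norm at most \<open>2\<^sup>-\<^sup>i\<close> the increments are
  summable almost everywhere, and Fatou's lemma estimates the distance to the pointwise limit. The
  subsequence is part of the conclusion so that further bounds can be passed to the limit.
\<close>
lemma L2_complete:
  assumes f: "\<And>n. f n \<in> L2_space T" and e: "e \<longlonglongrightarrow> 0" and T: "T \<ge> 0"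
    and cauchy: "\<And>m n. n \<le> m \<Longrightarrow> (LINT t|leb T. (f m t - f n t)\<^sup>2) \<le> e n"
  obtains v r where "v \<in> L2_space T" "\<And>n. (LINT t|leb T. (f n t - v t)\<^sup>2) \<le> e n"
    "AE t in leb T. (\<lambda>i. f (r i) t) \<longlonglongrightarrow> v t"
proof -
  \<comment> \<open>squared increments of at most \<open>4\<^sup>-\<^sup>i\<close> along the subsequence \<open>r\<close> give increments of norm at most \<open>2\<^sup>-\<^sup>i\<close>\<close>
  have ex: "\<exists>m\<ge>max (n::nat) l. e m \<le> (1/4) ^ n" for n l
  proof -
    have "\<forall>\<^sub>F m in sequentially. e m < (1/4) ^ n"
      using e by (rule order_tendstoD(2)) simp
    then obtain N where "\<And>m. m \<ge> N \<Longrightarrow> e m < (1/4) ^ n"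
      unfolding eventually_sequentially by blast
    then show ?thesis
      by (intro exI[of _ "max N (max n l)"]) (auto intro: less_imp_le)
  qed
  define r where "r = rec_nat (SOME m. m \<ge> max 0 0 \<and> e m \<le> (1/4) ^ 0) (\<lambda>n l. SOME m. m \<ge> max (Suc n) l \<and> e m \<le> (1/4) ^ Suc n)"
  have r0: "r 0 \<ge> max 0 0 \<and> e (r 0) \<le> (1/4) ^ 0"
    unfolding r_def using someI_ex[OF ex[of 0 0, unfolded Bex_def]] by simp
  have rS: "r (Suc n) \<ge> max (Suc n) (r n) \<and> e (r (Suc n)) \<le> (1/4) ^ Suc n" for n
    using someI_ex[OF ex[of "Suc n" "r n", unfolded Bex_def]] by (simp add: r_def)
  have rn: "n \<le> r n" and re: "e (r n) \<le> (1/4) ^ n" for n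
    using r0 rS[of "n - 1"] by (cases n; simp)+
  have rmono: "r n \<le> r (Suc n)" for n using rS[of n] by simp
  have fm[measurable]: "f n \<in> borel_measurable (leb T)" for n
    using f[of n] by (simp add: L2_space_def)
  define g where "g i t = f (r (Suc i)) t - f (r i) t" for i t
  have gm[measurable]: "g i \<in> borel_measurable (leb T)" for i unfolding g_def by measurable
  have gL2: "g i \<in> L2_space T" for i unfolding g_def by (intro L2_diff f)
  \<comment> \<open>the interval is bounded, so the \<open>L\<^sup>1\<close>-norms of the increments are summable as well\<close>
  have gint: "(LINT t|leb T. \<bar>g i t\<bar>) \<le> sqrt T * (1/2) ^ i" for i
  proof -
    have "(\<lambda>t. \<bar>g i t\<bar>) \<in> L2_space T" using gL2[of i] by (simp add: L2_space_def)
    then have "\<bar>LINT t|leb T. \<bar>g i t\<bar> * 1\<bar> \<le> sqrt (LINT t|leb T. (\<bar>g i t\<bar>)\<^sup>2) * sqrt (LINT t|leb T. 1\<^sup>2)"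
      by (rule L2_Cauchy_Schwarz) (intro L2_continuous continuous_intros)
    also have "(LINT t|leb T. (1::real)\<^sup>2) = T"
      using continuous_leb(3)[of T "\<lambda>_. (1::real)"] T by simp
    also have "sqrt (LINT t|leb T. (\<bar>g i t\<bar>)\<^sup>2) \<le> (1/2) ^ i"
    proof (rule real_le_lsqrt)
      have "(LINT t|leb T. (\<bar>g i t\<bar>)\<^sup>2) \<le> e (r i)"
        using cauchy[OF rmono[of i]] by (simp add: g_def)
      also have "\<dots> \<le> ((1/2) ^ i)\<^sup>2"
        using re[of i] unfolding power2_eq_square power_mult_distrib[symmetric] by simp
      finally show "(LINT t|leb T. (\<bar>g i t\<bar>)\<^sup>2) \<le> ((1/2) ^ i)\<^sup>2" .
    qed auto
    finally show ?thesis using T by (simp add: mult.commute mult_right_mono)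
  qed
  have "(\<integral>\<^sup>+ t. (\<Sum>i. ennreal \<bar>g i t\<bar>) \<partial>leb T) = (\<Sum>i. \<integral>\<^sup>+ t. ennreal \<bar>g i t\<bar> \<partial>leb T)"
    by (intro nn_integral_suminf) measurable
  also have "\<dots> \<le> (\<Sum>i. ennreal (sqrt T * (1/2) ^ i))"
  proof (intro suminf_le)
    fix i
    have "(\<integral>\<^sup>+ t. ennreal \<bar>g i t\<bar> \<partial>leb T) = ennreal (LINT t|leb T. \<bar>g i t\<bar>)"
      by (intro nn_integral_eq_integral) (auto intro: L2_integrable gL2)
    then show "(\<integral>\<^sup>+ t. ennreal \<bar>g i t\<bar> \<partial>leb T) \<le> ennreal (sqrt T * (1/2) ^ i)"
      using gint[of i] by (simp add: ennreal_leI)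
  qed auto
  also have "\<dots> < \<infinity>"
  proof -
    have "summable (\<lambda>i. sqrt T * (1/2) ^ i)" by (intro summable_mult summable_geometric) simp
    then have "(\<Sum>i. ennreal (sqrt T * (1/2) ^ i)) \<noteq> \<infinity>"
      using T by (subst suminf_ennreal2) auto
    then show ?thesis by (simp add: less_top)
  qed
  finally have "(\<integral>\<^sup>+ t. (\<Sum>i. ennreal \<bar>g i t\<bar>) \<partial>leb T) \<noteq> \<infinity>" by simp
  then have "AE t in leb T. (\<Sum>i. ennreal \<bar>g i t\<bar>) \<noteq> \<infinity>"
    by (intro nn_integral_PInf_AE) measurable
  then have conv: "AE t in leb T. convergent (\<lambda>i. f (r i) t)"
  proof eventually_elim
    case (elim t)
    have "summable (\<lambda>i. \<bar>g i t\<bar>)"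
      using elim by (intro summable_suminf_not_top) auto
    then have "summable (\<lambda>i. g i t)" by (rule summable_rabs_cancel)
    then have "convergent (\<lambda>n. f (r 0) t + (\<Sum>i<n. g i t))"
      by (intro convergent_add convergent_const) (simp add: summable_iff_convergent)
    moreover have "f (r 0) t + (\<Sum>i<n. g i t) = f (r n) t" for n
      unfolding g_def using sum_lessThan_telescope[of "\<lambda>i. f (r i) t" n] by simp
    ultimately show ?case by simp
  qed
  define v where "v t = lim (\<lambda>i. f (r i) t)" for t
  have vm[measurable]: "v \<in> borel_measurable (leb T)"
    unfolding v_def by measurable
  have lim: "AE t in leb T. (\<lambda>i. f (r i) t) \<longlonglongrightarrow> v t"
    using conv by eventually_elim (simp add: v_def convergent_LIMSEQ_iff)
  have bd: "(LINT t|leb T. (f n t - v t)\<^sup>2) \<le> e n" "(\<lambda>t. f n t - v t) \<in> L2_space T" for n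
  proof -
    have l: "AE t in leb T. (\<lambda>i. f n t - f (r i) t) \<longlonglongrightarrow> f n t - v t"
      using lim by eventually_elim (intro tendsto_intros)
    have c: "(LINT t|leb T. (f n t - f (r i) t)\<^sup>2) \<le> e n" if "i \<ge> n" for i
      using cauchy[of n "r i"] rn[of i] that by (simp add: power2_commute)
    show "(LINT t|leb T. (f n t - v t)\<^sup>2) \<le> e n" "(\<lambda>t. f n t - v t) \<in> L2_space T"
      using L2_Fatou[OF L2_diff[OF f f] _ l c] by auto
  qed
  have "(\<lambda>t. f 0 t - (f 0 t - v t)) \<in> L2_space T"
    by (intro L2_diff[OF f] bd)
  then have "v \<in> L2_space T" by simp
  then show ?thesis using that bd(1) lim by blast
qed

section \<open>Test functions and the fundamental lemma\<close>

lemma jet_deriv_iterated: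
  fixes F :: "nat \<Rightarrow> real \<Rightarrow> real"
  assumes "jet F"
  shows "(deriv ^^ n) (F p) = F (p + n)"
proof (induction n)
  case (Suc n)
  have "deriv (F (p + n)) t = F (Suc (p + n)) t" for t
    using jetD[OF assms, of "p + n" t]
    by (intro DERIV_imp_deriv) (simp add: has_real_derivative_iff_has_vector_derivative)
  then have "deriv (F (p + n)) = F (p + Suc n)" by (simp add: fun_eq_iff)
  then show ?case using Suc by simp
qed simp

lemma jet_test_fun:
  fixes F :: "nat \<Rightarrow> real \<Rightarrow> real"
  assumes "jet F" "0 < a" "b < T" "\<And>t. t \<notin> {a..b} \<Longrightarrow> F p t = 0"
  shows "F p \<in> test_funs T"
  unfolding test_funs_def
proof (intro CollectI conjI allI exI[of _ "{a..b}"])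
  show "(deriv ^^ n) (F p) field_differentiable at x" for n x
    using jetD[OF assms(1), of "p + n" x] unfolding jet_deriv_iterated[OF assms(1)]
    by (auto simp: field_differentiable_def has_real_derivative_iff_has_vector_derivative)
qed (use assms in auto)

lemma test_fun_jet:
  assumes "\<phi> \<in> test_funs T"
  shows "jet (\<lambda>n. (deriv ^^ n) \<phi>)"
  unfolding jet_def
proof (intro allI)
  fix n t
  have "(deriv ^^ n) \<phi> field_differentiable (at t)"
    using assms by (simp add: test_funs_def)
  then have "((deriv ^^ n) \<phi> has_real_derivative deriv ((deriv ^^ n) \<phi>) t) (at t)"
    by (simp add: DERIV_deriv_iff_field_differentiable)
  then show "((deriv ^^ n) \<phi> has_vector_derivative (deriv ^^ Suc n) \<phi> t) (at t)"
    by (simp add: has_real_derivative_iff_has_vector_derivative)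
qed

lemma bump_tendsto_indicator:
  "(\<lambda>n. bump (real (Suc n)) x y 0 t) \<longlonglongrightarrow> indicator {x<..<y} t"
proof (cases "t \<in> {x<..<y}")
  case True
  have "(\<lambda>n. exp (- (1 / (real (Suc n) * (t - x)))) * exp (- (1 / (real (Suc n) * (y - t))))) \<longlonglongrightarrow> exp (- 0) * exp (- 0)"
  proof (intro tendsto_intros)
    have "(\<lambda>n. (1 / c) * inverse (real (Suc n))) \<longlonglongrightarrow> (1 / c) * 0" for c :: real
      by (intro tendsto_intros LIMSEQ_inverse_real_of_nat)
    then show "(\<lambda>n. 1 / (real (Suc n) * (t - x))) \<longlonglongrightarrow> 0" "(\<lambda>n. 1 / (real (Suc n) * (y - t))) \<longlonglongrightarrow> 0"
      by (simp_all add: inverse_eq_divide mult.commute)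
  qed
  moreover have "exp (- (1 / (real (Suc n) * (t - x)))) * exp (- (1 / (real (Suc n) * (y - t)))) = bump (real (Suc n)) x y 0 t" for n
    using True by (simp add: bump_0 flat_def)
  ultimately show ?thesis using True by simp
next
  case False
  then show ?thesis by (simp add: bump_outside)
qed

text \<open>
  Bump functions approximate the indicator function of any interval inside \<open>(0,T)\<close>, so all integrals
  of \<open>w\<close> over such intervals vanish; Lebesgue's differentiation theorem concludes.
\<close>
lemma fundamental_lemma:
  assumes w: "w \<in> L2_space T" and z: "\<And>\<phi>. \<phi> \<in> test_funs T \<Longrightarrow> (LINT t|leb T. w t * \<phi> t) = 0"
  shows "AE t in leb T. w t = 0"
proof -
  have wi: "integrable (leb T) w" by (rule L2_integrable[OF w])
  have wm[measurable]: "w \<in> borel_measurable (leb T)" using w by (simp add: L2_space_def)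
  have zero: "(LINT t|leb T. w t * indicator {x<..<y} t) = 0" if "0 < x" "y < T" for x y
  proof -
    have bm: "bump (real (Suc n)) x y 0 \<in> borel_measurable (leb T)" for n
      by (intro continuous_leb jet_continuous_on jet_bump)
    have "(\<lambda>n. LINT t|leb T. w t * bump (real (Suc n)) x y 0 t) \<longlonglongrightarrow> (LINT t|leb T. w t * indicator {x<..<y} t)"
    proof (rule integral_dominated_convergence[where w = "\<lambda>t. \<bar>w t\<bar>"])
      show "(\<lambda>t. w t * indicator {x<..<y} t) \<in> borel_measurable (leb T)"
      proof -
        have "indicator {x<..<y} \<in> borel_measurable borel" by simp
        then have "(indicator {x<..<y} :: real \<Rightarrow> real) \<in> borel_measurable (leb T)"
          by (intro measurable_restrict_space1) (auto intro: measurable_completion)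
        then show ?thesis by measurable
      qed
      show "(\<lambda>t. w t * bump (real (Suc n)) x y 0 t) \<in> borel_measurable (leb T)" for n
        using bm by measurable
      show "integrable (leb T) (\<lambda>t. \<bar>w t\<bar>)" using wi by simp
      show "AE t in leb T. (\<lambda>n. w t * bump (real (Suc n)) x y 0 t) \<longlonglongrightarrow> w t * indicator {x<..<y} t"
        by (intro AE_I2 tendsto_mult tendsto_const bump_tendsto_indicator)
      have f01: "0 \<le> flat 0 s \<and> flat 0 s \<le> 1" for s by (simp add: flat_def)
      have "\<bar>bump m x y 0 t\<bar> \<le> 1" for m t
        unfolding bump_0 abs_mult using f01 by (simp add: mult_le_one)
      then show "AE t in leb T. norm (w t * bump (real (Suc n)) x y 0 t) \<le> \<bar>w t\<bar>" for n
        by (intro AE_I2) (simp add: abs_mult mult_left_le)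
    qed
    moreover have "(LINT t|leb T. w t * bump (real (Suc n)) x y 0 t) = 0" for n
      by (rule z, rule jet_test_fun[OF jet_bump that]) (auto intro: bump_outside)
    ultimately show ?thesis by (simp add: LIMSEQ_const_iff)
  qed
  define f where "f t = (if t \<in> {0<..<T} then w t else 0)" for t
  have fi: "integrable lebesgue f"
    unfolding f_def using wi by (subst Lebesgue_Measure.integrable_restrict_UNIV) auto
  have fon: "f integrable_on cbox a b" for a b
  proof -
    have "f integrable_on UNIV" using fi by (rule integrable_on_lebesgue)
    then show ?thesis by (rule integrable_on_subcbox) simp
  qed
  have fz: "integral (cbox x y) f = 0" if "0 < x" "y < T" for x y
  proof -
    have "(LINT t|leb T. w t * indicator {x<..<y} t) = (LINT t|lebesgue. (if t \<in> {0<..<T} then w t * indicator {x<..<y} t else 0))"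
      by (rule Lebesgue_Measure.integral_restrict_UNIV[symmetric]) auto
    also have "\<dots> = (LINT t|lebesgue. (if t \<in> {x<..<y} then f t else 0))"
      using that by (intro Bochner_Integration.integral_cong) (auto simp: f_def)
    also have "\<dots> = (LINT t|lebesgue_on {x<..<y}. f t)"
      by (rule Lebesgue_Measure.integral_restrict_UNIV) auto
    also have "\<dots> = integral {x<..<y} f"
    proof (rule lebesgue_integral_eq_integral)
      have "integrable lebesgue (\<lambda>t. if t \<in> {x<..<y} then f t else 0)"
        using integrable_mult_indicator[OF _ fi, of "{x<..<y}"] by (simp only: indicator_scaleR_eq_if) simp
      then show "integrable (lebesgue_on {x<..<y}) f"
        by (subst (asm) Lebesgue_Measure.integrable_restrict_UNIV) auto
    qed auto
    also have "\<dots> = integral (cbox x y) f"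
      using integral_open_interval[of x y f] by (simp add: box_real)
    finally show ?thesis using zero[OF that] by simp
  qed
  obtain N where N: "negligible N" "\<And>x e. x \<notin> N \<Longrightarrow> 0 < e \<Longrightarrow>
     \<exists>d>0. \<forall>h. 0 < h \<and> h < d \<longrightarrow> norm (integral (cbox x (x + h *\<^sub>R One)) f /\<^sub>R h ^ DIM(real) - f x) < e"
    using integrable_ccontinuous_explicit[OF fon] by blast
  have wz: "w x = 0" if x: "x \<in> {0<..<T}" and xN: "x \<notin> N" for x
  proof (rule ccontr)
    assume "w x \<noteq> 0"
    then have "f x \<noteq> 0" using x by (simp add: f_def)
    then obtain d where d: "d > 0" "\<And>h. 0 < h \<Longrightarrow> h < d \<Longrightarrow> norm (integral (cbox x (x + h *\<^sub>R One)) f /\<^sub>R h ^ DIM(real) - f x) < \<bar>f x\<bar>"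
      using N(2)[OF xN, of "\<bar>f x\<bar>"] by auto
    \<comment> \<open>for such a short \<open>h\<close> the interval of averaging stays inside \<open>(0,T)\<close>, where all integrals vanish\<close>
    define h where "h = min d (T - x) / 2"
    have "0 < h" "h < d" "x + h < T" using d x by (auto simp: h_def min_def field_simps)
    then show False using d(2)[of h] fz[of x "x + h"] x by simp
  qed
  have "AE t in lebesgue. t \<notin> N"
    using N(1) by (simp add: negligible_iff_null_sets AE_not_in)
  then have "AE t in leb T. t \<notin> N"
    by (auto intro: AE_restrict_space_iff[THEN iffD2] elim: eventually_mono)
  moreover have "AE t in leb T. t \<in> {0<..<T}" by (intro AE_I2) simp
  ultimately show ?thesis by eventually_elim (rule wz)
qed

section \<open>Weak derivatives\<close>

lemma weak_deriv_unique:
  assumes "has_weak_deriv T n u v" "has_weak_deriv T n u v'"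
  shows "AE t in leb T. v t = v' t"
proof -
  have L: "v \<in> L2_space T" "v' \<in> L2_space T"
    using assms by (auto simp: has_weak_deriv_def)
  have "AE t in leb T. v t - v' t = 0"
  proof (rule fundamental_lemma[OF L2_diff[OF L]])
    fix \<phi> assume p: "\<phi> \<in> test_funs T"
    have pL: "\<phi> \<in> L2_space T"
      using jet_continuous_on[OF test_fun_jet[OF p], of _ 0] by (intro L2_continuous) simp
    have "(-1) ^ n * (LINT t|leb T. v t * \<phi> t) = (-1) ^ n * (LINT t|leb T. v' t * \<phi> t)"
      using assms p by (auto simp: has_weak_deriv_def)
    then have "(LINT t|leb T. v t * \<phi> t) = (LINT t|leb T. v' t * \<phi> t)" by simp
    then show "(LINT t|leb T. (v t - v' t) * \<phi> t) = 0"
      using L2_times_integrable[OF L(1) pL] L2_times_integrable[OF L(2) pL]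
      by (simp add: left_diff_distrib)
  qed
  then show ?thesis by simp
qed

text \<open>
  By uniqueness the norm of the representative selected by \<open>weak_deriv\<close> can be computed from any weak
  derivative at hand.
\<close>
lemma L2_norm_weak_deriv:
  assumes "has_weak_deriv T n u v"
  shows "L2_norm T (weak_deriv T n u) = sqrt (LINT t|leb T. (v t)\<^sup>2)"
proof -
  have w: "has_weak_deriv T n u (weak_deriv T n u)"
    unfolding weak_deriv_def using someI[of "has_weak_deriv T n u" v] assms by simp
  have "AE t in leb T. (weak_deriv T n u t)\<^sup>2 = (v t)\<^sup>2"
    using weak_deriv_unique[OF w assms] by eventually_elim simp
  moreover have "(\<lambda>t. (weak_deriv T n u t)\<^sup>2) \<in> borel_measurable (leb T)" "(\<lambda>t. (v t)\<^sup>2) \<in> borel_measurable (leb T)"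
    using w assms by (auto simp: has_weak_deriv_def L2_space_def)
  ultimately have "(LINT t|leb T. (weak_deriv T n u t)\<^sup>2) = (LINT t|leb T. (v t)\<^sup>2)"
    by (intro integral_cong_AE)
  then show ?thesis unfolding L2_norm_def by simp
qed

lemma jet_integration_by_parts:
  fixes F G :: "nat \<Rightarrow> real \<Rightarrow> real"
  assumes F: "jet F" "\<And>p. F p 0 = 0" "\<And>p. F p T = 0" and G: "jet G" and T: "T \<ge> 0"
  shows "(LINT t|leb T. F p t * G n t) = (-1) ^ n * (LINT t|leb T. F (p + n) t * G 0 t)"
proof (induction n arbitrary: p)
  case (Suc n)
  have cF: "continuous_on {0..T} (F p)" for p by (intro jet_continuous_on F(1))
  have cG: "continuous_on {0..T} (G p)" for p by (intro jet_continuous_on G)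
  have "((\<lambda>t. F p t * G (Suc n) t + F (Suc p) t * G n t) has_integral F p T * G n T - F p 0 * G n 0) {0..T}"
  proof (rule fundamental_theorem_of_calculus[OF T])
    fix t
    from has_vector_derivative_mult[OF has_vector_derivative_at_within[OF jetD[OF F(1), of p]]
        has_vector_derivative_at_within[OF jetD[OF G, of n]]]
    show "((\<lambda>t. F p t * G n t) has_vector_derivative F p t * G (Suc n) t + F (Suc p) t * G n t) (at t within {0..T})" .
  qed
  then have "integral {0..T} (\<lambda>t. F p t * G (Suc n) t + F (Suc p) t * G n t) = 0"
    using F by (simp add: integral_unique)
  then have "(LINT t|leb T. F p t * G (Suc n) t + F (Suc p) t * G n t) = 0"
    by (subst continuous_leb(3)) (auto intro!: continuous_intros cF cG)
  moreover have "(LINT t|leb T. F p t * G (Suc n) t + F (Suc p) t * G n t)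
     = (LINT t|leb T. F p t * G (Suc n) t) + (LINT t|leb T. F (Suc p) t * G n t)"
    by (intro Bochner_Integration.integral_add continuous_leb continuous_intros cF cG)
  ultimately show ?case using Suc[of "Suc p"] by simp
qed simp

lemma L2_limit_times:
  assumes f: "\<And>N. f N \<in> L2_space T" and v: "v \<in> L2_space T" and p: "\<phi> \<in> L2_space T"
    and lim: "(\<lambda>N. LINT t|leb T. (f N t - v t)\<^sup>2) \<longlonglongrightarrow> 0"
  shows "(\<lambda>N. LINT t|leb T. f N t * \<phi> t) \<longlonglongrightarrow> (LINT t|leb T. v t * \<phi> t)"
proof -
  have "(\<lambda>N. sqrt (LINT t|leb T. (f N t - v t)\<^sup>2) * sqrt (LINT t|leb T. (\<phi> t)\<^sup>2)) \<longlonglongrightarrow> sqrt 0 * sqrt (LINT t|leb T. (\<phi> t)\<^sup>2)"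
    by (intro tendsto_intros lim)
  then have l0: "(\<lambda>N. sqrt (LINT t|leb T. (f N t - v t)\<^sup>2) * sqrt (LINT t|leb T. (\<phi> t)\<^sup>2)) \<longlonglongrightarrow> 0" by simp
  have "(\<lambda>N. (LINT t|leb T. f N t * \<phi> t) - (LINT t|leb T. v t * \<phi> t)) \<longlonglongrightarrow> 0"
  proof (rule Lim_null_comparison[OF _ l0], intro always_eventually allI)
    fix N
    have "(LINT t|leb T. f N t * \<phi> t) - (LINT t|leb T. v t * \<phi> t) = (LINT t|leb T. (f N t - v t) * \<phi> t)"
      using L2_times_integrable[OF f p] L2_times_integrable[OF v p] by (simp add: left_diff_distrib)
    then show "norm ((LINT t|leb T. f N t * \<phi> t) - (LINT t|leb T. v t * \<phi> t))
      \<le> sqrt (LINT t|leb T. (f N t - v t)\<^sup>2) * sqrt (LINT t|leb T. (\<phi> t)\<^sup>2)"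
      using L2_Cauchy_Schwarz[OF L2_diff[OF f v] p] by simp
  qed
  then show ?thesis by (rule Lim_transform2[OF tendsto_const, of _ _ _, simplified] | simp add: LIM_zero_iff)
qed

text \<open>
  At each order up to \<open>k\<close> the classical derivatives of the test functions \<open>F N 0\<close> have an \<open>L\<^sup>2\<close>-limit,
  and integration by parts against a test function passes to this limit; it is therefore the weak
  derivative of \<open>u\<close>. The common rate \<open>e\<close> controls the distance of \<open>F N 0\<close> to \<open>u\<close> in \<open>H\<^sup>k\<close>.
\<close>
theorem sobolev0_limit:
  fixes F :: "nat \<Rightarrow> nat \<Rightarrow> real \<Rightarrow> real" and e :: "nat \<Rightarrow> real"
  assumes F: "\<And>N. jet (F N)" and supp: "\<And>N p t. t \<notin> {a..b} \<Longrightarrow> F N p t = 0" and ab: "0 < a" "b < T" "0 \<le> T"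
    and lim: "\<And>t. t \<in> {0<..<T} \<Longrightarrow> (\<lambda>N. F N 0 t) \<longlonglongrightarrow> u t"
    and e: "e \<longlonglongrightarrow> 0"
    and cauchy: "\<And>p M N. p \<le> k \<Longrightarrow> N \<le> M \<Longrightarrow> (LINT t|leb T. (F M p t - F N p t)\<^sup>2) \<le> e N"
  shows "u \<in> sobolev0 T k"
    "\<And>p K. p \<le> k \<Longrightarrow> (\<And>N. (LINT t|leb T. (F N p t)\<^sup>2) \<le> K) \<Longrightarrow> L2_norm T (weak_deriv T p u) \<le> sqrt K"
proof -
  have FL: "F N p \<in> L2_space T" for N p
    by (intro L2_continuous jet_continuous_on F)
  have F0: "F N p 0 = 0" "F N p T = 0" for N p
    using supp ab by auto
  have um: "u \<in> borel_measurable (leb T)"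
    by (rule borel_measurable_LIMSEQ_metric[of "\<lambda>N. F N 0"])
       (use FL lim in \<open>auto simp: L2_space_def\<close>)
  have limAE: "AE t in leb T. (\<lambda>N. F N 0 t) \<longlonglongrightarrow> u t"
    using lim by (intro AE_I2) simp
  have ub: "(LINT t|leb T. (F N 0 t - u t)\<^sup>2) \<le> e N" and uL: "u \<in> L2_space T" for N
  proof -
    have l: "AE t in leb T. (\<lambda>M. F N 0 t - F M 0 t) \<longlonglongrightarrow> F N 0 t - u t" for N
      using limAE by eventually_elim (intro tendsto_intros)
    have c: "(LINT t|leb T. (F N 0 t - F M 0 t)\<^sup>2) \<le> e N" if "M \<ge> N" for M N
      using cauchy[of 0 N M] that by (simp add: power2_commute)
    have m: "(\<lambda>t. F N 0 t - u t) \<in> borel_measurable (leb T)" for N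
      using um FL[of N 0] by (auto simp: L2_space_def intro: borel_measurable_diff)
    show "(LINT t|leb T. (F N 0 t - u t)\<^sup>2) \<le> e N"
      using L2_Fatou[OF L2_diff[OF FL FL] m l c] by auto
    have "(\<lambda>t. F 0 0 t - u t) \<in> L2_space T"
      using L2_Fatou[OF L2_diff[OF FL FL] m l c] by auto
    from L2_diff[OF FL this, of 0 0] show "u \<in> L2_space T" by simp
  qed
  have sq0: "(\<lambda>N. LINT t|leb T. (F N p t - v t)\<^sup>2) \<longlonglongrightarrow> 0" if "\<And>N. (LINT t|leb T. (F N p t - v t)\<^sup>2) \<le> e N" for p v
    by (rule tendsto_sandwich[OF _ _ tendsto_const e]) (auto intro: always_eventually that)
  have ex: "\<exists>v. has_weak_deriv T p u v \<and> (\<forall>N. (LINT t|leb T. (F N p t - v t)\<^sup>2) \<le> e N) \<and>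
      (\<forall>K. (\<forall>N. (LINT t|leb T. (F N p t)\<^sup>2) \<le> K) \<longrightarrow> (LINT t|leb T. (v t)\<^sup>2) \<le> K)"
    if p: "p \<le> k" for p
  proof -
    obtain v r where v: "v \<in> L2_space T" "\<And>N. (LINT t|leb T. (F N p t - v t)\<^sup>2) \<le> e N"
      and r: "AE t in leb T. (\<lambda>i. F (r i) p t) \<longlonglongrightarrow> v t"
      by (rule L2_complete[of "\<lambda>N. F N p" T e, OF FL e ab(3) cauchy[OF p]]) (assumption | rule that)+
    have "has_weak_deriv T p u v"
      unfolding has_weak_deriv_def
    proof (intro conjI ballI v)
      fix \<phi> assume ph: "\<phi> \<in> test_funs T"
      note jp = test_fun_jet[OF ph]
      have pL: "(deriv ^^ n) \<phi> \<in> L2_space T" for n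
        by (intro L2_continuous jet_continuous_on jp)
      have l1: "(\<lambda>N. LINT t|leb T. F N 0 t * (deriv ^^ p) \<phi> t) \<longlonglongrightarrow> (LINT t|leb T. u t * (deriv ^^ p) \<phi> t)"
        by (rule L2_limit_times[OF FL uL pL sq0[OF ub]])
      have l2: "(\<lambda>N. (-1) ^ p * (LINT t|leb T. F N p t * \<phi> t)) \<longlonglongrightarrow> (-1) ^ p * (LINT t|leb T. v t * \<phi> t)"
        using L2_limit_times[OF FL v(1) pL[of 0] sq0[OF v(2)]] by (intro tendsto_mult tendsto_const) simp
      have eq: "(LINT t|leb T. F N 0 t * (deriv ^^ p) \<phi> t) = (-1) ^ p * (LINT t|leb T. F N p t * \<phi> t)" for N
        using jet_integration_by_parts[OF F F0 jp ab(3), of N 0 p] by simp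
      show "(LINT t|leb T. u t * (deriv ^^ p) \<phi> t) = (-1) ^ p * (LINT t|leb T. v t * \<phi> t)"
        by (rule LIMSEQ_unique[OF l1[unfolded eq] l2])
    qed
    moreover have "(LINT t|leb T. (v t)\<^sup>2) \<le> K" if "\<And>N. (LINT t|leb T. (F N p t)\<^sup>2) \<le> K" for K
      by (rule L2_Fatou(2)[OF FL _ r, of 0]) (use v that in \<open>auto simp: L2_space_def\<close>)
    ultimately show ?thesis using v(2) by blast
  qed
  show "L2_norm T (weak_deriv T p u) \<le> sqrt K" if p: "p \<le> k" and K: "\<And>N. (LINT t|leb T. (F N p t)\<^sup>2) \<le> K" for p K
  proof -
    obtain v where "has_weak_deriv T p u v" "(LINT t|leb T. (v t)\<^sup>2) \<le> K"
      using ex[OF p] K by blast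
    then show ?thesis by (simp add: L2_norm_weak_deriv)
  qed
  have "(\<lambda>N. sobolev_norm T k (\<lambda>t. F N 0 t - u t)) \<longlonglongrightarrow> 0"
  proof -
    have bound: "L2_norm T (weak_deriv T p (\<lambda>t. F N 0 t - u t)) \<le> sqrt (e N)" if p: "p \<le> k" for p N
    proof -
      obtain v where v: "has_weak_deriv T p u v" "(LINT t|leb T. (F N p t - v t)\<^sup>2) \<le> e N"
        using ex[OF p] by blast
      have vL: "v \<in> L2_space T" using v by (simp add: has_weak_deriv_def)
      have "has_weak_deriv T p (\<lambda>t. F N 0 t - u t) (\<lambda>t. F N p t - v t)"
        unfolding has_weak_deriv_def
      proof (intro conjI ballI L2_diff FL vL)
        fix \<phi> assume ph: "\<phi> \<in> test_funs T"
        note jp = test_fun_jet[OF ph]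
        have pL: "(deriv ^^ n) \<phi> \<in> L2_space T" for n
          by (intro L2_continuous jet_continuous_on jp)
        have "(LINT t|leb T. F N 0 t * (deriv ^^ p) \<phi> t) = (-1) ^ p * (LINT t|leb T. F N p t * \<phi> t)"
          using jet_integration_by_parts[OF F F0 jp ab(3), of N 0 p] by simp
        moreover have "(LINT t|leb T. u t * (deriv ^^ p) \<phi> t) = (-1) ^ p * (LINT t|leb T. v t * \<phi> t)"
          using v(1) ph by (simp add: has_weak_deriv_def)
        ultimately show "(LINT t|leb T. (F N 0 t - u t) * (deriv ^^ p) \<phi> t) = (-1) ^ p * (LINT t|leb T. (F N p t - v t) * \<phi> t)"
          using L2_times_integrable[OF FL[of N 0] pL[of p]] L2_times_integrable[OF uL pL[of p]]
            L2_times_integrable[OF FL[of N p] pL[of 0]] L2_times_integrable[OF vL pL[of 0]]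
          by (simp add: left_diff_distrib right_diff_distrib)
      qed
      from L2_norm_weak_deriv[OF this] show ?thesis using v(2) by simp
    qed
    have e0: "e N \<ge> 0" for N
      using ub[of N] order_trans[of 0 "LINT t|leb T. (F N 0 t - u t)\<^sup>2" "e N"] by simp
    have up: "sobolev_norm T k (\<lambda>t. F N 0 t - u t) \<le> sqrt (real (Suc k) * e N)" for N
    proof -
      have "(\<Sum>n\<le>k. (L2_norm T (weak_deriv T n (\<lambda>t. F N 0 t - u t)))\<^sup>2) \<le> (\<Sum>n\<le>k. e N)"
      proof (rule sum_mono)
        fix n assume "n \<in> {..k}"
        then have "(L2_norm T (weak_deriv T n (\<lambda>t. F N 0 t - u t)))\<^sup>2 \<le> (sqrt (e N))\<^sup>2"
          by (intro power_mono bound) (auto simp: L2_norm_def)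
        then show "(L2_norm T (weak_deriv T n (\<lambda>t. F N 0 t - u t)))\<^sup>2 \<le> e N" using e0 by simp
      qed
      then show ?thesis by (simp add: sobolev_norm_def)
    qed
    have lim0: "(\<lambda>N. sqrt (real (Suc k) * e N)) \<longlonglongrightarrow> 0"
      using tendsto_real_sqrt[OF tendsto_mult[OF tendsto_const e, of "real (Suc k)"]] by simp
    have low: "0 \<le> sobolev_norm T k w" for w by (simp add: sobolev_norm_def sum_nonneg)
    show ?thesis
      by (rule tendsto_sandwich[OF always_eventually[OF allI[OF low]] always_eventually[OF allI[OF up]] tendsto_const lim0])
  qed
  moreover have "F N 0 \<in> test_funs T" for N
    by (rule jet_test_fun[OF F ab(1,2) supp])
  ultimately show "u \<in> sobolev0 T k"
    unfolding sobolev0_def sobolev_def using uL ex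
    by (intro CollectI conjI exI[of _ "\<lambda>N. F N 0"]) blast+
qed

section \<open>The control map\<close>

text \<open>
  The properties of the biorthogonal family from which the control map is built.
\<close>
locale moment_synthesis =
  fixes T :: real and k :: nat and \<omega> :: "nat \<Rightarrow> real"
    and W :: "nat \<Rightarrow> nat \<Rightarrow> real \<Rightarrow> complex" and C :: real
  assumes T: "T > 0" and k: "k \<ge> 1"
    and mono: "strict_mono \<omega>" and w0: "\<omega> 0 = 0"
    and inverse_squares: "summable (\<lambda>l. (inverse (\<omega> l))\<^sup>2)"
    and C: "C \<ge> 0" and jetW: "\<And>l. jet (W l)"
    and W_left: "\<And>l p t. t < T/4 \<Longrightarrow> W l p t = 0"
    and W_right: "\<And>l p t. p \<ge> Suc k \<Longrightarrow> t > 3*T/4 \<Longrightarrow> W l p t = 0"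
    and W_end: "\<And>l p. p < k \<Longrightarrow> W l p T = 0"
    and W_pos: "\<And>l j. fourier T (W l (Suc k)) (\<omega> j) = (if j = l then 1 else 0)"
    and W_neg: "\<And>l j. (j, l) \<noteq> (0, 0) \<Longrightarrow> fourier T (W l (Suc k)) (- \<omega> j) = 0"
    and W_bound: "\<And>l p t. p \<le> 2*k+1 \<Longrightarrow> t \<in> {0..T} \<Longrightarrow>
        norm (W l p t) \<le> C * base_freq \<omega> l powi (int p - int (Suc k))"
    and W_bessel: "\<And>A c p. p \<le> 2*k+1 \<Longrightarrow> finite A \<Longrightarrow>
        integral {0..T} (\<lambda>t. (norm (\<Sum>l\<in>A. c l * W l p t))\<^sup>2)
        \<le> C * (\<Sum>l\<in>A. (norm (c l) * base_freq \<omega> l powi (int p - int (Suc k)))\<^sup>2)"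
begin

text \<open>
  Taking the real part of the series halves the contribution of \<open>d\<^sub>l\<close> at \<open>\<omega>\<^sub>l\<close> for \<open>l \<ge> 1\<close>, since the
  conjugate contributes at \<open>-\<omega>\<^sub>l\<close> only; at frequency \<open>0\<close> both coincide and \<open>d\<^sub>0\<close> is real.
\<close>
definition coef :: "(nat \<Rightarrow> complex) \<Rightarrow> nat \<Rightarrow> complex" where
  "coef d l = (if l = 0 then d 0 else 2 * d l)"

text \<open>
  Up to a factor, the size of the \<open>l\<close>-th term of the series after \<open>m\<close> derivations.
\<close>
definition amp :: "(nat \<Rightarrow> complex) \<Rightarrow> int \<Rightarrow> nat \<Rightarrow> real" where
  "amp d m l = norm (coef d l) * base_freq \<omega> l powi m"

definition partial :: "(nat \<Rightarrow> complex) \<Rightarrow> nat \<Rightarrow> nat \<Rightarrow> real \<Rightarrow> real" where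
  "partial d N p t = Re (\<Sum>l<N. coef d l * W l p t)"

definition series :: "(nat \<Rightarrow> complex) \<Rightarrow> nat \<Rightarrow> real \<Rightarrow> real" where
  "series d p t = Re (\<Sum>l. coef d l * W l p t)"

definition control :: "(nat \<Rightarrow> complex) \<Rightarrow> real \<Rightarrow> real" where
  "control d = series d (Suc k)"

lemma omega_pos: "l \<noteq> 0 \<Longrightarrow> \<omega> l > 0"
  using strict_mono_less[OF mono, of 0 l] w0 by simp

definition min_freq :: real where "min_freq = min 1 (\<omega> 1)"

lemma min_freq_pos: "min_freq > 0"
  using omega_pos[of 1] by (simp add: min_freq_def)

lemma base_ge_min_freq: "base_freq \<omega> l \<ge> min_freq"
proof (cases "l = 0")
  case False
  then have "\<omega> 1 \<le> \<omega> l" using strict_mono_less_eq[OF mono, of 1 l] by simp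
  then show ?thesis using False by (simp add: base_freq_def min_freq_def)
qed (simp add: base_freq_def min_freq_def)

lemma base_pos: "base_freq \<omega> l > 0"
  using base_ge_min_freq[of l] min_freq_pos by linarith

lemma base_powi_nonpos: "m \<le> 0 \<Longrightarrow> base_freq \<omega> l powi m \<le> min_freq powi m"
  using power_int_antimono[OF base_ge_min_freq, of m l] min_freq_pos by (cases "m = 0") auto

lemma amp_nonneg: "amp d m l \<ge> 0"
  using base_pos[of l] by (simp add: amp_def zero_le_power_int less_imp_le)

lemma amp_le_weight:
  "amp d m l \<le> 2 * norm (of_real (h_weight \<omega> m l) * d l)"
proof (cases "l = 0")
  case True
  have "1 \<le> h_weight \<omega> m 0" using w0 by (auto simp: h_weight_def power_int_0_left_if)
  then have "norm (d 0) * 1 \<le> norm (d 0) * h_weight \<omega> m 0" by (intro mult_left_mono) auto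
  moreover have "h_weight \<omega> m 0 * norm (d 0) = norm (of_real (h_weight \<omega> m 0) * d 0)"
    using \<open>1 \<le> h_weight \<omega> m 0\<close> by (simp add: norm_mult)
  ultimately show ?thesis
    using True norm_ge_zero[of "of_real (h_weight \<omega> m 0) * d 0"]
    by (simp add: amp_def coef_def base_freq_def mult.commute del: norm_ge_zero)
next
  case False
  then have "\<omega> l powi m > 0" using omega_pos by simp
  then show ?thesis
    unfolding norm_mult[of "of_real _"] norm_of_real
    using False by (simp add: amp_def coef_def base_freq_def h_weight_def norm_mult mult.commute)
qed

text \<open>
  Since \<open>\<omega>\<^sub>l\<close> stays away from \<open>0\<close> for \<open>l \<ge> 1\<close>, all weights of order \<open>m \<le> k\<close> are dominated by those of
  order \<open>k\<close>; thus every norm in the size estimates is a convergent sum.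
\<close>
lemma weight_le_top:
  fixes d :: "nat \<Rightarrow> complex"
  assumes "m \<le> int k"
  shows "norm (of_real (h_weight \<omega> m l) * d l) \<le> (2 + min_freq powi (m - int k)) * norm (of_real (h_weight \<omega> (int k) l) * d l)"
proof -
  have b: "min_freq powi (m - int k) > 0" using min_freq_pos by simp
  have "\<bar>h_weight \<omega> m l\<bar> \<le> (2 + min_freq powi (m - int k)) * \<bar>h_weight \<omega> (int k) l\<bar>"
  proof (cases "l = 0")
    case True
    have "\<bar>h_weight \<omega> m 0\<bar> \<le> 2" "1 \<le> \<bar>h_weight \<omega> (int k) 0\<bar>"
      using w0 by (auto simp: h_weight_def power_int_0_left_if)
    then have "\<bar>h_weight \<omega> m 0\<bar> * 1 \<le> (2 + min_freq powi (m - int k)) * \<bar>h_weight \<omega> (int k) 0\<bar>"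
      using b by (intro mult_mono) auto
    then show ?thesis unfolding True by simp
  next
    case False
    have "\<omega> l powi m = \<omega> l powi (m - int k) * \<omega> l powi int k"
      using omega_pos[OF False] by (subst power_int_add[symmetric]) auto
    also have "\<dots> \<le> min_freq powi (m - int k) * \<omega> l powi int k"
      using base_powi_nonpos[of "m - int k" l] assms False omega_pos[OF False]
      by (intro mult_right_mono) (auto simp: base_freq_def)
    also have "\<dots> \<le> (2 + min_freq powi (m - int k)) * \<omega> l powi int k"
      using omega_pos[OF False] by (intro mult_right_mono) auto
    finally show ?thesis using False omega_pos[OF False] by (simp add: h_weight_def)
  qed
  then show ?thesis
    unfolding norm_mult norm_of_real mult.assoc[symmetric] by (intro mult_right_mono) auto
qed

lemma weighted_summable:
  assumes d: "d \<in> h_space \<omega> k" and m: "m \<le> int k"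
  shows "summable (\<lambda>l. (norm (of_real (h_weight \<omega> m l) * d l))\<^sup>2)"
proof (rule summable_comparison_test')
  let ?K = "2 + min_freq powi (m - int k)"
  show "summable (\<lambda>l. ?K\<^sup>2 * (norm (of_real (h_weight \<omega> (int k) l) * d l))\<^sup>2)"
    using d by (intro summable_mult) (simp add: h_space_def)
  show "norm ((norm (of_real (h_weight \<omega> m l) * d l))\<^sup>2) \<le> ?K\<^sup>2 * (norm (of_real (h_weight \<omega> (int k) l) * d l))\<^sup>2" for l
    using power_mono[OF weight_le_top[OF m, of l d] norm_ge_zero, of 2]
    by (simp only: power_mult_distrib real_norm_def abs_power2)
qed

lemma h_norm_sq:
  assumes d: "d \<in> h_space \<omega> k" and m: "m \<le> int k"
  shows "(h_norm \<omega> m d)\<^sup>2 = (\<Sum>l. (norm (of_real (h_weight \<omega> m l) * d l))\<^sup>2)"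
  unfolding h_norm_def
  by (rule real_sqrt_pow2) (intro suminf_nonneg weighted_summable d m, simp)

lemma h_norm_nonneg: "d \<in> h_space \<omega> k \<Longrightarrow> m \<le> int k \<Longrightarrow> h_norm \<omega> m d \<ge> 0"
  unfolding h_norm_def by (intro real_sqrt_ge_zero suminf_nonneg weighted_summable) auto

lemma amp_sq_summable:
  assumes d: "d \<in> h_space \<omega> k" and m: "m \<le> int k"
  shows "summable (\<lambda>l. (amp d m l)\<^sup>2)" "(\<Sum>l\<in>A. (amp d m l)\<^sup>2) \<le> (2 * h_norm \<omega> m d)\<^sup>2"
proof -
  let ?f = "\<lambda>l. (norm (of_real (h_weight \<omega> m l) * d l))\<^sup>2"
  have le: "(amp d m l)\<^sup>2 \<le> 4 * ?f l" for l
    using power_mono[OF amp_le_weight[of d m l] amp_nonneg, of 2] by (simp add: power_mult_distrib)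
  have sf: "summable (\<lambda>l. 4 * ?f l)" by (intro summable_mult weighted_summable d m)
  show s: "summable (\<lambda>l. (amp d m l)\<^sup>2)"
    by (rule summable_comparison_test'[OF sf]) (simp add: le)
  show "(\<Sum>l\<in>A. (amp d m l)\<^sup>2) \<le> (2 * h_norm \<omega> m d)\<^sup>2"
  proof (cases "finite A")
    case True
    then have "(\<Sum>l\<in>A. (amp d m l)\<^sup>2) \<le> (\<Sum>l. (amp d m l)\<^sup>2)"
      by (intro sum_le_suminf s) auto
    also have "\<dots> \<le> (\<Sum>l. 4 * ?f l)" by (rule suminf_le[OF le s sf])
    also have "\<dots> = (2 * h_norm \<omega> m d)\<^sup>2"
      using h_norm_sq[OF d m] suminf_mult[OF weighted_summable[OF d m], of 4] by (simp add: power_mult_distrib)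
    finally show ?thesis .
  qed simp
qed

text \<open>
  With one power of \<open>\<omega>\<^sub>l\<close> in hand, \<open>|d\<^sub>l| \<le> |d\<^sub>l \<omega>\<^sub>l|\<^sup>2 + \<omega>\<^sub>l\<^sup>-\<^sup>2\<close>. Consequently the series of the control and
  of its primitives converge absolutely at each point.
\<close>
lemma coef_summable:
  assumes d: "d \<in> h_space \<omega> k"
  shows "summable (\<lambda>l. norm (coef d l))"
proof (rule summable_comparison_test'[where N = 1])
  show "summable (\<lambda>l. (amp d 1 l)\<^sup>2 + (inverse (\<omega> l))\<^sup>2)"
    using amp_sq_summable(1)[OF d, of 1] k by (intro summable_add inverse_squares) auto
  fix l :: nat assume "1 \<le> l"
  then have w: "\<omega> l > 0" "l \<noteq> 0" using omega_pos by auto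
  then have "norm (coef d l) = amp d 1 l * inverse (\<omega> l)"
    by (simp add: amp_def base_freq_def)
  also have "\<dots> \<le> (amp d 1 l)\<^sup>2 + (inverse (\<omega> l))\<^sup>2"
  proof -
    have "0 \<le> amp d 1 l * inverse (\<omega> l)"
      using amp_nonneg[of d 1 l] w by (intro mult_nonneg_nonneg) auto
    then show ?thesis using sum_squares_bound[of "amp d 1 l" "inverse (\<omega> l)"] by linarith
  qed
  finally show "norm (norm (coef d l)) \<le> (amp d 1 l)\<^sup>2 + (inverse (\<omega> l))\<^sup>2" by simp
qed

definition majorant :: "(nat \<Rightarrow> complex) \<Rightarrow> nat \<Rightarrow> real" where
  "majorant d p = (\<Sum>l. C * min_freq powi (int p - int (Suc k)) * norm (coef d l))"

lemma term_bound:
  assumes "p \<le> Suc k" "t \<le> T \<or> p = Suc k"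
  shows "norm (coef d l * W l p t) \<le> C * min_freq powi (int p - int (Suc k)) * norm (coef d l)"
proof (cases "t \<in> {0..T}")
  case True
  have "norm (W l p t) \<le> C * base_freq \<omega> l powi (int p - int (Suc k))"
    using assms True k by (intro W_bound) auto
  also have "\<dots> \<le> C * min_freq powi (int p - int (Suc k))"
    using assms by (intro mult_left_mono base_powi_nonpos C) auto
  finally show ?thesis
    unfolding norm_mult by (subst mult.commute) (rule mult_right_mono, auto)
next
  case False
  then have "W l p t = 0" using assms T W_left[of t l p] W_right[of p t l] by auto
  then show ?thesis using C min_freq_pos by (simp add: zero_le_power_int)
qed

lemma
  assumes d: "d \<in> h_space \<omega> k" and p: "p \<le> Suc k" "t \<le> T \<or> p = Suc k"
  shows term_summable: "summable (\<lambda>l. coef d l * W l p t)"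
    and partial_bound: "\<bar>partial d N p t\<bar> \<le> majorant d p"
    and partial_tendsto: "(\<lambda>N. partial d N p t) \<longlonglongrightarrow> series d p t"
proof -
  have s: "summable (\<lambda>l. C * min_freq powi (int p - int (Suc k)) * norm (coef d l))"
    by (intro summable_mult coef_summable d)
  show ts: "summable (\<lambda>l. coef d l * W l p t)"
    by (rule summable_comparison_test'[OF s]) (rule term_bound[OF p])
  have "\<bar>partial d N p t\<bar> \<le> norm (\<Sum>l<N. coef d l * W l p t)"
    unfolding partial_def by (rule abs_Re_le_cmod)
  also have "\<dots> \<le> (\<Sum>l<N. C * min_freq powi (int p - int (Suc k)) * norm (coef d l))"
    by (intro sum_norm_le term_bound[OF p])
  also have "\<dots> \<le> majorant d p"
    unfolding majorant_def using C min_freq_pos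
    by (intro sum_le_suminf s) (auto intro!: mult_nonneg_nonneg simp: zero_le_power_int)
  finally show "\<bar>partial d N p t\<bar> \<le> majorant d p" .
  show "(\<lambda>N. partial d N p t) \<longlonglongrightarrow> series d p t"
    unfolding partial_def series_def by (intro tendsto_Re summable_LIMSEQ ts)
qed

lemma jet_partial: "jet (partial d N)"
  unfolding jet_def
proof (intro allI)
  fix p t
  have "((\<lambda>t. \<Sum>l<N. coef d l * W l p t) has_vector_derivative (\<Sum>l<N. coef d l * W l (Suc p) t)) (at t)"
    by (intro has_vector_derivative_sum has_vector_derivative_mult_right jetD jetW)
  from bounded_linear.has_vector_derivative[OF bounded_linear_Re this]
  show "(partial d N p has_vector_derivative partial d N (Suc p) t) (at t)"
    unfolding partial_def .
qed

lemma partial_L2: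
  assumes p: "p \<le> 2*k+1" and A: "finite A"
  shows "(LINT t|leb T. (Re (\<Sum>l\<in>A. coef d l * W l p t))\<^sup>2) \<le> C * (\<Sum>l\<in>A. (amp d (int p - int (Suc k)) l)\<^sup>2)"
proof -
  have c: "continuous_on {0..T} (\<lambda>t. \<Sum>l\<in>A. coef d l * W l p t)"
    by (intro continuous_intros jet_continuous_on jetW)
  have "(LINT t|leb T. (Re (\<Sum>l\<in>A. coef d l * W l p t))\<^sup>2) \<le> (LINT t|leb T. (norm (\<Sum>l\<in>A. coef d l * W l p t))\<^sup>2)"
  proof (rule integral_mono)
    show "(Re z)\<^sup>2 \<le> (norm z)\<^sup>2" for z
      unfolding cmod_power2 by simp
  qed (intro continuous_leb continuous_intros c)+
  also have "\<dots> = integral {0..T} (\<lambda>t. (norm (\<Sum>l\<in>A. coef d l * W l p t))\<^sup>2)"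
    by (intro continuous_leb continuous_intros c)
  also have "\<dots> \<le> C * (\<Sum>l\<in>A. (amp d (int p - int (Suc k)) l)\<^sup>2)"
    unfolding amp_def by (rule W_bessel[OF p A])
  finally show ?thesis .
qed

lemma partial_L2_h_norm:
  assumes d: "d \<in> h_space \<omega> k" and p: "p \<le> 2*k+1"
  shows "(LINT t|leb T. (partial d N p t)\<^sup>2) \<le> C * (2 * h_norm \<omega> (int p - int (Suc k)) d)\<^sup>2"
proof -
  have "(LINT t|leb T. (partial d N p t)\<^sup>2) \<le> C * (\<Sum>l<N. (amp d (int p - int (Suc k)) l)\<^sup>2)"
    unfolding partial_def by (rule partial_L2[OF p]) simp
  also have "\<dots> \<le> C * (2 * h_norm \<omega> (int p - int (Suc k)) d)\<^sup>2"
    using p by (intro mult_left_mono C amp_sq_summable d) auto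
  finally show ?thesis .
qed

text \<open>
  The primitives of the control are the series of the primitives, by dominated convergence and
  because every \<open>W l p\<close> vanishes at \<open>0\<close>.
\<close>
lemma iter_prim_control:
  assumes d: "d \<in> h_space \<omega> k"
  shows "n \<le> Suc k \<Longrightarrow> t \<in> {0..T} \<Longrightarrow> iter_prim (control d) n t = series d (Suc k - n) t"
proof (induction n arbitrary: t)
  case 0
  then show ?case by (simp add: control_def)
next
  case (Suc n)
  define q where "q = k - n"
  have q: "Suc k - n = Suc q" "Suc k - Suc n = q" "q \<le> k" using Suc.prems by (auto simp: q_def)
  have "iter_prim (control d) (Suc n) t = (LINT \<tau>|leb t. series d (Suc q) \<tau>)"
    using Suc q by (auto intro!: Bochner_Integration.integral_cong)
  moreover have "(\<lambda>N. LINT \<tau>|leb t. partial d N (Suc q) \<tau>) \<longlonglongrightarrow> (LINT \<tau>|leb t. series d (Suc q) \<tau>)"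
  proof (rule integral_dominated_convergence[where w = "\<lambda>_. majorant d (Suc q)"])
    show m: "partial d N (Suc q) \<in> borel_measurable (leb t)" for N
      by (intro continuous_leb jet_continuous_on jet_partial)
    have l: "(\<lambda>N. partial d N (Suc q) \<tau>) \<longlonglongrightarrow> series d (Suc q) \<tau>" if "\<tau> \<in> {0<..<t}" for \<tau>
      using that Suc.prems q by (intro partial_tendsto d) auto
    show "series d (Suc q) \<in> borel_measurable (leb t)"
      by (rule borel_measurable_LIMSEQ_metric[of "\<lambda>N. partial d N (Suc q)"]) (use m l in auto)
    show "AE \<tau> in leb t. (\<lambda>N. partial d N (Suc q) \<tau>) \<longlonglongrightarrow> series d (Suc q) \<tau>"
      using l by (intro AE_I2) simp
    show "integrable (leb t) (\<lambda>_. majorant d (Suc q))"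
      by (intro continuous_leb continuous_intros)
    show "AE \<tau> in leb t. norm (partial d N (Suc q) \<tau>) \<le> majorant d (Suc q)" for N
      using Suc.prems q by (intro AE_I2) (auto intro!: partial_bound d)
  qed
  moreover have "(LINT \<tau>|leb t. partial d N (Suc q) \<tau>) = partial d N q t" for N
  proof -
    have "(LINT \<tau>|leb t. partial d N (Suc q) \<tau>) = integral {0..t} (partial d N (Suc q))"
      by (intro continuous_leb jet_continuous_on jet_partial)
    also have "\<dots> = partial d N q t - partial d N q 0"
      using Suc.prems by (intro integral_unique fundamental_theorem_of_calculus)
        (auto intro: has_vector_derivative_at_within jetD[OF jet_partial])
    also have "partial d N q 0 = 0" using T by (simp add: partial_def W_left)
    finally show ?thesis by simp
  qed
  moreover have "(\<lambda>N. partial d N q t) \<longlonglongrightarrow> series d q t"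
    using Suc.prems q by (intro partial_tendsto d) auto
  ultimately have "iter_prim (control d) (Suc n) t = series d q t"
    using LIMSEQ_unique by simp
  then show ?case using q by simp
qed

lemma control_endpoint:
  assumes d: "d \<in> h_space \<omega> k" and n: "n \<in> {2..k+1}"
  shows "iter_prim (control d) n T = 0"
proof -
  have "iter_prim (control d) n T = series d (Suc k - n) T"
    using n T by (intro iter_prim_control d) auto
  also have "\<dots> = 0"
  proof -
    have "Suc k - n < k" using n by auto
    then show ?thesis by (simp add: series_def W_end)
  qed
  finally show ?thesis .
qed

text \<open>
  The integral against \<open>e\<^bsup>i\<omega>\<^sub>j t\<^esup>\<close> of the real part of a partial sum is half the sum of its transform
  at \<open>\<omega>\<^sub>j\<close> and the conjugate of its transform at \<open>-\<omega>\<^sub>j\<close>; by biorthogonality it is \<open>d\<^sub>j\<close> once \<open>N > j\<close>.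
\<close>
lemma control_moment:
  assumes d: "d \<in> h_space \<omega> k"
  shows "(LINT t|leb T. complex_of_real (control d t) * exp (\<i> * of_real (\<omega> j * t))) = d j"
proof -
  let ?e = "\<lambda>t. exp (\<i> * complex_of_real (\<omega> j * t))"
  let ?I = "\<lambda>N. LINT t|leb T. complex_of_real (partial d N (Suc k) t) * ?e t"
  have e: "?e t = cis (\<omega> j * t)" for t by (simp add: cis_conv_exp)
  have lim: "?I \<longlonglongrightarrow> (LINT t|leb T. complex_of_real (control d t) * ?e t)"
  proof (rule integral_dominated_convergence[where w = "\<lambda>_. majorant d (Suc k)"])
    have m: "(\<lambda>t. complex_of_real (partial d N (Suc k) t) * ?e t) \<in> borel_measurable (leb T)" for N
      unfolding e by (intro continuous_leb continuous_intros jet_continuous_on jet_partial)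
    then show "(\<lambda>t. complex_of_real (partial d N (Suc k) t) * ?e t) \<in> borel_measurable (leb T)" for N .
    have l: "(\<lambda>N. complex_of_real (partial d N (Suc k) t) * ?e t) \<longlonglongrightarrow> complex_of_real (control d t) * ?e t" for t
      unfolding control_def by (intro tendsto_intros partial_tendsto d) auto
    show "(\<lambda>t. complex_of_real (control d t) * ?e t) \<in> borel_measurable (leb T)"
      by (rule borel_measurable_LIMSEQ_metric[OF m]) (use l in auto)
    show "AE t in leb T. (\<lambda>N. complex_of_real (partial d N (Suc k) t) * ?e t) \<longlonglongrightarrow> complex_of_real (control d t) * ?e t"
      using l by (intro AE_I2) simp
    show "integrable (leb T) (\<lambda>_. majorant d (Suc k))"
      by (intro continuous_leb continuous_intros)
    show "AE t in leb T. norm (complex_of_real (partial d N (Suc k) t) * ?e t) \<le> majorant d (Suc k)" for N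
      unfolding e norm_mult norm_cis norm_of_real using partial_bound[OF d] by (intro AE_I2) simp
  qed
  have fsum: "fourier T (\<lambda>t. \<Sum>l<N. coef d l * W l (Suc k) t) \<xi> = (\<Sum>l<N. coef d l * fourier T (W l (Suc k)) \<xi>)" for N \<xi>
  proof -
    have "fourier T (\<lambda>t. \<Sum>l<N. coef d l * W l (Suc k) t) \<xi>
       = integral {0..T} (\<lambda>t. \<Sum>l<N. coef d l * (W l (Suc k) t * cis (\<xi> * t)))"
      unfolding fourier_def by (simp only: sum_distrib_right mult.assoc)
    also have "\<dots> = (\<Sum>l<N. integral {0..T} (\<lambda>t. coef d l * (W l (Suc k) t * cis (\<xi> * t))))"
      by (rule integral_sum) (auto intro!: integrable_on_mult_right fourier_integrable jet_continuous_on jetW)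
    finally show ?thesis by (simp only: integral_mult_right fourier_def)
  qed
  have val: "?I N = d j" if "N > j" for N
  proof -
    define g where "g t = (\<Sum>l<N. coef d l * W l (Suc k) t)" for t
    have cg: "continuous_on {0..T} g"
      unfolding g_def by (intro continuous_intros jet_continuous_on jetW)
    \<comment> \<open>\<open>W\<close> is complex-valued: the conjugate half is tested at the frequency \<open>-\<omega>\<^sub>j\<close>\<close>
    have re: "complex_of_real (partial d N (Suc k) t) = (g t + cnj (g t)) / 2" for t
      unfolding partial_def g_def[symmetric] complex_add_cnj by simp
    have i1: "(\<lambda>t. g t * cis (\<omega> j * t)) integrable_on {0..T}" 
      and i2: "(\<lambda>t. g t * cis (- \<omega> j * t)) integrable_on {0..T}"
      by (intro fourier_integrable cg)+
    have i3: "(\<lambda>t. cnj (g t * cis (- \<omega> j * t))) integrable_on {0..T}"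
      by (intro integrable_continuous_real continuous_intros cg)
    have "?I N = integral {0..T} (\<lambda>t. complex_of_real (partial d N (Suc k) t) * ?e t)"
      unfolding e by (intro continuous_leb continuous_intros jet_continuous_on jet_partial)
    also have "\<dots> = integral {0..T} (\<lambda>t. (1/2) * (g t * cis (\<omega> j * t) + cnj (g t * cis (- \<omega> j * t))))"
      unfolding e re by (simp add: cis_cnj field_simps)
    also have "\<dots> = (1/2) * (fourier T g (\<omega> j) + cnj (fourier T g (- \<omega> j)))"
      unfolding fourier_def integral_cnj
      by (simp only: integral_mult_right integral_add[OF i1 i3])
    also have "fourier T g (\<omega> j) = coef d j"
      unfolding g_def fsum W_pos using that by (simp add: if_distrib cong: if_cong)
    also have "fourier T g (- \<omega> j) = (if j = 0 then d 0 else 0)"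
    proof -
      have "coef d l * fourier T (W l (Suc k)) (- \<omega> j) = (if l = 0 then (if j = 0 then d 0 else 0) else 0)" for l
        using W_neg[of j l] W_pos[of 0 0] w0 by (cases "(j, l) = (0, 0)") (auto simp: coef_def)
      then show ?thesis unfolding g_def fsum using that by simp
    qed
    also have "(1/2) * (coef d j + cnj (if j = 0 then d 0 else 0)) = d j"
      using d by (auto simp: coef_def h_space_def Reals_cnj_iff)
    finally show ?thesis .
  qed
  have "?I \<longlonglongrightarrow> d j"
    by (rule tendsto_eventually, rule eventually_mono[OF eventually_gt_at_top[of j]], rule val)
  then show ?thesis using lim LIMSEQ_unique by blast
qed

text \<open>
  The partial sums are test functions, and the tails of the square sums of the coefficients, added
  over the orders \<open>p \<le> k\<close>, serve as common Cauchy rate.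
\<close>
lemma control_sobolev:
  assumes d: "d \<in> h_space \<omega> k"
  shows "control d \<in> sobolev0 T k"
    and "p \<le> k \<Longrightarrow> L2_norm T (weak_deriv T p (control d)) \<le> 2 * sqrt C * h_norm \<omega> (int p) d"
proof -
  define f where "f l = (\<Sum>p\<le>k. (amp d (int p) l)\<^sup>2)" for l
  have sf: "summable f" unfolding f_def by (intro summable_sum amp_sq_summable(1) d) auto
  have f0: "f l \<ge> 0" for l by (simp add: f_def sum_nonneg)
  define e where "e N = C * (suminf f - sum f {..<N})" for N
  have e: "e \<longlonglongrightarrow> 0"
  proof -
    have "(\<lambda>N. C * (suminf f - sum f {..<N})) \<longlonglongrightarrow> C * (suminf f - suminf f)"
      by (intro tendsto_intros summable_LIMSEQ sf)
    then show ?thesis by (simp add: e_def[abs_def])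
  qed
  define F where "F N p = partial d N (p + Suc k)" for N p
  have F: "jet (F N)" for N
    unfolding F_def by (intro jet_shift_order jet_partial)
  have supp: "F N p t = 0" if "t \<notin> {T/4..3*T/4}" for N p t
    using that W_left[of t] W_right[of _ t] by (auto simp: F_def partial_def not_le)
  have lim: "(\<lambda>N. F N 0 t) \<longlonglongrightarrow> control d t" for t
    unfolding F_def control_def by (simp only: add_0) (intro partial_tendsto d; simp)
  have cauchy: "(LINT t|leb T. (F M p t - F N p t)\<^sup>2) \<le> e N" if p: "p \<le> k" and MN: "N \<le> M" for p M N
  proof -
    have "F M p t - F N p t = Re (\<Sum>l\<in>{N..<M}. coef d l * W l (p + Suc k) t)" for t
      using sum_diff_nat_ivl[of 0 N M "\<lambda>l. coef d l * W l (p + Suc k) t"] MN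
      unfolding F_def partial_def atLeast0LessThan minus_complex.simps(1)[symmetric] by simp
    then have "(LINT t|leb T. (F M p t - F N p t)\<^sup>2) \<le> C * (\<Sum>l\<in>{N..<M}. (amp d (int (p + Suc k) - int (Suc k)) l)\<^sup>2)"
      using partial_L2[of "p + Suc k" "{N..<M}" d] p by simp
    also have "\<dots> \<le> C * (\<Sum>l\<in>{N..<M}. f l)"
      unfolding f_def using p by (intro mult_left_mono C sum_mono) (auto intro!: member_le_sum)
    also have "(\<Sum>l\<in>{N..<M}. f l) = sum f {..<M} - sum f {..<N}"
      using sum_diff_nat_ivl[of 0 N M f] MN by (simp add: atLeast0LessThan)
    also have "C * \<dots> \<le> e N"
      unfolding e_def using sum_le_suminf[OF sf, of "{..<M}"] f0 by (intro mult_left_mono C) auto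
    finally show ?thesis .
  qed
  note limit = sobolev0_limit[where F = F and a = "T/4" and b = "3*T/4" and e = e and u = "control d" and k = k]
  have ab: "0 < T/4" "3*T/4 < T" "0 \<le> T" using T by auto
  show "control d \<in> sobolev0 T k"
    by (rule limit(1); (rule F supp ab lim e cauchy; assumption))
  show "L2_norm T (weak_deriv T p (control d)) \<le> 2 * sqrt C * h_norm \<omega> (int p) d" if p: "p \<le> k"
  proof -
    have "L2_norm T (weak_deriv T p (control d)) \<le> sqrt (C * (2 * h_norm \<omega> (int p) d)\<^sup>2)"
    proof -
      have Fb: "(LINT t|leb T. (F N p t)\<^sup>2) \<le> C * (2 * h_norm \<omega> (int p) d)\<^sup>2" for N
        using partial_L2_h_norm[OF d, of "p + Suc k" N] p by (simp add: F_def)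
      show ?thesis
        by (rule limit(2); (rule F supp ab lim e cauchy p Fb; assumption))
    qed
    also have "\<dots> = 2 * sqrt C * h_norm \<omega> (int p) d"
      using h_norm_nonneg[OF d, of "int p"] p by (simp add: real_sqrt_mult power_mult_distrib)
    finally show ?thesis .
  qed
qed

text \<open>
  For negative \<open>m\<close> the first part of the norm is the zeroth moment \<open>|d\<^sub>0|\<close>, and the second is estimated
  through the partial sums of the primitives, which converge pointwise.
\<close>
lemma control_H0_norm:
  assumes d: "d \<in> h_space \<omega> k" and m: "m \<in> {- (int k + 1)..int k}"
  shows "H0_norm T m (control d) \<le> (1 + 2 * sqrt C) * h_norm \<omega> m d"
proof (cases "0 \<le> m")
  case True
  then have "nat m \<le> k" "int (nat m) = m" using m by auto
  then show ?thesis
    using control_sobolev(2)[OF d, of "nat m"] True m h_norm_nonneg[OF d, of m]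
    by (simp add: H0_norm_def distrib_right)
next
  case False
  define n where "n = nat (- m)"
  have n: "1 \<le> n" "n \<le> Suc k" "m = - int n" using False m by (auto simp: n_def)
  have "complex_of_real (LINT t|leb T. control d t) = d 0"
    using control_moment[OF d, of 0] w0 by simp
  then have "\<bar>iter_prim (control d) 1 T\<bar> = norm (d 0)"
    by (metis One_nat_def iter_prim.simps norm_of_real)
  also have "\<dots> \<le> h_norm \<omega> m d"
  proof -
    have "(norm (d 0))\<^sup>2 = (\<Sum>l\<in>{0}. (norm (of_real (h_weight \<omega> m l) * d l))\<^sup>2)"
      using False by (simp add: h_weight_def)
    also have "\<dots> \<le> (h_norm \<omega> m d)\<^sup>2"
      using m by (subst h_norm_sq[OF d]) (auto simp del: sum.insert sum.empty intro!: sum_le_suminf weighted_summable d)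
    finally show ?thesis using h_norm_nonneg[OF d, of m] m by (simp add: power2_le_iff_abs_le)
  qed
  finally have 1: "\<bar>iter_prim (control d) 1 T\<bar> \<le> h_norm \<omega> m d" .
  define q where "q = Suc k - n"
  have q: "q \<le> Suc k" "int q - int (Suc k) = m" using n by (auto simp: q_def)
  have "(LINT t|leb T. (iter_prim (control d) n t)\<^sup>2) \<le> C * (2 * h_norm \<omega> m d)\<^sup>2"
  proof (rule L2_Fatou(2)[where h = "\<lambda>N. partial d N q" and N = 0])
    show pL: "partial d N q \<in> L2_space T" for N
      by (intro L2_continuous jet_continuous_on jet_partial)
    have l: "(\<lambda>N. partial d N q t) \<longlonglongrightarrow> iter_prim (control d) n t" if "t \<in> {0<..<T}" for t
      using that q n iter_prim_control[OF d, of n t] by (simp add: q_def[symmetric]) (intro partial_tendsto d; simp)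
    show "iter_prim (control d) n \<in> borel_measurable (leb T)"
      by (rule borel_measurable_LIMSEQ_metric[of "\<lambda>N. partial d N q"]) (use pL l in \<open>auto simp: L2_space_def\<close>)
    show "AE t in leb T. (\<lambda>N. partial d N q t) \<longlonglongrightarrow> iter_prim (control d) n t"
      using l by (intro AE_I2) simp
    show "(LINT t|leb T. (partial d N q t)\<^sup>2) \<le> C * (2 * h_norm \<omega> m d)\<^sup>2" for N
      using partial_L2_h_norm[OF d, of q N] q by simp
  qed
  then have "L2_norm T (iter_prim (control d) n) \<le> sqrt (C * (2 * h_norm \<omega> m d)\<^sup>2)"
    unfolding L2_norm_def by (rule real_sqrt_le_mono)
  also have "\<dots> = 2 * sqrt C * h_norm \<omega> m d"
    using h_norm_nonneg[OF d, of m] m by (simp add: real_sqrt_mult power_mult_distrib)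
  finally show ?thesis using 1 False by (simp add: H0_norm_def n_def distrib_right)
qed

lemma coef_add: "coef (\<lambda>j. d j + e j) l = coef d l + coef e l"
  by (simp add: coef_def distrib_left)

lemma coef_scale: "coef (\<lambda>j. a * d j) l = a * coef d l"
  by (simp add: coef_def)

lemma control_add:
  assumes "d \<in> h_space \<omega> k" "e \<in> h_space \<omega> k"
  shows "control (\<lambda>j. d j + e j) t = control d t + control e t"
  using term_summable[OF assms(1), of "Suc k" t] term_summable[OF assms(2), of "Suc k" t]
  by (simp add: control_def series_def coef_add distrib_right suminf_add[symmetric])

lemma control_scale:
  assumes "d \<in> h_space \<omega> k"
  shows "control (\<lambda>j. of_real a * d j) t = a * control d t"
  using term_summable[OF assms(1), of "Suc k" t]
  by (simp add: control_def series_def coef_scale mult.assoc suminf_mult)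

lemma square_summable_diff:
  fixes f g :: "nat \<Rightarrow> complex"
  assumes "summable (\<lambda>j. (norm (f j))\<^sup>2)" "summable (\<lambda>j. (norm (g j))\<^sup>2)"
  shows "summable (\<lambda>j. (norm (f j - g j))\<^sup>2)"
proof (rule summable_comparison_test')
  show "summable (\<lambda>j. 2 * (norm (f j))\<^sup>2 + 2 * (norm (g j))\<^sup>2)"
    by (intro summable_add summable_mult assms)
  fix j
  have "(norm (f j - g j))\<^sup>2 \<le> (norm (f j) + norm (g j))\<^sup>2"
    by (intro power_mono norm_triangle_ineq4) simp
  also have "\<dots> \<le> 2 * (norm (f j))\<^sup>2 + 2 * (norm (g j))\<^sup>2"
    using sum_squares_bound[of "norm (f j)" "norm (g j)"] by (simp add: power2_sum)
  finally show "norm ((norm (f j - g j))\<^sup>2) \<le> 2 * (norm (f j))\<^sup>2 + 2 * (norm (g j))\<^sup>2" by simp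
qed

lemma h_space_diff:
  assumes "e \<in> h_space \<omega> k" "d \<in> h_space \<omega> k"
  shows "(\<lambda>j. e j - d j) \<in> h_space \<omega> k"
  using assms by (auto simp: h_space_def right_diff_distrib intro: square_summable_diff Reals_diff)

lemma control_linear: "linear_h_H0 \<omega> T k control"
  unfolding linear_h_H0_def
  using control_sobolev(1) control_add control_scale by (auto intro!: AE_I2)

lemma control_continuous: "continuous_h_H0 \<omega> T k control"
  unfolding continuous_h_H0_def
proof (intro ballI allI impI)
  fix d \<epsilon> assume d: "d \<in> h_space \<omega> k" and e: "(\<epsilon>::real) > 0"
  let ?K = "1 + 2 * sqrt C"
  have K: "?K > 0" using C by (simp add: add_pos_nonneg)
  show "\<exists>\<delta>>0. \<forall>e\<in>h_space \<omega> k. h_norm \<omega> (int k) (\<lambda>j. e j - d j) < \<delta> \<longrightarrow>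
        H0_norm T (int k) (\<lambda>t. control e t - control d t) < \<epsilon>"
  proof (intro exI[of _ "\<epsilon> / ?K"] conjI ballI impI)
    show "\<epsilon> / ?K > 0" using K e by simp
    fix f assume f: "f \<in> h_space \<omega> k" and less: "h_norm \<omega> (int k) (\<lambda>j. f j - d j) < \<epsilon> / ?K"
    have fd: "(\<lambda>j. f j - d j) \<in> h_space \<omega> k" by (rule h_space_diff[OF f d])
    have "control f t - control d t = control (\<lambda>j. f j - d j) t" for t
      using control_add[OF fd d, of t] by simp
    then have "H0_norm T (int k) (\<lambda>t. control f t - control d t) = H0_norm T (int k) (control (\<lambda>j. f j - d j))"
      by simp
    also have "\<dots> \<le> ?K * h_norm \<omega> (int k) (\<lambda>j. f j - d j)"
      by (rule control_H0_norm[OF fd]) auto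
    also have "\<dots> < \<epsilon>"
      using less K by (simp add: field_simps)
    finally show "H0_norm T (int k) (\<lambda>t. control f t - control d t) < \<epsilon>" .
  qed
qed

end

theorem theorem3p10:
  fixes T :: real and k :: nat and \<omega> :: "nat \<Rightarrow> real"
  assumes "T > 0"
    and "k \<ge> 1"
    and "strict_mono \<omega>"
    and "\<And>j. \<omega> j \<ge> 0"
    and "\<omega> 0 = 0"
    and "\<exists>\<epsilon>>0. \<exists>N0::nat. \<exists>c>0. \<forall>j\<ge>N0. \<omega> (Suc j) - \<omega> j \<ge> c * real j powr \<epsilon>"
  shows "\<exists>C>0. \<exists>M :: (nat \<Rightarrow> complex) \<Rightarrow> (real \<Rightarrow> real).
           linear_h_H0 \<omega> T k M \<and> continuous_h_H0 \<omega> T k M \<and>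
           (\<forall>d\<in>h_space \<omega> k.
              M d \<in> sobolev0 T k \<and>
              (\<forall>j. (LINT t|lebesgue_on {0<..<T}.
                      complex_of_real (M d t) * exp (\<i> * of_real (\<omega> j * t))) = d j) \<and>
              (\<forall>n\<in>{2..k+1}. iter_prim (M d) n T = 0) \<and>
              (\<forall>m\<in>{- (int k + 1)..int k}.
                 H0_norm T m (M d) \<le> C * h_norm \<omega> m d))"
proof -
  obtain \<gamma> s where gs: "\<gamma> > 0" "s > 1"
    and gap: "\<And>a b. \<bar>signed_freq \<omega> a - signed_freq \<omega> b\<bar> \<ge> \<gamma> * real_of_int \<bar>a - b\<bar> powr s"
    using signed_freq_gap[OF assms(3,5,6)] by blast
  obtain W C where W: "C \<ge> 0" "\<And>l. jet (W l)"
    "\<And>l p t. t < T/4 \<Longrightarrow> W l p t = 0"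
    "\<And>l p t. p \<ge> Suc k \<Longrightarrow> t > 3*T/4 \<Longrightarrow> W l p t = 0"
    "\<And>l p. p < k \<Longrightarrow> W l p T = 0"
    "\<And>l j. fourier T (W l (Suc k)) (\<omega> j) = (if j = l then 1 else 0)"
    "\<And>l j. (j, l) \<noteq> (0, 0) \<Longrightarrow> fourier T (W l (Suc k)) (- \<omega> j) = 0"
    "\<And>l p t. p \<le> 2*k+1 \<Longrightarrow> t \<in> {0..T} \<Longrightarrow> norm (W l p t) \<le> C * base_freq \<omega> l powi (int p - int (Suc k))"
    "\<And>A c p. p \<le> 2*k+1 \<Longrightarrow> finite A \<Longrightarrow> integral {0..T} (\<lambda>t. (norm (\<Sum>l\<in>A. c l * W l p t))\<^sup>2)
       \<le> C * (\<Sum>l\<in>A. (norm (c l) * base_freq \<omega> l powi (int p - int (Suc k)))\<^sup>2)"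
    by (rule bessel_biorthogonal_family[OF assms(1,3,5) gs gap, of k]) (rule that; assumption)
  have "summable (\<lambda>l. (inverse (\<omega> l))\<^sup>2)"
  proof (rule summable_comparison_test'[where N = 1])
    show "summable (\<lambda>l. (inverse \<gamma>)\<^sup>2 * real l powr (- 2 * s))"
      using gs by (intro summable_mult) (simp add: summable_real_powr_iff)
    fix l :: nat assume "1 \<le> l"
    then have "\<gamma> * real l powr s \<le> \<omega> l" "0 < \<gamma> * real l powr s"
      using gap[of "int l" 0] gs assms(4)[of l] assms(5) by (auto simp: signed_freq_def)
    then have "(inverse (\<omega> l))\<^sup>2 \<le> (inverse (\<gamma> * real l powr s))\<^sup>2"
      using assms(4)[of l] by (intro power_mono le_imp_inverse_le) auto
    also have "\<dots> = (inverse \<gamma>)\<^sup>2 * real l powr (- 2 * s)"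
    proof -
      have "real l powr (2 * s) = real l powr s * real l powr s"
        by (simp only: mult_2 powr_add)
      then show ?thesis by (simp add: powr_minus power2_eq_square)
    qed
    finally show "norm ((inverse (\<omega> l))\<^sup>2) \<le> (inverse \<gamma>)\<^sup>2 * real l powr (- 2 * s)" by simp
  qed
  then interpret moment_synthesis T k \<omega> W C
    using assms(1,2,3,5) W by unfold_locales
  have "1 + 2 * sqrt C > 0" using W(1) by (simp add: add_pos_nonneg)
  then show ?thesis
    using control_linear control_continuous control_sobolev(1) control_moment control_endpoint control_H0_norm
    by (intro exI[of _ "1 + 2 * sqrt C"] exI[of _ control] conjI ballI allI) auto
qed

end
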